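(* Let $\gamma>0$, let $(f_\varepsilon^0,\xi_\varepsilon^0,\eta_\varepsilon^0)_{0<\varepsilon<1}$ be an admissible family of initial data, and for each $\varepsilon\in(0,1)$ let $(f_\varepsilon,\xi_\varepsilon)$ (with velocity $\eta_\varepsilon$ of the charge) be the corresponding global weak solution of the Vlasov-Poisson system with point charge, with $\rho_\varepsilon=\int_{\mathbb{R}^2} f_\varepsilon\,dv$. Let $(\rho,\xi)$ be an accumulation point with vanishing defect measure, that is: let $\varepsilon_n\to0$, $\rho\in C_w(\mathbb{R}_+,\mathcal{M}_+(\mathbb{R}^2))\cap L^\infty(\mathbb{R}_+,H^{-1}(\mathbb{R}^2))$ and $\xi:\mathbb{R}_+\to\mathbb{R}^2$ be such that $\rho_{\varepsilon_n}\to\rho$ in $C_w(\mathbb{R}_+,\mathcal{M}_+(\mathbb{R}^2))$, $\xi_{\varepsilon_n}\to\xi$ in $C^{1/2}([0,T],\mathbb{R}^2)$ for all $T>0$, and such that for all $\Phi\in C_c^\infty(\mathbb{R}_+\times\mathbb{R}^2)$, $$\frac{d}{dt}\int_{\mathbb{R}^2}\Phi(t,x)\,d(\rho(t)+\gamma\delta_{\xi(t)})(x)=\int_{\mathbb{R}^2}\partial_t\Phi(t,x)\,d(\rho(t)+\gamma\delta_{\xi(t)})(x)+\mathcal{H}_{\Phi(t)}[\rho(t)+\gamma\delta_{\xi(t)},\rho(t)+\gamma\delta_{\xi(t)}]$$ in the sense of distributions on $\mathbb{R}_+$. If moreover $\rho\in L^\infty_{\mathrm{loc}}(\mathbb{R}_+,L^p(\mathbb{R}^2))$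 for some $p>2$ and $\xi\in C^1(\mathbb{R}_+,\mathbb{R}^2)$, then, with $E=\frac{x}{|x|^2}*\rho$, $(\rho,\xi)$ satisfies the system $$\begin{cases}\partial_t\rho+\Big(E^\perp+\gamma\dfrac{(x-\xi)^\perp}{|x-\xi|^2}\Big)\cdot\nabla\rho=0,\\[2mm] \dot\xi(t)=E^\perp(t,\xi(t)),\end{cases}$$ the first equation being understood in the sense of distributions.
   Context: Notation. $\mathbb{R}_+=[0,\infty)$; $(x_1,x_2)^\perp=(-x_2,x_1)$. $\mathcal{M}_+(\Omega)$ is the space of bounded positive Radon measures on $\Omega$; $C_0(\Omega)$ is the space of continuous functions vanishing at infinity. $\rho\in C_w(\mathbb{R}_+,\mathcal{M}_+(\Omega))$ means $\rho(t)\in\mathcal{M}_+(\Omega)$ for all $t$ and $t\mapsto\int\Phi\,d\rho(t)$ is continuous for all $\Phi\in C_0(\Omega)$; $\rho_n\to\rho$ in $C_w(\mathbb{R}_+,\mathcal{M}_+(\Omega))$ means $\sup_{t\in[0,T]}\left|\int\Phi\,d\rho_n(t)-\int\Phi\,d\rho(t)\right|\to0$ for all $T>0$, $\Phi\in C_0(\Omega)$. Since the velocity field $E^\perp+\gamma(x-\xi)^\perp/|x-\xi|^2$ is divergence free, the transport term in the first equation is $\nabla\cdot\big((E^\perp+\gamma\frac{(x-\xi)^\perp}{|x-\xi|^2})\rho\big)$ in the sense of distributions. For $\rho\in L^\infty_{\mathrm{loc}}(\mathbb{R}_+,L^1\cap L^p(\mathbb{R}^2))$, $p>2$, $E$ is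 in $L^\infty_{\mathrm{loc}}(\mathbb{R}_+,L^\infty\cap C^{0,1-2/p})$. Nonlinear term. For $\rho,\mu\in\mathcal{M}_+(\mathbb{R}^2)$ and $\Phi\in C_c^\infty(\mathbb{R}^2)$, $\mathcal{H}_\Phi[\rho,\mu]=\frac12\iint_{\mathbb{R}^2\times\mathbb{R}^2}H_\Phi(x,y)\,d\rho(x)\,d\mu(y)$, where $H_\Phi(x,y)=\frac{(x-y)^\perp}{|x-y|^2}\cdot(\nabla\Phi(x)-\nabla\Phi(y))$ if $x\ne y$ and $H_\Phi(x,x)=0$. System. For $\varepsilon\in(0,1)$, with unknowns $f_\varepsilon(t,x,v)$, $\xi_\varepsilon(t)$, $\eta_\varepsilon(t)$, $(x,v)\in\mathbb{R}^2\times\mathbb{R}^2$: $$\partial_tf_\varepsilon+\frac v\varepsilon\cdot\nabla_xf_\varepsilon+\Big(\frac{v^\perp}{\varepsilon^2}+\frac{E_\varepsilon}{\varepsilon}+\frac\gamma\varepsilon\frac{x-\xi_\varepsilon}{|x-\xi_\varepsilon|^2}\Big)\cdot\nabla_vf_\varepsilon=0,\quad E_\varepsilon=\frac{x}{|x|^2}*\rho_\varepsilon,\quad \rho_\varepsilon=\int_{\mathbb{R}^2}f_\varepsilon\,dv,$$ $$\dot\xi_\varepsilon=\frac{\eta_\varepsilon}{\varepsilon},\qquad \dot\eta_\varepsilon=\gamma\Big(\frac{\eta_\varepsilon^\perp}{\varepsilon^2}+\frac{E_\varepsilon(t,\xi_\varepsilon)}{\varepsilon}\Big),$$ with $f_\varepsilon(0)=f_\varepsilon^0$,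 $(\xi_\varepsilon,\eta_\varepsilon)(0)=(\xi_\varepsilon^0,\eta_\varepsilon^0)$. Energy. For $\rho=\int f\,dv$, $\mathcal{H}(f,\xi,\eta)=\frac12\iint|v|^2f\,dx\,dv+\frac12|\eta|^2-\frac12\iint\ln|x-y|\rho(x)\rho(y)\,dx\,dy-\gamma\int\ln|x-\xi|\rho(x)\,dx$. Admissible family of initial data: a family $(f_\varepsilon^0,\xi_\varepsilon^0,\eta_\varepsilon^0)_{0<\varepsilon<1}$, $\xi_\varepsilon^0,\eta_\varepsilon^0\in\mathbb{R}^2$, $\rho_\varepsilon^0=\int f_\varepsilon^0\,dv$, such that: (a) for each $\varepsilon$, $f_\varepsilon^0\in L^1\cap L^\infty(\mathbb{R}^2\times\mathbb{R}^2)$, $f_\varepsilon^0\ge0$, $f_\varepsilon^0$ is compactly supported and $\operatorname{supp}f_\varepsilon^0\subset\{(x,v):|x-\xi_\varepsilon^0|\ge\delta_\varepsilon\}$ for some $\delta_\varepsilon>0$; (b) $\sup_{0<\varepsilon<1}\big(\|f_\varepsilon^0\|_{L^1}+\int|x|^2\rho_\varepsilon^0\,dx+|\xi_\varepsilon^0|\big)<\infty$ and $\sup_{0<\varepsilon<1}\mathcal{H}(f_\varepsilon^0,\xi_\varepsilon^0,\eta_\varepsilon^0)<\infty$; (c) $\varepsilon^2\|f_\varepsilon^0\|_{L^\infty}\to0$ as $\varepsilon\to0$; (d) $\sup_{0<\varepsilon<1}\|f_\varepsilon^0\|_{L^1}<1$. Solution. For data as in (a) the system has (Caprino-Marchioro)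 a unique global solution, with $f_\varepsilon\in L^\infty(\mathbb{R}_+,L^1\cap L^\infty)$ and $f_\varepsilon(t)$ compactly supported; it satisfies $f_\varepsilon(t)=(X_\varepsilon(t),V_\varepsilon(t))_\#f_\varepsilon^0$, where $(X_\varepsilon,V_\varepsilon)(t,x,v)$ is the flow of $\dot X=V/\varepsilon$, $\dot V=\varepsilon^{-2}\big(V^\perp+\varepsilon E_\varepsilon(t,X)+\varepsilon\gamma\frac{X-\xi_\varepsilon}{|X-\xi_\varepsilon|^2}\big)$, $(X,V)(0)=(x,v)$; if $x\neq\xi_\varepsilon^0$ then $X_\varepsilon(t,x,v)\ne\xi_\varepsilon(t)$ for all $t$. This is "the corresponding global weak solution". *)

theory Defs
  imports "HOL-Probability.Probability"
begin

primrec Ck :: "nat \<Rightarrow> ('a::euclidean_space \<Rightarrow> real) \<Rightarrow> bool" where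
  "Ck 0 f \<longleftrightarrow> continuous_on UNIV f"
| "Ck (Suc k) f \<longleftrightarrow>
     f differentiable_on UNIV \<and> (\<forall>v. Ck k (\<lambda>x. frechet_derivative f (at x) v))"

text \<open>The class of test functions on an open set \<open>U\<close>, extended by zero to the whole space.
  Smooth compactly supported functions on a closed half space \<open>[0,\<infinity>) \<times> V\<close>, smooth up to the
  boundary, are exactly the restrictions of test functions on \<open>\<real> \<times> V\<close> (Seeley extension); below
  they are represented by such extensions, of which only the values at times \<open>t \<ge> 0\<close> enter.\<close>

definition test_function :: "'a::euclidean_space set \<Rightarrow> ('a \<Rightarrow> real) \<Rightarrow> bool" where
  "test_function U \<phi> \<longleftrightarrow>
     (\<forall>k. Ck k \<phi>) \<and> compact (closure {x. \<phi> x \<noteq> 0}) \<and> closure {x. \<phi> x \<noteq> 0} \<subseteq> U"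

definition grad :: "('a::euclidean_space \<Rightarrow> real) \<Rightarrow> 'a \<Rightarrow> 'a" where
  "grad \<Phi> x = (\<Sum>b\<in>Basis. frechet_derivative \<Phi> (at x) b *\<^sub>R b)"

definition L1_norm :: "('a::euclidean_space \<Rightarrow> real) \<Rightarrow> real" where
  "L1_norm g = (LINT z|lborel. \<bar>g z\<bar>)"

definition Linf_norm :: "('a::euclidean_space \<Rightarrow> real) \<Rightarrow> ennreal" where
  "Linf_norm g = esssup lborel (\<lambda>z. ennreal \<bar>g z\<bar>)"

text \<open>Support of a function defined almost everywhere: complement of the largest open set on
  which the function vanishes almost everywhere.\<close>

definition ess_support :: "('a::euclidean_space \<Rightarrow> real) \<Rightarrow> 'a set" where
  "ess_support g = - \<Union>{U. open U \<and> (AE z in lborel. z \<in> U \<longrightarrow> g z = 0)}"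

definition C0_function :: "('a::euclidean_space \<Rightarrow> real) \<Rightarrow> bool" where
  "C0_function \<Phi> \<longleftrightarrow> continuous_on UNIV \<Phi> \<and> (\<Phi> \<longlongrightarrow> 0) at_infinity"

text \<open>Every finite Borel measure on a Euclidean space is a Radon measure.\<close>

definition Mplus :: "('a::euclidean_space) measure \<Rightarrow> bool" where
  "Mplus \<mu> \<longleftrightarrow> sets \<mu> = sets borel \<and> finite_measure \<mu>"

definition in_Cw :: "(real \<Rightarrow> ('a::euclidean_space) measure) \<Rightarrow> bool" where
  "in_Cw \<mu> \<longleftrightarrow> (\<forall>t\<ge>0. Mplus (\<mu> t)) \<and>
     (\<forall>\<Phi>. C0_function \<Phi> \<longrightarrow> continuous_on {0..} (\<lambda>t. LINT x|\<mu> t. \<Phi> x))"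

definition Cw_tendsto ::
  "(nat \<Rightarrow> real \<Rightarrow> ('a::euclidean_space) measure) \<Rightarrow> (real \<Rightarrow> 'a measure) \<Rightarrow> bool" where
  "Cw_tendsto \<mu>n \<mu> \<longleftrightarrow> (\<forall>T>0. \<forall>\<Phi>. C0_function \<Phi> \<longrightarrow>
     uniform_limit {0..T} (\<lambda>n t. LINT x|\<mu>n n t. \<Phi> x) (\<lambda>t. LINT x|\<mu> t. \<Phi> x) sequentially)"

definition H1_norm :: "('a::euclidean_space \<Rightarrow> real) \<Rightarrow> real" where
  "H1_norm \<phi> = sqrt (LINT x|lborel. (\<phi> x)\<^sup>2 + (norm (grad \<phi> x))\<^sup>2)"

text \<open>\<open>H\<^sup>-\<^sup>1\<close> is the dual of \<open>H\<^sup>1\<close>, in which smooth compactly supported functions are dense.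
  Measurability in time is not required separately in the following two classes, since it
  follows from weak continuity of \<open>\<mu>\<close>.\<close>

definition in_Linf_Hm1 :: "(real \<Rightarrow> ('a::euclidean_space) measure) \<Rightarrow> bool" where
  "in_Linf_Hm1 \<mu> \<longleftrightarrow> (\<exists>C. AE t in lborel. 0 \<le> t \<longrightarrow>
     (\<forall>\<phi>. test_function UNIV \<phi> \<longrightarrow> \<bar>LINT x|\<mu> t. \<phi> x\<bar> \<le> C * H1_norm \<phi>))"

definition in_Linf_loc_Lp :: "real \<Rightarrow> (real \<Rightarrow> ('a::euclidean_space) measure) \<Rightarrow> bool" where
  "in_Linf_loc_Lp p \<mu> \<longleftrightarrow> (\<forall>T>0. \<exists>C. AE t in lborel. t \<in> {0..T} \<longrightarrow>
     (\<exists>g \<in> borel_measurable lborel. (\<forall>x. 0 \<le> g x) \<and> \<mu> t = density lborel (\<lambda>x. ennreal (g x)) \<and>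
        integrable lborel (\<lambda>x. \<bar>g x\<bar> powr p) \<and>
        (LINT x|lborel. \<bar>g x\<bar> powr p) powr (1 / p) \<le> C))"

definition holder_norm :: "real \<Rightarrow> real \<Rightarrow> (real \<Rightarrow> 'a::real_normed_vector) \<Rightarrow> ennreal" where
  "holder_norm \<alpha> T g =
     (SUP t\<in>{0..T}. ennreal (norm (g t))) +
     (SUP (s, t)\<in>{(s, t). s \<in> {0..T} \<and> t \<in> {0..T} \<and> s \<noteq> t}.
        ennreal (norm (g t - g s) / \<bar>t - s\<bar> powr \<alpha>))"

definition C1_halfline :: "(real \<Rightarrow> 'a::real_normed_vector) \<Rightarrow> bool" where
  "C1_halfline g \<longleftrightarrow> (\<exists>g'. continuous_on {0..} g' \<and>
     (\<forall>t\<ge>0. (g has_vector_derivative g' t) (at t within {0..})))"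

definition perp :: "real^2 \<Rightarrow> real^2" where
  "perp x = vector [- (x $ 2), x $ 1]"

definition coulomb :: "real^2 \<Rightarrow> real^2" where
  "coulomb x = x /\<^sub>R (norm x)\<^sup>2"

definition efield :: "(real^2) measure \<Rightarrow> real^2 \<Rightarrow> real^2" where
  "efield \<mu> x = (LINT y|\<mu>. coulomb (x - y))"

definition H_kernel :: "(real^2 \<Rightarrow> real) \<Rightarrow> real^2 \<Rightarrow> real^2 \<Rightarrow> real" where
  "H_kernel \<Phi> x y =
     (if x = y then 0 else (perp (x - y) /\<^sub>R (norm (x - y))\<^sup>2) \<bullet> (grad \<Phi> x - grad \<Phi> y))"

definition vortex_interaction ::
  "(real^2 \<Rightarrow> real) \<Rightarrow> (real^2) measure \<Rightarrow> (real^2) measure \<Rightarrow> real" where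
  "vortex_interaction \<Phi> \<rho> \<mu> = 1/2 * (LINT (x, y)|(\<rho> \<Otimes>\<^sub>M \<mu>). H_kernel \<Phi> x y)"

definition measure_plus :: "('a::topological_space) measure \<Rightarrow> 'a measure \<Rightarrow> 'a measure" where
  "measure_plus \<mu> \<nu> = measure_of UNIV (sets borel) (\<lambda>A. emeasure \<mu> A + emeasure \<nu> A)"

lemma sets_measure_plus: "sets (measure_plus \<mu> \<nu>) = sets borel"
proof -
  have "sigma_sets UNIV (sets (borel :: 'a measure)) = sets borel"
    using sets.sigma_sets_eq[of "borel :: 'a measure"] by simp
  then show ?thesis
    by (simp add: measure_plus_def)
qed

lemma emeasure_measure_plus:
  fixes \<mu> \<nu> :: "('a::topological_space) measure"
  assumes "sets \<mu> = sets borel" "sets \<nu> = sets borel" "A \<in> sets borel"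
  shows "emeasure (measure_plus \<mu> \<nu>) A = emeasure \<mu> A + emeasure \<nu> A"
proof (rule emeasure_measure_of[OF measure_plus_def])
  show "countably_additive (sets (measure_plus \<mu> \<nu>)) (\<lambda>A. emeasure \<mu> A + emeasure \<nu> A)"
  proof (rule countably_additiveI)
    fix B :: "nat \<Rightarrow> 'a set"
    assume "range B \<subseteq> sets (measure_plus \<mu> \<nu>)" "disjoint_family B"
    then have "range B \<subseteq> sets \<mu>" "range B \<subseteq> sets \<nu>"
      using assms by (auto simp: sets_measure_plus)
    then show "(\<Sum>i. emeasure \<mu> (B i) + emeasure \<nu> (B i)) = emeasure \<mu> (\<Union> (range B)) + emeasure \<nu> (\<Union> (range B))"
      using \<open>disjoint_family B\<close> by (simp add: suminf_add[symmetric] suminf_emeasure)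
  qed
qed (use assms in \<open>auto simp: sets_measure_plus positive_def\<close>)

definition add_charge :: "real \<Rightarrow> (real^2) measure \<Rightarrow> real^2 \<Rightarrow> (real^2) measure" where
  "add_charge \<gamma> \<mu> a = measure_plus \<mu> (scale_measure (ennreal \<gamma>) (return borel a))"

definition spatial_density :: "((real^2) \<times> (real^2) \<Rightarrow> real) \<Rightarrow> real^2 \<Rightarrow> real" where
  "spatial_density g x = (LINT v|lborel. g (x, v))"

definition spatial_measure :: "((real^2) \<times> (real^2) \<Rightarrow> real) \<Rightarrow> (real^2) measure" where
  "spatial_measure g = density lborel (\<lambda>x. ennreal (spatial_density g x))"

definition energy :: "real \<Rightarrow> ((real^2) \<times> (real^2) \<Rightarrow> real) \<Rightarrow> real^2 \<Rightarrow> real^2 \<Rightarrow> real" where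
  "energy \<gamma> g \<xi> \<eta> =
     1/2 * (LINT (x, v)|lborel. (norm v)\<^sup>2 * g (x, v)) + 1/2 * (norm \<eta>)\<^sup>2
     - 1/2 * (LINT (x, y)|lborel. ln (norm (x - y)) * spatial_density g x * spatial_density g y)
     - \<gamma> * (LINT x|lborel. ln (norm (x - \<xi>)) * spatial_density g x)"

definition admissible_datum :: "((real^2) \<times> (real^2) \<Rightarrow> real) \<Rightarrow> real^2 \<Rightarrow> bool" where
  "admissible_datum g \<xi> \<longleftrightarrow>
     integrable lborel g \<and> Linf_norm g < \<infinity> \<and> (AE z in lborel. 0 \<le> g z) \<and>
     compact (ess_support g) \<and> (\<exists>\<delta>>0. ess_support g \<subseteq> {(x, v). \<delta> \<le> norm (x - \<xi>)})"

definition admissible_family ::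
  "real \<Rightarrow> (real \<Rightarrow> (real^2) \<times> (real^2) \<Rightarrow> real) \<Rightarrow> (real \<Rightarrow> real^2) \<Rightarrow> (real \<Rightarrow> real^2) \<Rightarrow> bool" where
  "admissible_family \<gamma> f0 \<xi>0 \<eta>0 \<longleftrightarrow>
     (\<forall>\<epsilon>\<in>{0<..<1}. admissible_datum (f0 \<epsilon>) (\<xi>0 \<epsilon>)) \<and>
     bdd_above ((\<lambda>\<epsilon>. L1_norm (f0 \<epsilon>) + (LINT x|lborel. (norm x)\<^sup>2 * spatial_density (f0 \<epsilon>) x)
                      + norm (\<xi>0 \<epsilon>)) ` {0<..<1}) \<and>
     bdd_above ((\<lambda>\<epsilon>. energy \<gamma> (f0 \<epsilon>) (\<xi>0 \<epsilon>) (\<eta>0 \<epsilon>)) ` {0<..<1}) \<and>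
     ((\<lambda>\<epsilon>. ennreal (\<epsilon>\<^sup>2) * Linf_norm (f0 \<epsilon>)) \<longlongrightarrow> 0) (at_right 0) \<and>
     (SUP \<epsilon>\<in>{0<..<1}. L1_norm (f0 \<epsilon>)) < 1"

definition vp_force :: "real \<Rightarrow> real \<Rightarrow> (real^2) measure \<Rightarrow> real^2 \<Rightarrow> real^2 \<Rightarrow> real^2 \<Rightarrow> real^2" where
  "vp_force \<gamma> \<epsilon> \<rho> \<xi> x v =
     perp v /\<^sub>R \<epsilon>\<^sup>2 + efield \<rho> x /\<^sub>R \<epsilon> + (\<gamma> / \<epsilon>) *\<^sub>R coulomb (x - \<xi>)"

text \<open>\<open>frechet_derivative \<Phi> (at (t, x, v)) (1, a, b)\<close> is
  \<open>\<partial>\<^sub>t\<Phi> + a \<bullet> \<nabla>\<^sub>x\<Phi> + b \<bullet> \<nabla>\<^sub>v\<Phi>\<close>; the advecting field is divergence free in \<open>(x, v)\<close>.\<close>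

definition vp_weak_form ::
  "real \<Rightarrow> real \<Rightarrow> ((real^2) \<times> (real^2) \<Rightarrow> real) \<Rightarrow> (real \<Rightarrow> (real^2) \<times> (real^2) \<Rightarrow> real) \<Rightarrow> (real \<Rightarrow> real^2) \<Rightarrow> bool"
  where
  "vp_weak_form \<gamma> \<epsilon> f0 f \<xi> \<longleftrightarrow> (\<forall>\<Phi>. test_function UNIV \<Phi> \<longrightarrow>
     (LINT t:{0..}|lborel. LINT (x, v)|lborel. f t (x, v) *
        frechet_derivative \<Phi> (at (t, x, v))
          (1, v /\<^sub>R \<epsilon>, vp_force \<gamma> \<epsilon> (spatial_measure (f t)) (\<xi> t) x v))
     + (LINT z|lborel. f0 z * \<Phi> (0, z)) = 0)"

definition vp_charge_ode ::
  "real \<Rightarrow> real \<Rightarrow> real^2 \<Rightarrow> real^2 \<Rightarrow> (real \<Rightarrow> (real^2) \<times> (real^2) \<Rightarrow> real)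
     \<Rightarrow> (real \<Rightarrow> real^2) \<Rightarrow> (real \<Rightarrow> real^2) \<Rightarrow> bool" where
  "vp_charge_ode \<gamma> \<epsilon> \<xi>0 \<eta>0 f \<xi> \<eta> \<longleftrightarrow> \<xi> 0 = \<xi>0 \<and> \<eta> 0 = \<eta>0 \<and>
     (\<forall>t\<ge>0. (\<xi> has_vector_derivative (\<eta> t /\<^sub>R \<epsilon>)) (at t within {0..}) \<and>
            (\<eta> has_vector_derivative
               \<gamma> *\<^sub>R (perp (\<eta> t) /\<^sub>R \<epsilon>\<^sup>2 + efield (spatial_measure (f t)) (\<xi> t) /\<^sub>R \<epsilon>)) (at t within {0..}))"

text \<open>The flow is only prescribed for starting points with \<open>x \<noteq> \<xi>0\<close>, i.e. outside a null set; its
  values on that null set are irrelevant up to the measurability needed for the push-forward.\<close>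

definition vp_flow ::
  "real \<Rightarrow> real \<Rightarrow> real^2 \<Rightarrow> (real \<Rightarrow> (real^2) \<times> (real^2) \<Rightarrow> real) \<Rightarrow> (real \<Rightarrow> real^2)
     \<Rightarrow> (real \<Rightarrow> (real^2) \<times> (real^2) \<Rightarrow> real^2) \<Rightarrow> (real \<Rightarrow> (real^2) \<times> (real^2) \<Rightarrow> real^2) \<Rightarrow> bool" where
  "vp_flow \<gamma> \<epsilon> \<xi>0 f \<xi> X V \<longleftrightarrow>
     (\<forall>t\<ge>0. (\<lambda>z. (X t z, V t z)) \<in> borel_measurable borel) \<and>
     (\<forall>x v. x \<noteq> \<xi>0 \<longrightarrow> X 0 (x, v) = x \<and> V 0 (x, v) = v \<and>
        (\<forall>t\<ge>0. X t (x, v) \<noteq> \<xi> t \<and>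
           ((\<lambda>s. X s (x, v)) has_vector_derivative V t (x, v) /\<^sub>R \<epsilon>) (at t within {0..}) \<and>
           ((\<lambda>s. V s (x, v)) has_vector_derivative
              vp_force \<gamma> \<epsilon> (spatial_measure (f t)) (\<xi> t) (X t (x, v)) (V t (x, v))) (at t within {0..})))"

definition vp_global_solution ::
  "real \<Rightarrow> real \<Rightarrow> ((real^2) \<times> (real^2) \<Rightarrow> real) \<Rightarrow> real^2 \<Rightarrow> real^2
     \<Rightarrow> (real \<Rightarrow> (real^2) \<times> (real^2) \<Rightarrow> real) \<Rightarrow> (real \<Rightarrow> real^2) \<Rightarrow> (real \<Rightarrow> real^2) \<Rightarrow> bool" where
  "vp_global_solution \<gamma> \<epsilon> f0 \<xi>0 \<eta>0 f \<xi> \<eta> \<longleftrightarrow>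
     (\<forall>t\<ge>0. integrable lborel (f t) \<and> (AE z in lborel. 0 \<le> f t z) \<and> compact (ess_support (f t))) \<and>
     (\<exists>C. AE t in lborel. 0 \<le> t \<longrightarrow> L1_norm (f t) \<le> C \<and> Linf_norm (f t) \<le> ennreal C) \<and>
     (AE z in lborel. f 0 z = f0 z) \<and>
     vp_weak_form \<gamma> \<epsilon> f0 f \<xi> \<and>
     vp_charge_ode \<gamma> \<epsilon> \<xi>0 \<eta>0 f \<xi> \<eta> \<and>
     (\<exists>X V. vp_flow \<gamma> \<epsilon> \<xi>0 f \<xi> X V \<and>
        (\<forall>t\<ge>0. density lborel (\<lambda>z. ennreal (f t z)) =
           distr (density lborel (\<lambda>z. ennreal (f0 z))) borel (\<lambda>z. (X t z, V t z))))"

text \<open>\<open>d/dt \<langle>\<Phi>(t), \<mu>(t)\<rangle> = \<langle>\<partial>\<^sub>t\<Phi>(t), \<mu>(t)\<rangle> + \<H>\<^bsub>\<Phi>(t)\<^esub>[\<mu>(t), \<mu>(t)]\<close> as distributions on the open half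
  line, for every \<open>\<Phi>\<close> smooth and compactly supported in \<open>[0,\<infinity>) \<times> \<real>\<^sup>2\<close>; \<open>\<theta>\<close> is the test function in
  time.\<close>

definition vortex_equation :: "(real \<Rightarrow> (real^2) measure) \<Rightarrow> bool" where
  "vortex_equation \<mu> \<longleftrightarrow>
     (\<forall>\<Phi> :: real \<times> (real^2) \<Rightarrow> real. test_function UNIV \<Phi> \<longrightarrow>
       (\<forall>\<theta> :: real \<Rightarrow> real. test_function {0<..} \<theta> \<longrightarrow>
          - (LINT t:{0<..}|lborel. deriv \<theta> t * (LINT x|\<mu> t. \<Phi> (t, x))) =
          (LINT t:{0<..}|lborel. \<theta> t *
             ((LINT x|\<mu> t. frechet_derivative \<Phi> (at (t, x)) (1, 0)) +
              vortex_interaction (\<lambda>x. \<Phi> (t, x)) (\<mu> t) (\<mu> t)))))"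

text \<open>\<open>\<partial>\<^sub>t\<rho> + \<nabla>\<cdot>(u\<rho>) = 0\<close> as distributions on \<open>(0,\<infinity>) \<times> \<real>\<^sup>2\<close>. Integrability of the pairing is part of
  the definition, because the Bochner integral of a non-integrable function is \<open>0\<close>.\<close>

definition transport_distributional ::
  "(real \<Rightarrow> real^2 \<Rightarrow> real^2) \<Rightarrow> (real \<Rightarrow> (real^2) measure) \<Rightarrow> bool" where
  "transport_distributional u \<rho> \<longleftrightarrow>
     (\<forall>\<phi> :: real \<times> (real^2) \<Rightarrow> real. test_function ({0<..} \<times> UNIV) \<phi> \<longrightarrow>
        (AE t in lborel. 0 < t \<longrightarrow>
           integrable (\<rho> t) (\<lambda>x. frechet_derivative \<phi> (at (t, x)) (1, u t x))) \<and>
        set_integrable lborel {0<..}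
          (\<lambda>t. LINT x|\<rho> t. frechet_derivative \<phi> (at (t, x)) (1, u t x)) \<and>
        (LINT t:{0<..}|lborel. LINT x|\<rho> t. frechet_derivative \<phi> (at (t, x)) (1, u t x)) = 0)"

end

theory Submission
  imports Defs "HOL-Computational_Algebra.Polynomial"
begin

text \<open>
The vortex equation is one identity for the measure \<open>\<mu> = \<rho> + \<gamma> \<delta>\<^sub>\<xi>\<close>; the theorem says that it decouples into
an equation for \<open>\<rho>\<close> and one for \<open>\<xi>\<close>. The kernel \<open>K = coulomb\<close> is odd, so symmetrization turns the
interaction term into \<open>\<integral> \<nabla>\<Phi> \<bullet> E\<^sub>\<mu>\<^sup>\<bottom> d\<mu>\<close> as soon as \<open>K(x - y)\<close> is integrable for \<open>\<mu> \<otimes> \<mu>\<close>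
(lemma \<open>vortex_interaction_eq\<close>; \<open>\<bottom>\<close> stands for \<open>perp\<close>). Here \<open>E\<^sub>\<mu>(x) = E(x) + \<gamma> K(x - \<xi>)\<close>, and the charge does
not act on itself because \<open>K 0 = 0\<close>. Splitting the integral over \<open>\<mu>\<close> into its two parts, and subtracting
the total derivative of \<open>t \<mapsto> \<phi>(t, \<xi>(t))\<close>, which integrates to zero, leaves
\<open>\<integral>\<integral> (\<partial>\<^sub>t\<phi> + u \<bullet> \<nabla>\<phi>) d\<rho>(t) dt = \<gamma> \<integral> \<nabla>\<phi>(t, \<xi>(t)) \<bullet> (\<xi>'(t) - E\<^sup>\<bottom>(t, \<xi>(t))) dt\<close>
with \<open>u = E\<^sup>\<bottom> + \<gamma> (x - \<xi>)\<^sup>\<bottom> / |x - \<xi>|\<^sup>2\<close> (lemma \<open>transport_defect_identity\<close>).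

The two sides behave differently under localization at a point of the trajectory. For \<open>p > 2\<close> the density
\<open>\<rho> (1 + |u|)\<close> has uniformly small integrals over small balls, whereas the right-hand side only sees
\<open>\<nabla>\<phi>\<close> on a curve. Test functions \<open>\<tau> \<phi>((t - t\<^sub>0) / \<tau>, (x - \<xi>(t\<^sub>0)) / \<tau>)\<close> have gradients bounded independently
of \<open>\<tau>\<close>, with a prescribed value on the trajectory near \<open>t\<^sub>0\<close>, and their supports shrink to a point:
as \<open>\<tau> \<rightarrow> 0\<close> the left-hand side is \<open>o(\<tau>)\<close> and the right-hand side is of order \<open>\<tau>\<close> unless
\<open>\<xi>'(t\<^sub>0) = E\<^sup>\<bottom>(t\<^sub>0, \<xi>(t\<^sub>0))\<close> (lemma \<open>slip_eq_0_interior\<close>). This is the equation of the charge, and with it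
the right-hand side vanishes for every \<open>\<phi>\<close>, which is the transport equation.

The analysis behind this is the estimate of \<open>\<integral> |K(x - y)| d\<rho>(t)(y)\<close> near the singularity. Young's inequality
gives it for almost every \<open>t\<close>, from the \<open>L\<^sup>p\<close> bound (lemma \<open>Lp_density_singular_integral_small\<close>). Weak
continuity, applied to regularized kernels, extends it to every \<open>t\<close> (lemma \<open>coulomb_cut_uniform\<close>), and
uniform approximation then shows that \<open>E\<close> and all the pairings above are continuous in time. A uniform bound
on the mass of \<open>\<rho>(t)\<close> comes from the particle densities, whose mass is conserved by the flow.
\<close>

section \<open>Smooth cut-off functions\<close>

lemma Ck_SucI:
  assumes "\<And>x. (f has_derivative f' x) (at x)" and "\<And>v. Ck k (\<lambda>x. f' x v)"
  shows "Ck (Suc k) f"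
proof -
  have "frechet_derivative f (at x) = f' x" for x
    using frechet_derivative_at[OF assms(1)] by simp
  moreover have "f differentiable_on UNIV"
    using assms(1) by (auto simp: differentiable_on_def differentiable_def)
  ultimately show ?thesis
    using assms(2) by simp
qed

lemma Ck_Suc_has_derivative:
  assumes "Ck (Suc k) f"
  shows "(f has_derivative frechet_derivative f (at x)) (at x)"
  using assms by (simp add: differentiable_on_def frechet_derivative_works)

lemma Ck_Suc_derivative: "Ck (Suc k) f \<Longrightarrow> Ck k (\<lambda>x. frechet_derivative f (at x) v)"
  by simp

lemma Ck_decreasing: "Ck (Suc k) f \<Longrightarrow> Ck k f"
proof (induction k arbitrary: f)
  case 0
  then show ?case
    by (auto intro: differentiable_imp_continuous_on)
next
  case (Suc k)
  then show ?case
    by (meson Ck.simps(2))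
qed

lemma Ck_const: "Ck k (\<lambda>x. c)"
proof (induction k arbitrary: c)
  case (Suc k)
  show ?case by (rule Ck_SucI[where f' = "\<lambda>_ _. 0"]) (use Suc in auto)
qed simp

lemma Ck_bounded_linear: "bounded_linear L \<Longrightarrow> Ck k L"
proof (cases k)
  case (Suc n)
  assume "bounded_linear L"
  then show ?thesis
    unfolding Suc by (intro Ck_SucI[where f' = "\<lambda>_. L"] bounded_linear_imp_has_derivative Ck_const)
qed (simp add: linear_continuous_on)

lemma Ck_add: "Ck k f \<Longrightarrow> Ck k g \<Longrightarrow> Ck k (\<lambda>x. f x + g x)"
proof (induction k arbitrary: f g)
  case (Suc k)
  show ?case
    by (rule Ck_SucI[OF has_derivative_add[OF Suc.prems[THEN Ck_Suc_has_derivative]]])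
      (intro Suc.IH Suc.prems[THEN Ck_Suc_derivative])
qed (auto intro: continuous_intros)

lemma Ck_mult: "Ck k f \<Longrightarrow> Ck k g \<Longrightarrow> Ck k (\<lambda>x. f x * g x)"
proof (induction k arbitrary: f g)
  case (Suc k)
  show ?case
    by (rule Ck_SucI[OF has_derivative_mult[OF Suc.prems[THEN Ck_Suc_has_derivative]]])
      (intro Ck_add Suc.IH Suc.prems[THEN Ck_Suc_derivative] Suc.prems[THEN Ck_decreasing])
qed (auto intro: continuous_intros)

lemma Ck_inverse: "Ck k f \<Longrightarrow> (\<And>x. f x \<noteq> 0) \<Longrightarrow> Ck k (\<lambda>x. inverse (f x))"
proof (induction k arbitrary: f)
  case (Suc k)
  have "Ck k (\<lambda>x. - 1 * (inverse (f x) * frechet_derivative f (at x) v * inverse (f x)))" for v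
    by (intro Ck_mult Ck_const Suc.IH Suc.prems(1)[THEN Ck_Suc_derivative]
        Suc.prems(1)[THEN Ck_decreasing] Suc.prems(2))
  then show ?case
    by (intro Ck_SucI[OF Deriv.has_derivative_inverse[OF Suc.prems(2) Ck_Suc_has_derivative[OF Suc.prems(1)]]]) simp
qed (auto intro: continuous_intros)

lemma Ck_affine:
  assumes "bounded_linear L"
  shows "Ck k f \<Longrightarrow> Ck k (\<lambda>x. f (c + L x))"
proof (induction k arbitrary: f)
  case 0
  then show ?case
    using linear_continuous_on[OF assms, of UNIV]
    by (auto intro!: continuous_intros continuous_on_compose2[of UNIV f])
next
  case (Suc k)
  have L: "((\<lambda>x. c + L x) has_derivative L) (at x)" for x
    using bounded_linear_imp_has_derivative[OF assms] by (auto intro!: derivative_eq_intros)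
  show ?case
    by (rule Ck_SucI[OF has_derivative_compose[OF L Ck_Suc_has_derivative[OF Suc.prems]]])
      (intro Suc.IH Ck_Suc_derivative[OF Suc.prems])
qed

text \<open>Allowing a polynomial in \<open>1 / x\<close> in front of \<open>exp (- 1 / x)\<close> makes the family closed under
differentiation, so that smoothness follows by induction for all members at once.\<close>

definition flat :: "real poly \<Rightarrow> real \<Rightarrow> real" where
  "flat P x = (if x \<le> 0 then 0 else poly P (1 / x) * exp (- (1 / x)))"

lemma poly_times_exp_decay: "((\<lambda>y. poly P y * exp (- y)) \<longlongrightarrow> (0::real)) at_top"
proof -
  have "((\<lambda>y. \<Sum>i\<le>degree P. coeff P i * (y ^ i / exp y)) \<longlongrightarrow> (\<Sum>i\<le>degree P. coeff P i * 0)) at_top"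
    by (intro tendsto_sum tendsto_mult tendsto_const tendsto_power_div_exp_0)
  then show ?thesis
    by (simp add: poly_altdef exp_minus sum_distrib_right divide_inverse mult.assoc)
qed

lemma flat_has_derivative: "(flat P has_real_derivative flat (monom 1 2 * (P - pderiv P)) x) (at x)"
proof -
  consider "x < 0" | "x > 0" | "x = 0" by linarith
  then show ?thesis
  proof cases
    case 1
    then have "((\<lambda>_. 0) has_real_derivative 0) (at x)" "\<forall>\<^sub>F y in nhds x. flat P y = 0"
      by (auto simp: flat_def eventually_nhds intro!: exI[of _ "{..<0}"])
    then show ?thesis
      using 1 by (subst DERIV_cong_ev[OF refl _ refl, where g = "\<lambda>_. 0"]) (auto simp: flat_def)
  next
    case 2
    have "((\<lambda>y. poly P (1 / y) * exp (- (1 / y))) has_real_derivative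
        flat (monom 1 2 * (P - pderiv P)) x) (at x)"
      using 2 by (auto intro!: derivative_eq_intros DERIV_chain'[OF _ poly_DERIV]
          simp: flat_def poly_monom field_simps power2_eq_square)
    moreover have "\<forall>\<^sub>F y in nhds x. flat P y = poly P (1 / y) * exp (- (1 / y))"
      using 2 by (auto simp: flat_def eventually_nhds intro!: exI[of _ "{0<..}"])
    ultimately show ?thesis
      by (subst DERIV_cong_ev[OF refl _ refl]) auto
  next
    case 3
    have "((\<lambda>h. flat P h / h) \<longlongrightarrow> 0) (at 0)"
    proof (rule filterlim_split_at_real)
      show "((\<lambda>h. flat P h / h) \<longlongrightarrow> 0) (at_left 0)"
        by (rule tendsto_eventually) (auto simp: flat_def eventually_at_left_field intro!: exI[of _ "-1"])
      \<comment> \<open>in the variable \<open>1 / h\<close> the quotient is again a polynomial times a decaying exponential\<close>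
      have "((\<lambda>h. poly (pCons 0 P) (inverse h) * exp (- inverse h)) \<longlongrightarrow> 0) (at_right 0)"
        by (rule filterlim_compose[OF poly_times_exp_decay filterlim_inverse_at_top_right])
      moreover have "\<forall>\<^sub>F h in at_right 0.
          poly (pCons 0 P) (inverse h) * exp (- inverse h) = flat P h / h"
        by (auto simp: flat_def field_simps eventually_at_right_field intro!: exI[of _ 1])
      ultimately show "((\<lambda>h. flat P h / h) \<longlongrightarrow> 0) (at_right 0)"
        by (rule Lim_transform_eventually)
    qed
    then show ?thesis
      using 3 by (simp add: DERIV_def flat_def)
  qed
qed

lemma Ck_flat: "Ck k (flat P)"
proof (induction k arbitrary: P)
  case 0
  show ?case
    using flat_has_derivative[of P] by (auto intro!: continuous_at_imp_continuous_on DERIV_isCont)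
next
  case (Suc k)
  have "(flat P has_derivative (\<lambda>v. flat (monom 1 2 * (P - pderiv P)) x * v)) (at x)" for x
    using flat_has_derivative[of P x] by (simp add: has_field_derivative_def)
  then show ?case
    by (rule Ck_SucI) (intro Ck_mult Suc.IH Ck_const)
qed

definition smooth_step :: "real \<Rightarrow> real" where
  "smooth_step x = flat 1 x * inverse (flat 1 x + flat 1 (1 - x))"

text \<open>At every point one of \<open>x\<close> and \<open>1 - x\<close> is positive, so the denominator never vanishes.\<close>

lemma Ck_smooth_step: "Ck k smooth_step"
proof -
  have *: "Ck k (\<lambda>x. flat 1 (1 - x))"
    using Ck_affine[of uminus k "flat 1" 1] by (simp add: Ck_flat bounded_linear_minus bounded_linear_ident)
  have "flat 1 x + flat 1 (1 - x) \<noteq> 0" for x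
    unfolding flat_def by (auto simp: add_nonneg_pos pos_add_strict less_imp_neq[symmetric])
  then have "Ck k (\<lambda>x. flat 1 x * inverse (flat 1 x + flat 1 (1 - x)))"
    by (intro Ck_mult Ck_inverse Ck_add Ck_flat *)
  then show ?thesis
    by (simp add: smooth_step_def[abs_def])
qed

lemma smooth_step_values:
  shows "x \<le> 0 \<Longrightarrow> smooth_step x = 0" "x \<ge> 1 \<Longrightarrow> smooth_step x = 1"
    and "0 \<le> smooth_step x"
  by (auto simp: smooth_step_def flat_def)

lemma smooth_plateau:
  assumes "h > 0"
  obtains \<theta> :: "real \<Rightarrow> real"
  where "\<And>k. Ck k \<theta>" "\<And>s. 0 \<le> \<theta> s" "\<And>s. s \<in> {a..b} \<Longrightarrow> \<theta> s = 1" "\<And>s. s \<notin> {a - h..b + h} \<Longrightarrow> \<theta> s = 0"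
proof
  let ?\<theta> = "\<lambda>s. smooth_step ((h - a) / h + s / h) * smooth_step ((h + b) / h + - s / h)"
  show "Ck k ?\<theta>" for k
    by (intro Ck_mult Ck_affine Ck_smooth_step bounded_linear_divide
        bounded_linear_compose[OF bounded_linear_divide bounded_linear_minus[OF bounded_linear_ident]])
  show "0 \<le> ?\<theta> s" for s
    by (simp add: smooth_step_values)
  show "?\<theta> s = 1" if "s \<in> {a..b}" for s
  proof -
    have "(h - a) / h + s / h \<ge> 1" "(h + b) / h + - s / h \<ge> 1"
      using that assms by (auto simp: field_simps)
    then show ?thesis by (simp add: smooth_step_values)
  qed
  show "?\<theta> s = 0" if "s \<notin> {a - h..b + h}" for s
  proof -
    have "(h - a) + s \<le> 0 \<or> (h + b) + - s \<le> 0"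
      using that by auto
    then have "(h - a) / h + s / h \<le> 0 \<or> (h + b) / h + - s / h \<le> 0"
      using assms by (simp only: add_divide_distrib[symmetric] divide_le_0_iff) auto
    then show ?thesis by (auto simp: smooth_step_values)
  qed
qed

section \<open>Gradients of test functions\<close>

lemma frechet_derivative_eq_grad:
  assumes "f differentiable (at x)"
  shows "frechet_derivative f (at x) v = grad f x \<bullet> v"
proof -
  interpret linear "frechet_derivative f (at x)"
    using assms by (rule linear_frechet_derivative)
  have "frechet_derivative f (at x) v = frechet_derivative f (at x) (\<Sum>b\<in>Basis. (v \<bullet> b) *\<^sub>R b)"
    by (simp add: euclidean_representation)
  also have "\<dots> = (\<Sum>b\<in>Basis. (v \<bullet> b) * frechet_derivative f (at x) b)"
    by (simp add: sum scale)
  also have "\<dots> = grad f x \<bullet> v"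
    unfolding grad_def inner_sum_left inner_scaleR_left
    by (intro sum.cong) (simp_all add: inner_commute)
  finally show ?thesis .
qed

lemma test_function_Ck: "test_function U \<phi> \<Longrightarrow> Ck k \<phi>"
  and test_function_mono: "test_function U \<phi> \<Longrightarrow> U \<subseteq> V \<Longrightarrow> test_function V \<phi>"
  by (auto simp: test_function_def)

lemma test_function_has_derivative:
  assumes "test_function U \<phi>"
  shows "(\<phi> has_derivative (\<lambda>v. grad \<phi> z \<bullet> v)) (at z)"
proof -
  have "\<phi> differentiable (at z)"
    using test_function_Ck[OF assms, of 1] by (simp add: differentiable_on_def)
  moreover from this have "frechet_derivative \<phi> (at z) = (\<lambda>v. grad \<phi> z \<bullet> v)"
    by (intro ext frechet_derivative_eq_grad)
  ultimately show ?thesis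
    by (metis frechet_derivative_works)
qed

lemma frechet_derivative_test_function:
  "test_function U \<phi> \<Longrightarrow> frechet_derivative \<phi> (at z) v = grad \<phi> z \<bullet> v"
  using frechet_derivative_at[OF test_function_has_derivative] by metis

lemma grad_unique:
  assumes "(f has_derivative (\<lambda>v. g \<bullet> v)) (at x)"
  shows "grad f x = g"
proof -
  have "frechet_derivative f (at x) = (\<lambda>v. g \<bullet> v)"
    using frechet_derivative_at[OF assms] by simp
  then show ?thesis
    by (simp add: grad_def euclidean_representation)
qed

lemma continuous_on_grad_test_function:
  assumes "test_function U \<phi>"
  shows "continuous_on UNIV (grad \<phi>)"
  unfolding grad_def using test_function_Ck[OF assms, of 1]
  by (auto intro!: continuous_intros)

lemma test_function_eq_0:
  assumes "z \<notin> closure {x. \<phi> x \<noteq> (0::real)}"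
  shows "\<phi> z = 0" "grad \<phi> z = 0"
proof -
  let ?S = "- closure {x. \<phi> x \<noteq> 0}"
  have zero: "\<phi> y = 0" if "y \<in> ?S" for y
    using that closure_subset[of "{x. \<phi> x \<noteq> 0}"] by auto
  show "\<phi> z = 0" using zero[of z] assms by simp
  have "(\<phi> has_derivative (\<lambda>v. 0)) (at z)"
  proof (rule has_derivative_transform_within_open[OF has_derivative_const])
    show "open ?S" by (rule open_Compl[OF closed_closure])
    show "z \<in> ?S" using assms by simp
    show "0 = \<phi> y" if "y \<in> ?S" for y
      by (rule zero[OF that, symmetric])
  qed
  then show "grad \<phi> z = 0"
    by (intro grad_unique) simp
qed

lemma grad_bounded:
  assumes \<phi>: "test_function U \<phi>"
  obtains B where "0 \<le> B" "\<And>z. norm (grad \<phi> z) \<le> B"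
proof -
  let ?S = "closure {z. \<phi> z \<noteq> 0}"
  have "compact (grad \<phi> ` ?S)"
    using \<phi> unfolding test_function_def
    by (intro compact_continuous_image continuous_on_subset[OF continuous_on_grad_test_function[OF \<phi>]]) auto
  then obtain B where B: "\<And>z. z \<in> ?S \<Longrightarrow> norm (grad \<phi> z) \<le> B"
    using compact_imp_bounded bounded_iff by (metis imageI)
  have "norm (grad \<phi> z) \<le> max 0 B" for z
  proof (cases "z \<in> ?S")
    case True
    then show ?thesis using B[of z] by simp
  next
    case False
    then show ?thesis using test_function_eq_0(2)[OF False] by simp
  qed
  then show ?thesis
    by (intro that[of "max 0 B"]) simp_all
qed

lemma test_functionI:
  assumes "\<And>k. Ck k \<phi>" "compact K" "K \<subseteq> U" "\<And>x. x \<notin> K \<Longrightarrow> \<phi> x = 0"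
  shows "test_function U \<phi>"
proof -
  have "closure {x. \<phi> x \<noteq> 0} \<subseteq> K"
    using assms(2,4) by (intro closure_minimal compact_imp_closed) auto
  moreover from this have "compact (closure {x. \<phi> x \<noteq> 0})"
    using compact_Int_closed[OF assms(2) closed_closure, of "{x. \<phi> x \<noteq> 0}"] by (simp add: Int_absorb1)
  ultimately show ?thesis
    using assms(1,3) by (auto simp: test_function_def)
qed


section \<open>The Coulomb kernel and its regularization\<close>

text \<open>Replacing \<open>|z|\<close> by \<open>max |z| d\<close> in the denominator gives a Lipschitz kernel that vanishes at infinity,
and changes the kernel only in the ball of radius \<open>d\<close>.\<close>

definition coulomb_cut :: "real \<Rightarrow> real^2 \<Rightarrow> real^2" where
  "coulomb_cut d z = z /\<^sub>R (max (norm z) d)\<^sup>2"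

lemma norm_coulomb: "norm (coulomb z) = inverse (norm z)"
  by (cases "z = 0") (auto simp: coulomb_def power2_eq_square)

lemma coulomb_minus: "coulomb (- z) = - coulomb z"
  by (simp add: coulomb_def)

lemma coulomb_cut_minus: "coulomb_cut d (- z) = - coulomb_cut d z"
  by (simp add: coulomb_cut_def)

lemma coulomb_0 [simp]: "coulomb 0 = 0"
  by (simp add: coulomb_def)

lemma coulomb_borel [measurable]: "coulomb \<in> borel_measurable borel"
  unfolding coulomb_def[abs_def] by measurable

lemma bounded_linear_perp: "bounded_linear perp"
proof -
  have "linear perp"
    by (rule linearI) (auto simp: perp_def vec_eq_iff forall_2)
  then show ?thesis
    using linear_conv_bounded_linear by blast
qed

lemmas perp_simps = linear_simps[OF bounded_linear_perp]

lemma norm_perp [simp]: "norm (perp x) = norm x"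
  by (simp add: norm_vec_def L2_set_def perp_def sum_2)

lemma continuous_on_perp [continuous_intros]:
  "continuous_on A f \<Longrightarrow> continuous_on A (\<lambda>x. perp (f x))"
  by (rule bounded_linear.continuous_on[OF bounded_linear_perp])

lemma perp_borel [measurable]: "perp \<in> borel_measurable borel"
  by (intro borel_measurable_continuous_onI continuous_intros)

lemma coulomb_cut_eq: "0 \<le> d \<Longrightarrow> d \<le> norm z \<Longrightarrow> coulomb_cut d z = coulomb z"
  by (simp add: coulomb_cut_def coulomb_def max_def)

lemma coulomb_cut_0 [simp]: "coulomb_cut d 0 = 0"
  by (simp add: coulomb_cut_def)

text \<open>In the ball both kernels are multiples of \<open>z\<close> with factors between \<open>0\<close> and \<open>1 / |z|\<^sup>2\<close>. The bound does not
depend on \<open>d'\<close>, which allows \<open>d' \<rightarrow> 0\<close>.\<close>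

lemma norm_coulomb_cut_diff:
  assumes "0 < d'" "d' \<le> d"
  shows "norm (coulomb_cut d' z - coulomb_cut d z) \<le> indicator (ball 0 d) z * inverse (norm z)"
proof (cases "norm z < d \<and> z \<noteq> 0")
  case False
  then show ?thesis
    using assms by (cases "z = 0") (auto simp: coulomb_cut_eq)
next
  case True
  let ?m = "max (norm z) d'"
  have m: "norm z \<le> ?m" "?m \<le> d" "0 < ?m"
    using True assms by auto
  have "inverse (d\<^sup>2) \<le> inverse (?m\<^sup>2)"
    using m by (intro le_imp_inverse_le power_mono) auto
  moreover have "inverse (?m\<^sup>2) \<le> inverse ((norm z)\<^sup>2)"
    using m True by (intro le_imp_inverse_le power_mono) auto
  ultimately have "\<bar>inverse (?m\<^sup>2) - inverse (d\<^sup>2)\<bar> \<le> inverse ((norm z)\<^sup>2)"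
    by (simp add: abs_le_iff)(use assms in \<open>smt (verit) inverse_nonnegative_iff_nonnegative zero_le_power2\<close>)
  moreover have "coulomb_cut d' z - coulomb_cut d z = (inverse (?m\<^sup>2) - inverse (d\<^sup>2)) *\<^sub>R z"
    using True by (simp add: coulomb_cut_def scaleR_diff_left max_def)
  ultimately have "norm (coulomb_cut d' z - coulomb_cut d z) \<le> inverse ((norm z)\<^sup>2) * norm z"
    by (simp add: mult_right_mono)
  also have "inverse ((norm z)\<^sup>2) * norm z = inverse (norm z)"
    using True by (simp add: power2_eq_square field_simps)
  finally show ?thesis
    using True by simp
qed

lemma coulomb_cut_tendsto: "((\<lambda>d. coulomb_cut d z) \<longlongrightarrow> coulomb z) (at_right 0)"
proof (cases "z = 0")
  case False
  then have "\<forall>\<^sub>F d in at_right 0. coulomb_cut d z = coulomb z"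
    by (auto simp: eventually_at_right_field coulomb_cut_eq intro!: exI[of _ "norm z"])
  then show ?thesis
    by (rule tendsto_eventually)
qed simp

lemma norm_coulomb_cut:
  assumes "0 < d"
  shows "norm (coulomb_cut d z) \<le> 1 / max (norm z) d"
proof -
  have m: "0 < max (norm z) d" using assms by auto
  have "norm (coulomb_cut d z) = norm z / (max (norm z) d)\<^sup>2"
    by (simp add: coulomb_cut_def divide_inverse mult.commute)
  also have "\<dots> \<le> max (norm z) d / (max (norm z) d)\<^sup>2"
    using m by (intro divide_right_mono) auto
  finally show ?thesis
    using m by (simp add: power2_eq_square)
qed

lemma norm_coulomb_cut_le: "0 < d \<Longrightarrow> norm (coulomb_cut d z) \<le> 1 / d"
  by (rule order_trans[OF norm_coulomb_cut]) (auto intro!: divide_left_mono mult_pos_pos)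

text \<open>The truncated norms \<open>p\<close> and \<open>q\<close> of \<open>z\<close> and \<open>w\<close> are at least \<open>d\<close>, dominate \<open>|z|\<close> and \<open>|w|\<close>, and differ by
at most \<open>|z - w|\<close>; this controls the difference of the factors \<open>1 / p\<^sup>2\<close> and \<open>1 / q\<^sup>2\<close>.\<close>

lemma coulomb_cut_lipschitz:
  assumes d: "0 < d"
  shows "norm (coulomb_cut d z - coulomb_cut d w) \<le> 3 / d\<^sup>2 * norm (z - w)"
proof -
  define p q where "p = max (norm z) d" and "q = max (norm w) d"
  have pq: "d \<le> p" "d \<le> q" "norm w \<le> q" "0 < p" "0 < q"
    using d by (auto simp: p_def q_def)
  have pq_diff: "\<bar>p - q\<bar> \<le> norm (z - w)"
    unfolding p_def q_def using norm_triangle_ineq3[of z w] by linarith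
  have inv: "inverse p \<le> inverse d" "inverse q \<le> inverse d" "0 < inverse p" "0 < inverse q"
    using pq d by (auto intro: le_imp_inverse_le)
  have split: "coulomb_cut d z - coulomb_cut d w
      = inverse (p\<^sup>2) *\<^sub>R (z - w) + (inverse (p\<^sup>2) - inverse (q\<^sup>2)) *\<^sub>R w"
    by (simp add: coulomb_cut_def p_def q_def algebra_simps)
  have "norm (inverse (p\<^sup>2) *\<^sub>R (z - w)) \<le> inverse d * inverse d * norm (z - w)"
    using inv d less_imp_le[OF d] by (auto simp: power2_eq_square intro!: mult_right_mono mult_mono)
  moreover have "norm ((inverse (p\<^sup>2) - inverse (q\<^sup>2)) *\<^sub>R w) \<le> 2 * (inverse d * inverse d) * norm (z - w)"
  proof -
    have "inverse (p\<^sup>2) - inverse (q\<^sup>2) = (q - p) * (inverse p * inverse p * inverse q + inverse p * inverse q * inverse q)"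
      using pq by (simp add: power2_eq_square field_simps)
    then have "norm ((inverse (p\<^sup>2) - inverse (q\<^sup>2)) *\<^sub>R w)
        = \<bar>p - q\<bar> * ((inverse p * inverse p * inverse q + inverse p * inverse q * inverse q) * norm w)"
      using pq by (simp add: abs_mult abs_minus_commute)
    also have "\<dots> \<le> norm (z - w) * ((inverse p * inverse p * inverse q + inverse p * inverse q * inverse q) * q)"
      using pq inv pq_diff by (intro mult_mono mult_nonneg_nonneg add_nonneg_nonneg) auto
    also have "(inverse p * inverse p * inverse q + inverse p * inverse q * inverse q) * q = inverse p * inverse p + inverse p * inverse q"
      using pq by (simp add: field_simps)
    also have "norm (z - w) * \<dots> \<le> norm (z - w) * (inverse d * inverse d + inverse d * inverse d)"
      using inv d by (intro mult_left_mono add_mono mult_mono) auto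
    finally show ?thesis by (simp add: algebra_simps)
  qed
  ultimately show ?thesis
    unfolding split by (intro norm_triangle_le) (simp add: power2_eq_square divide_inverse algebra_simps)
qed

lemma continuous_on_coulomb_cut: "0 < d \<Longrightarrow> continuous_on UNIV (coulomb_cut d)"
  unfolding coulomb_cut_def[abs_def] by (intro continuous_intros) (auto simp: max_def)

lemma coulomb_cut_borel [measurable]: "coulomb_cut d \<in> borel_measurable borel"
  unfolding coulomb_cut_def[abs_def] by measurable

lemma filterlim_reflected_at_infinity: "filterlim (\<lambda>y. x - y :: 'a::real_normed_vector) at_infinity at_infinity"
proof -
  have "filterlim (\<lambda>y. x + - y) at_infinity at_infinity"
    by (rule tendsto_add_filterlim_at_infinity[OF tendsto_const])
      (simp add: filterlim_at_infinity_conv_norm_at_top[of "\<lambda>y. - y"] filterlim_norm_at_top)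
  then show ?thesis by simp
qed

lemma C0_function_reflected: "C0_function \<Phi> \<Longrightarrow> C0_function (\<lambda>y. \<Phi> (x - y))"
  unfolding C0_function_def
  by (auto intro!: continuous_on_compose2[of UNIV \<Phi>] continuous_intros
      filterlim_compose[OF _ filterlim_reflected_at_infinity])

lemma coulomb_cut_tendsto_0_at_infinity: "0 < d \<Longrightarrow> (coulomb_cut d \<longlongrightarrow> 0) at_infinity"
proof (rule Lim_null_comparison)
  show "\<forall>\<^sub>F z in at_infinity. norm (coulomb_cut d z) \<le> inverse (norm z)" if "0 < d"
    by (rule eventually_at_infinityI[of d])
      (use that in \<open>auto simp: coulomb_cut_eq norm_coulomb\<close>)
  show "((\<lambda>z. inverse (norm z)) \<longlongrightarrow> 0) (at_infinity :: (real^2) filter)"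
    by (rule tendsto_inverse_0_at_top[OF filterlim_norm_at_top])
qed

lemma C0_function_coulomb_cut: "0 < d \<Longrightarrow> C0_function (\<lambda>z. coulomb_cut d z \<bullet> b)"
  unfolding C0_function_def using coulomb_cut_tendsto_0_at_infinity[of d]
  by (auto intro!: continuous_intros continuous_on_coulomb_cut tendsto_eq_intros)

text \<open>Both kernels agree outside a ball. Belonging to \<open>C\<^sub>0\<close> is what makes pairings with the difference of two
regularizations continuous in time.\<close>

lemma C0_function_coulomb_cut_diff:
  "0 < d \<Longrightarrow> 0 < d' \<Longrightarrow> C0_function (\<lambda>z. norm (coulomb_cut d' z - coulomb_cut d z))"
  unfolding C0_function_def
  using coulomb_cut_tendsto_0_at_infinity[of d] coulomb_cut_tendsto_0_at_infinity[of d']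
  by (auto intro!: continuous_intros continuous_on_coulomb_cut tendsto_eq_intros)

text \<open>On the annulus \<open>\<delta> / 2^(k+1) \<le> |x - y| < \<delta> / 2^k\<close> the integrand is at most \<open>(\<delta> / 2^(k+1)) powr - q\<close>, and the
annulus lies in a disc of area \<open>pi (\<delta> / 2^k)\<^sup>2\<close>. The resulting series is geometric with ratio
\<open>2 powr (q - 2)\<close>, which is less than \<open>1\<close> in the plane exactly for \<open>q < 2\<close>.\<close>

lemma nn_integral_riesz_potential_ball:
  fixes x :: "real^2"
  assumes q: "0 < q" "q < 2" and \<delta>: "0 < \<delta>"
  shows "(\<integral>\<^sup>+y. ennreal (norm (x - y) powr - q) * indicator (ball x \<delta>) y \<partial>lborel)
    \<le> ennreal (\<delta> powr (2 - q) * (pi * 2 powr q / (1 - 2 powr (q - 2))))"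
proof -
  let ?a = "\<lambda>k::nat. (\<delta> / 2 ^ Suc k) powr - q"
  have r: "2 powr (q - 2) < 1"
    using q by (simp add: powr_less_one)
  have term_le: "F j \<le> suminf F" for F :: "nat \<Rightarrow> ennreal" and j
    using sum_le_suminf[of F "{j}"] by simp
  have meas: "(\<lambda>y. ennreal c * indicator (ball x s) y) \<in> borel_measurable lborel" for c s
    by (intro borel_measurable_times_ennreal borel_measurable_const borel_measurable_indicator) simp
  have bound: "ennreal (norm (x - y) powr - q) * indicator (ball x \<delta>) y
      \<le> (\<Sum>k. ennreal (?a k) * indicator (ball x (\<delta> / 2 ^ k)) y)" for y
  proof (cases "y \<in> ball x \<delta> \<and> y \<noteq> x")
    case False
    then show ?thesis by (auto simp: indicator_def)
  next
    case True
    then have n: "0 < norm (x - y)" "norm (x - y) < \<delta>"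
      by (auto simp: dist_norm)
    have "\<exists>k. \<delta> / 2 ^ k \<le> norm (x - y)"
    proof -
      obtain k where "\<delta> / norm (x - y) < 2 ^ k"
        using real_arch_pow[of 2 "\<delta> / norm (x - y)"] by auto
      then show ?thesis
        using n by (intro exI[of _ k]) (simp add: field_simps)
    qed
    then have k: "\<delta> / 2 ^ (LEAST k. \<delta> / 2 ^ k \<le> norm (x - y)) \<le> norm (x - y)"
      by (rule LeastI_ex)
    with n have "(LEAST k. \<delta> / 2 ^ k \<le> norm (x - y)) \<noteq> 0"
      by (metis div_by_1 not_le power_0)
    then obtain j where j: "(LEAST k. \<delta> / 2 ^ k \<le> norm (x - y)) = Suc j"
      by (meson not0_implies_Suc)
    have j': "norm (x - y) < \<delta> / 2 ^ j"
      using not_less_Least[of j "\<lambda>k. \<delta> / 2 ^ k \<le> norm (x - y)"] j by simp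
    have "norm (x - y) powr - q \<le> ?a j"
      using k q \<delta> unfolding j by (intro powr_mono2') auto
    then have "ennreal (norm (x - y) powr - q) * indicator (ball x \<delta>) y
        \<le> ennreal (?a j) * indicator (ball x (\<delta> / 2 ^ j)) y"
      using True j' \<open>norm (x - y) powr - q \<le> ?a j\<close> by (simp add: dist_norm ennreal_leI)
    also have "\<dots> \<le> (\<Sum>k. ennreal (?a k) * indicator (ball x (\<delta> / 2 ^ k)) y)"
      by (rule term_le)
    finally show ?thesis .
  qed
  have term_eq: "?a k * (pi * (\<delta> / 2 ^ k)\<^sup>2) = \<delta> powr (2 - q) * (pi * 2 powr q) * (2 powr (q - 2)) ^ k" for k
  proof -
    have two_powr: "(2 ^ m :: real) powr q = (2 powr q) ^ m" for m :: nat
      by (simp add: powr_realpow[symmetric] powr_powr mult.commute)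
    have "?a k = \<delta> powr - q * (2 powr q * (2 powr q) ^ k)"
      using \<delta> two_powr[of "Suc k"] by (simp only: powr_divide powr_minus) (simp add: divide_inverse)
    moreover have "(\<delta> / 2 ^ k)\<^sup>2 = \<delta>\<^sup>2 / 4 ^ k"
      by (simp add: power_divide power_mult[symmetric] mult.commute[of k] power_mult)
    moreover have "(2 powr (q - 2)) ^ k = (2 powr q) ^ k / (4::real) ^ k"
      by (simp add: powr_diff power_divide)
    moreover have "\<delta> powr (2 - q) = \<delta>\<^sup>2 * \<delta> powr - q"
      using \<delta> by (simp add: powr_diff powr_minus divide_inverse)
    ultimately show ?thesis
      by (simp add: mult_ac)
  qed
  have "(\<integral>\<^sup>+y. ennreal (norm (x - y) powr - q) * indicator (ball x \<delta>) y \<partial>lborel)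
      \<le> (\<integral>\<^sup>+y. (\<Sum>k. ennreal (?a k) * indicator (ball x (\<delta> / 2 ^ k)) y) \<partial>lborel)"
    by (intro nn_integral_mono bound)
  also have "\<dots> = (\<Sum>k. ennreal (?a k) * emeasure lborel (ball x (\<delta> / 2 ^ k)))"
    by (subst nn_integral_suminf[OF meas]) (intro suminf_cong nn_integral_cmult_indicator, simp)
  also have "\<dots> = (\<Sum>k. ennreal (\<delta> powr (2 - q) * (pi * 2 powr q) * (2 powr (q - 2)) ^ k))"
  proof (intro suminf_cong)
    fix k
    have "emeasure lborel (ball x (\<delta> / 2 ^ k)) = ennreal (pi * (\<delta> / 2 ^ k)\<^sup>2)"
      using \<delta> by (simp add: emeasure_ball unit_ball_vol_2)
    then show "ennreal (?a k) * emeasure lborel (ball x (\<delta> / 2 ^ k))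
        = ennreal (\<delta> powr (2 - q) * (pi * 2 powr q) * (2 powr (q - 2)) ^ k)"
      by (simp only: term_eq[symmetric] ennreal_mult powr_ge_zero mult_nonneg_nonneg pi_ge_zero zero_le_power2)
  qed
  also have "\<dots> = ennreal (\<Sum>k. \<delta> powr (2 - q) * (pi * 2 powr q) * (2 powr (q - 2)) ^ k)"
    using r by (intro suminf_ennreal2 summable_mult summable_geometric) auto
  also have "(\<Sum>k. \<delta> powr (2 - q) * (pi * 2 powr q) * (2 powr (q - 2)) ^ k)
      = \<delta> powr (2 - q) * (pi * 2 powr q / (1 - 2 powr (q - 2)))"
    using r by (subst suminf_mult) (auto simp: suminf_geometric summable_geometric)
  finally show ?thesis .
qed

text \<open>Young's inequality bounds \<open>g / |x - y|\<close> by \<open>\<kappa> g\<^sup>p\<close> plus a multiple of \<open>|x - y| powr - q\<close> with the conjugate exponent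
\<open>q = p / (p - 1)\<close>, and \<open>q < 2\<close> because \<open>p > 2\<close>. First \<open>\<kappa>\<close> is taken small, then the radius. The summand \<open>1\<close> in the
integrand makes the same estimate control the mass of the ball.\<close>

lemma Lp_density_singular_integral_small:
  fixes p C \<epsilon> :: real
  assumes p: "p > 2" and C: "0 \<le> C" and \<epsilon>: "\<epsilon> > 0"
  obtains \<delta> where "\<delta> > 0"
    "\<And>g (x::real^2). g \<in> borel_measurable lborel \<Longrightarrow> (\<And>y. 0 \<le> g y) \<Longrightarrow>
       integrable lborel (\<lambda>y. \<bar>g y\<bar> powr p) \<Longrightarrow> (LINT y|lborel. \<bar>g y\<bar> powr p) \<le> C \<Longrightarrow>
       (\<integral>\<^sup>+y. ennreal (1 + inverse (norm (x - y))) * indicator (ball x \<delta>) y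
          \<partial>density lborel (\<lambda>y. ennreal (g y))) \<le> ennreal \<epsilon>"
proof -
  define \<kappa> where "\<kappa> = \<epsilon> / (4 * (C + 1))"
  define a where "a = 1 / (p - 1)"
  define q where "q = 1 + a"
  define B where "B = \<kappa> powr - a * (pi * 2 powr q / (1 - 2 powr (q - 2)))"
  define \<delta> where "\<delta> = min 1 ((\<epsilon> / (4 * B)) powr (1 / (2 - q)))"
  have \<kappa>: "\<kappa> > 0" using C \<epsilon> by (simp add: \<kappa>_def)
  have a: "0 < a" "a < 1" using p by (auto simp: a_def)
  then have q: "0 < q" "q < 2" by (auto simp: q_def)
  have B: "B > 0"
    using q \<kappa> unfolding B_def by (auto intro!: mult_pos_pos divide_pos_pos simp: powr_less_one)
  have \<delta>: "0 < \<delta>" "\<delta> \<le> 1" using B \<epsilon> by (auto simp: \<delta>_def)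
  have \<delta>q: "\<delta> powr (2 - q) * B \<le> \<epsilon> / 4"
  proof -
    have "\<delta> powr (2 - q) \<le> ((\<epsilon> / (4 * B)) powr (1 / (2 - q))) powr (2 - q)"
      using q \<delta> by (intro powr_mono2) (auto simp: \<delta>_def)
    also have "\<dots> = \<epsilon> / (4 * B)"
      using q B \<epsilon> by (simp add: powr_powr)
    finally show ?thesis
      using B by (simp add: field_simps)
  qed
  show ?thesis
  proof (rule that[OF \<delta>(1)])
    fix g :: "real^2 \<Rightarrow> real" and x :: "real^2"
    assume g [measurable]: "g \<in> borel_measurable lborel" and g0: "\<And>y. 0 \<le> g y"
      and int: "integrable lborel (\<lambda>y. \<bar>g y\<bar> powr p)" and le: "(LINT y|lborel. \<bar>g y\<bar> powr p) \<le> C"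
    \<comment> \<open>a form of Young's inequality, obtained by comparing \<open>1 / |z|\<close> with \<open>\<kappa> g\<^sup>p\<^sup>-\<^sup>1\<close>\<close>
    have young: "inverse n * c \<le> \<kappa> * c powr p + \<kappa> powr - a * n powr - q" if "0 < n" "0 \<le> c" for n c :: real
    proof (cases "c = 0")
      case False
      with that have c: "0 < c" by simp
      show ?thesis
      proof (cases "inverse n \<le> \<kappa> * c powr (p - 1)")
        case True
        then have "inverse n * c \<le> \<kappa> * c powr (p - 1) * c powr 1"
          using c by (simp add: mult_right_mono)
        also have "\<dots> = \<kappa> * c powr p"
          using c by (simp only: mult.assoc powr_add[symmetric]) simp
        finally show ?thesis
          by (rule order_trans) (use that in simp)
      next
        case False
        then have "c powr (p - 1) \<le> inverse (\<kappa> * n)"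
          using \<kappa> that by (simp add: field_simps)
        then have "(c powr (p - 1)) powr a \<le> inverse (\<kappa> * n) powr a"
          using a by (intro powr_mono2) auto
        then have "c \<le> \<kappa> powr - a * n powr - a"
          using c p \<kappa> that by (simp add: powr_powr a_def powr_mult powr_minus inverse_powr)
        then have "inverse n * c \<le> inverse n * (\<kappa> powr - a * n powr - a)"
          using that by (intro mult_left_mono) auto
        also have "\<dots> = \<kappa> powr - a * n powr - q"
          using that by (simp add: q_def powr_diff powr_minus field_simps)
        finally show ?thesis
          by (rule order_trans) (use \<kappa> in simp)
      qed
    qed (use \<kappa> that in simp)
    have pw: "AE y in lborel. ennreal (g y) * (ennreal (1 + inverse (norm (x - y))) * indicator (ball x \<delta>) y)
        \<le> ennreal (2 * \<kappa>) * ennreal (\<bar>g y\<bar> powr p)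
          + ennreal (2 * \<kappa> powr - a) * (ennreal (norm (x - y) powr - q) * indicator (ball x \<delta>) y)"
      using AE_lborel_singleton[of x]
    proof eventually_elim
      case (elim y)
      show ?case
      proof (cases "y \<in> ball x \<delta>")
        case True
        then have n: "0 < norm (x - y)" "norm (x - y) < 1"
          using elim \<delta> by (auto simp: dist_norm)
        then have "1 \<le> inverse (norm (x - y))"
          by (simp add: one_le_inverse)
        then have "g y * (1 + inverse (norm (x - y))) \<le> g y * (2 * inverse (norm (x - y)))"
          using g0 by (intro mult_left_mono) auto
        also have "\<dots> \<le> 2 * \<kappa> * \<bar>g y\<bar> powr p + 2 * \<kappa> powr - a * norm (x - y) powr - q"
          using young[OF n(1) g0[of y]] g0[of y] by (simp add: algebra_simps)
        finally have "ennreal (g y * (1 + inverse (norm (x - y))))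
            \<le> ennreal (2 * \<kappa> * \<bar>g y\<bar> powr p + 2 * \<kappa> powr - a * norm (x - y) powr - q)"
          by (rule ennreal_leI)
        then show ?thesis
          using True \<kappa> g0 by (simp add: ennreal_mult ennreal_plus)
      qed (simp add: indicator_def)
    qed
    have [measurable]: "ball x \<delta> \<in> sets borel" by simp
    have "(\<integral>\<^sup>+y. ennreal (1 + inverse (norm (x - y))) * indicator (ball x \<delta>) y
          \<partial>density lborel (\<lambda>y. ennreal (g y)))
        = (\<integral>\<^sup>+y. ennreal (g y) * (ennreal (1 + inverse (norm (x - y))) * indicator (ball x \<delta>) y) \<partial>lborel)"
      by (rule nn_integral_density; measurable)
    also have "\<dots> \<le> (\<integral>\<^sup>+y. ennreal (2 * \<kappa>) * ennreal (\<bar>g y\<bar> powr p)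
          + ennreal (2 * \<kappa> powr - a) * (ennreal (norm (x - y) powr - q) * indicator (ball x \<delta>) y) \<partial>lborel)"
      by (rule nn_integral_mono_AE[OF pw])
    also have "\<dots> = ennreal (2 * \<kappa>) * (\<integral>\<^sup>+y. ennreal (\<bar>g y\<bar> powr p) \<partial>lborel)
          + ennreal (2 * \<kappa> powr - a) * (\<integral>\<^sup>+y. ennreal (norm (x - y) powr - q) * indicator (ball x \<delta>) y \<partial>lborel)"
      by (subst nn_integral_add) (auto simp: nn_integral_cmult)
    also have "(\<integral>\<^sup>+y. ennreal (\<bar>g y\<bar> powr p) \<partial>lborel) = ennreal (LINT y|lborel. \<bar>g y\<bar> powr p)"
      by (rule nn_integral_eq_integral[OF int]) auto
    also have "ennreal (2 * \<kappa>) * \<dots> + ennreal (2 * \<kappa> powr - a) * (\<integral>\<^sup>+y. ennreal (norm (x - y) powr - q) * indicator (ball x \<delta>) y \<partial>lborel)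
        \<le> ennreal (2 * \<kappa>) * ennreal C + ennreal (2 * \<kappa> powr - a) * ennreal (\<delta> powr (2 - q) * (pi * 2 powr q / (1 - 2 powr (q - 2))))"
      using le by (intro add_mono mult_left_mono nn_integral_riesz_potential_ball q \<delta> ennreal_leI) auto
    also have "\<dots> = ennreal (2 * \<kappa> * C + 2 * (\<delta> powr (2 - q) * B))"
    proof -
      have "0 \<le> \<delta> powr (2 - q) * (pi * 2 powr q / (1 - 2 powr (q - 2)))"
        using q by (auto intro!: mult_nonneg_nonneg divide_nonneg_nonneg simp: powr_less_one less_imp_le)
      moreover have sum: "ennreal (2 * \<kappa>) * ennreal C + ennreal (2 * \<kappa> powr - a) * ennreal D
          = ennreal (2 * \<kappa> * C + 2 * (\<kappa> powr - a * D))" if "0 \<le> D" for D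
        using \<kappa> C that by (simp add: mult.assoc flip: ennreal_mult ennreal_plus)
      ultimately show ?thesis
        by (subst sum) (auto simp: B_def mult_ac)
    qed
    also have "\<dots> \<le> ennreal \<epsilon>"
    proof (rule ennreal_leI)
      have "2 * \<kappa> * C \<le> \<epsilon> / 2"
        using C \<epsilon> by (simp add: \<kappa>_def field_simps)
      then show "2 * \<kappa> * C + 2 * (\<delta> powr (2 - q) * B) \<le> \<epsilon>"
        using \<delta>q by linarith
    qed
    finally show "(\<integral>\<^sup>+y. ennreal (1 + inverse (norm (x - y))) * indicator (ball x \<delta>) y
          \<partial>density lborel (\<lambda>y. ennreal (g y))) \<le> ennreal \<epsilon>" .
  qed
qed

section \<open>The electric field of a weakly continuous density\<close>

text \<open>A strict inequality at one point persists on an interval, which has positive measure.\<close>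

lemma AE_le_imp_le_on_interval:
  fixes h :: "real \<Rightarrow> real"
  assumes T: "0 < T" and cont: "continuous_on {0..T} h"
    and ae: "AE t in lborel. t \<in> {0..T} \<longrightarrow> h t \<le> c" and s: "s \<in> {0..T}"
  shows "h s \<le> c"
proof (rule ccontr)
  assume "\<not> h s \<le> c"
  then obtain d where d: "d > 0" "\<And>t. t \<in> {0..T} \<Longrightarrow> dist t s < d \<Longrightarrow> dist (h t) (h s) < h s - c"
    using cont s unfolding continuous_on_iff by (metis diff_gt_0_iff_gt not_le)
  define a b where "a = max 0 (s - d)" and "b = min T (s + d)"
  have ab: "a < b" using T d s by (auto simp: a_def b_def)
  have "AE t in lborel. t \<notin> {a<..<b}"
    using ae
  proof eventually_elim
    case (elim t)
    show ?case
    proof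
      assume "t \<in> {a<..<b}"
      then have "t \<in> {0..T}" "dist t s < d"
        by (auto simp: a_def b_def dist_real_def)
      then show False
        using d(2) elim by (fastforce simp: dist_real_def)
    qed
  qed
  then have "{a<..<b} \<in> null_sets lborel"
    by (simp add: AE_iff_null_sets)
  then show False using ab by (auto simp: null_sets_def)
qed

lemma continuous_on_halfline_times:
  fixes f :: "real \<times> 'a::metric_space \<Rightarrow> 'b::metric_space"
  assumes "\<And>T. 0 < T \<Longrightarrow> continuous_on ({0..T} \<times> UNIV) f"
  shows "continuous_on ({0..} \<times> UNIV) f"
  unfolding continuous_on_eq_continuous_within
proof
  fix z :: "real \<times> 'a" assume z: "z \<in> {0..} \<times> UNIV"
  let ?S = "{..<fst z + 1} \<times> (UNIV :: 'a set)"
  have "at z within {0..} \<times> UNIV = at z within {0..fst z + 1} \<times> UNIV"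
    using z by (intro at_within_nhd[of _ ?S]) (auto intro!: open_Times)
  then show "continuous (at z within {0..} \<times> UNIV) f"
    using assms[of "fst z + 1"] z by (auto simp: continuous_on_eq_continuous_within continuous_within)
qed

lemma continuous_on_halfline:
  fixes f :: "real \<Rightarrow> 'b::metric_space"
  assumes "\<And>T. 0 < T \<Longrightarrow> continuous_on {0..T} f"
  shows "continuous_on {0..} f"
  unfolding continuous_on_eq_continuous_within
proof
  fix t :: real assume t: "t \<in> {0..}"
  have "at t within {0..} = at t within {0..t + 1}"
    using t by (intro at_within_nhd[of _ "{..<t + 1}"]) auto
  then show "continuous (at t within {0..}) f"
    using assms[of "t + 1"] t by (auto simp: continuous_on_eq_continuous_within continuous_within)
qed

lemma continuous_on_uniform_approx:
  fixes g :: "'a::metric_space \<Rightarrow> 'b::metric_space"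
  assumes approx: "\<And>e. 0 < e \<Longrightarrow> \<exists>f. continuous_on S f \<and> (\<forall>x\<in>S. dist (f x) (g x) \<le> e)"
  shows "continuous_on S g"
  unfolding continuous_on_iff
proof (intro ballI allI impI)
  fix x and e :: real assume x: "x \<in> S" and e: "0 < e"
  obtain f where f: "continuous_on S f" "\<And>y. y \<in> S \<Longrightarrow> dist (f y) (g y) \<le> e / 3"
    using approx[of "e / 3"] e by auto
  obtain d where d: "0 < d" "\<And>y. y \<in> S \<Longrightarrow> dist y x < d \<Longrightarrow> dist (f y) (f x) < e / 3"
    using f(1) x e unfolding continuous_on_iff by (metis divide_pos_pos zero_less_numeral)
  have "dist (g y) (g x) < e" if y: "y \<in> S" "dist y x < d" for y
    using f(2)[OF x] f(2)[OF y(1)] d(2)[OF y] dist_triangle[of "g y" "g x" "f y"]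
      dist_triangle[of "f y" "g x" "f x"] dist_commute[of "f y" "g y"] by linarith
  with d(1) show "\<exists>d>0. \<forall>y\<in>S. dist y x < d \<longrightarrow> dist (g y) (g x) < e" by blast
qed

lemma finite_borel_integrable_bounded:
  fixes f :: "'a::topological_space \<Rightarrow> 'b::{banach,second_countable_topology}"
  assumes "finite_measure M" "sets M = sets borel" "f \<in> borel_measurable borel" "\<And>x. norm (f x) \<le> c"
  shows "integrable M f"
  using assms(1,3,4) measurable_cong_sets[OF assms(2) refl]
  by (intro finite_measure.integrable_const_bound[of M f c]) auto

lemma norm_integral_le_of_mass_le_1:
  fixes f :: "'a::topological_space \<Rightarrow> 'b::{banach,second_countable_topology}"
  assumes M: "finite_measure M" "sets M = sets borel" "measure M UNIV \<le> 1"
    and f: "integrable M f" "\<And>x. norm (f x) \<le> c" and c: "0 \<le> c"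
  shows "norm (integral\<^sup>L M f) \<le> c"
proof -
  interpret finite_measure M by fact
  have "space M = UNIV" using M(2) sets_eq_imp_space_eq[OF M(2)] by simp
  have "norm (integral\<^sup>L M f) \<le> (\<integral>x. norm (f x) \<partial>M)"
    by (rule integral_norm_bound)
  also have "\<dots> \<le> (\<integral>x. c \<partial>M)"
    using f by (intro integral_mono) auto
  also have "\<dots> = c * measure M UNIV"
    by (simp add: \<open>space M = UNIV\<close>)
  also have "\<dots> \<le> c * 1"
    using M(3) c by (intro mult_left_mono)
  finally show ?thesis by simp
qed

text \<open>The limit density. In the application the mass bound is inherited from the particle densities, whose initial mass
is less than \<open>1\<close>.\<close>

locale vortex_density =
  fixes \<rho> :: "real \<Rightarrow> (real^2) measure" and p :: real
  assumes Cw: "in_Cw \<rho>" and p: "p > 2" and Lp: "in_Linf_loc_Lp p \<rho>"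
    and mass: "0 \<le> t \<Longrightarrow> measure (\<rho> t) UNIV \<le> 1"
begin

lemma sets_density: "0 \<le> t \<Longrightarrow> sets (\<rho> t) = sets borel"
  and finite_density: "0 \<le> t \<Longrightarrow> finite_measure (\<rho> t)"
  using Cw by (auto simp: in_Cw_def Mplus_def)

lemma borel_measurable_density: "0 \<le> t \<Longrightarrow> f \<in> borel_measurable borel \<Longrightarrow> f \<in> borel_measurable (\<rho> t)"
  using measurable_cong_sets[OF sets_density refl] by blast

lemma C0_pairing_continuous: "C0_function \<Phi> \<Longrightarrow> continuous_on {0..} (\<lambda>t. LINT x|\<rho> t. \<Phi> x)"
  using Cw by (simp add: in_Cw_def)

lemma singular_integral_small_AE:
  assumes "0 < T" "0 < \<epsilon>"
  obtains \<delta> where "0 < \<delta>" "AE t in lborel. t \<in> {0..T} \<longrightarrow>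
    (\<forall>x. (\<integral>\<^sup>+y. ennreal (1 + inverse (norm (x - y))) * indicator (ball x \<delta>) y \<partial>\<rho> t) \<le> ennreal \<epsilon>)"
proof -
  obtain C where C: "AE t in lborel. t \<in> {0..T} \<longrightarrow>
     (\<exists>g \<in> borel_measurable lborel. (\<forall>x. 0 \<le> g x) \<and> \<rho> t = density lborel (\<lambda>x. ennreal (g x)) \<and>
        integrable lborel (\<lambda>x. \<bar>g x\<bar> powr p) \<and> (LINT x|lborel. \<bar>g x\<bar> powr p) powr (1 / p) \<le> C)"
    using Lp \<open>0 < T\<close> unfolding in_Linf_loc_Lp_def by blast
  have "0 \<le> max C 0 powr p" by simp
  from Lp_density_singular_integral_small[OF p this \<open>0 < \<epsilon>\<close>] obtain \<delta> where \<delta>: "\<delta> > 0"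
    "\<And>g (x::real^2). g \<in> borel_measurable lborel \<Longrightarrow> (\<And>y. 0 \<le> g y) \<Longrightarrow>
       integrable lborel (\<lambda>y. \<bar>g y\<bar> powr p) \<Longrightarrow> (LINT y|lborel. \<bar>g y\<bar> powr p) \<le> max C 0 powr p \<Longrightarrow>
       (\<integral>\<^sup>+y. ennreal (1 + inverse (norm (x - y))) * indicator (ball x \<delta>) y
          \<partial>density lborel (\<lambda>y. ennreal (g y))) \<le> ennreal \<epsilon>" by blast
  have pth: "L \<le> max C 0 powr p" if "L powr (1 / p) \<le> C" "0 \<le> L" for L
  proof -
    have "(L powr (1 / p)) powr p \<le> max C 0 powr p"
      using that p by (intro powr_mono2) auto
    then show ?thesis using that p by (simp add: powr_powr)
  qed
  show ?thesis
  proof (rule that[OF \<delta>(1)])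
    show "AE t in lborel. t \<in> {0..T} \<longrightarrow>
      (\<forall>x. (\<integral>\<^sup>+y. ennreal (1 + inverse (norm (x - y))) * indicator (ball x \<delta>) y \<partial>\<rho> t) \<le> ennreal \<epsilon>)"
      using C
    proof eventually_elim
      case (elim t)
      show ?case
      proof (intro impI allI)
        fix x assume "t \<in> {0..T}"
        with elim obtain g where g: "g \<in> borel_measurable lborel" "\<And>x. 0 \<le> g x"
          "\<rho> t = density lborel (\<lambda>x. ennreal (g x))" "integrable lborel (\<lambda>x. \<bar>g x\<bar> powr p)"
          "(LINT x|lborel. \<bar>g x\<bar> powr p) powr (1 / p) \<le> C" by blast
        have "(LINT x|lborel. \<bar>g x\<bar> powr p) \<le> max C 0 powr p"
          by (intro pth[OF g(5)] integral_nonneg_AE) auto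
        then show "(\<integral>\<^sup>+y. ennreal (1 + inverse (norm (x - y))) * indicator (ball x \<delta>) y \<partial>\<rho> t) \<le> ennreal \<epsilon>"
          unfolding g(3) by (intro \<delta>(2) g)
      qed
    qed
  qed
qed

lemma coulomb_cut_integrable:
  assumes "0 < \<delta>" "0 \<le> t"
  shows "integrable (\<rho> t) (\<lambda>y. coulomb_cut \<delta> (x - y))"
proof (rule finite_borel_integrable_bounded[OF finite_density[OF assms(2)] sets_density[OF assms(2)]])
  show "norm (coulomb_cut \<delta> (x - y)) \<le> 1 / \<delta>" for y
    by (rule norm_coulomb_cut_le[OF assms(1)])
  show "(\<lambda>y. coulomb_cut \<delta> (x - y)) \<in> borel_measurable borel"
    by measurable
qed

lemma coulomb_cut_diff_integral_le:
  assumes \<delta>: "0 < \<delta>'" "\<delta>' \<le> \<delta>" and t: "0 \<le> t" and "0 \<le> \<epsilon>"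
    and le: "(\<integral>\<^sup>+y. ennreal (1 + inverse (norm (x - y))) * indicator (ball x \<delta>) y \<partial>\<rho> t) \<le> ennreal \<epsilon>"
  shows "(LINT y|\<rho> t. norm (coulomb_cut \<delta>' (x - y) - coulomb_cut \<delta> (x - y))) \<le> \<epsilon>"
proof -
  have "ennreal (LINT y|\<rho> t. norm (coulomb_cut \<delta>' (x - y) - coulomb_cut \<delta> (x - y)))
      = (\<integral>\<^sup>+y. ennreal (norm (coulomb_cut \<delta>' (x - y) - coulomb_cut \<delta> (x - y))) \<partial>\<rho> t)"
    using \<delta> t by (intro nn_integral_eq_integral[symmetric] integrable_norm Bochner_Integration.integrable_diff
        coulomb_cut_integrable) auto
  also have "\<dots> \<le> (\<integral>\<^sup>+y. ennreal (1 + inverse (norm (x - y))) * indicator (ball x \<delta>) y \<partial>\<rho> t)"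
  proof (rule nn_integral_mono)
    fix y
    have "norm (coulomb_cut \<delta>' (x - y) - coulomb_cut \<delta> (x - y))
        \<le> indicator (ball 0 \<delta>) (x - y) * inverse (norm (x - y))"
      by (rule norm_coulomb_cut_diff[OF \<delta>])
    also have "indicator (ball 0 \<delta>) (x - y) = (indicator (ball x \<delta>) y :: real)"
      by (simp only: indicator_def mem_ball_0) (simp only: mem_ball dist_norm)
    also have "\<dots> * inverse (norm (x - y)) \<le> \<dots> * (1 + inverse (norm (x - y)))"
      by (intro mult_left_mono) auto
    finally have "ennreal (norm (coulomb_cut \<delta>' (x - y) - coulomb_cut \<delta> (x - y)))
        \<le> ennreal (indicator (ball x \<delta>) y * (1 + inverse (norm (x - y))))"
      by (rule ennreal_leI)
    also have "\<dots> = ennreal (1 + inverse (norm (x - y))) * indicator (ball x \<delta>) y"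
      by (cases "y \<in> ball x \<delta>") simp_all
    finally show "ennreal (norm (coulomb_cut \<delta>' (x - y) - coulomb_cut \<delta> (x - y)))
        \<le> ennreal (1 + inverse (norm (x - y))) * indicator (ball x \<delta>) y" .
  qed
  also note le
  finally show ?thesis using \<open>0 \<le> \<epsilon>\<close> by simp
qed

text \<open>The \<open>L\<^sup>p\<close> bound holds at almost every time only. For the difference of two regularizations the resulting
estimate holds at every time, since its pairing with \<open>\<rho>(t)\<close> is continuous in \<open>t\<close>. Fatou's lemma then removes the
inner regularization.\<close>

lemma coulomb_cut_uniform:
  assumes "0 < T" "0 < \<epsilon>"
  shows "\<exists>\<delta>>0. \<forall>t\<in>{0..T}. \<forall>x. integrable (\<rho> t) (\<lambda>y. coulomb (x - y)) \<and>
    (LINT y|\<rho> t. norm (coulomb (x - y) - coulomb_cut \<delta> (x - y))) \<le> \<epsilon>"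
proof -
  obtain \<delta> where \<delta>: "0 < \<delta>" and ae: "AE t in lborel. t \<in> {0..T} \<longrightarrow>
    (\<forall>x. (\<integral>\<^sup>+y. ennreal (1 + inverse (norm (x - y))) * indicator (ball x \<delta>) y \<partial>\<rho> t) \<le> ennreal \<epsilon>)"
    using singular_integral_small_AE[OF assms] by blast
  have cut: "(LINT y|\<rho> t. norm (coulomb_cut \<delta>' (x - y) - coulomb_cut \<delta> (x - y))) \<le> \<epsilon>"
    if "0 < \<delta>'" "\<delta>' \<le> \<delta>" "t \<in> {0..T}" for t x \<delta>'
  proof (rule AE_le_imp_le_on_interval[OF \<open>0 < T\<close> _ _ that(3)])
    show "continuous_on {0..T} (\<lambda>t. LINT y|\<rho> t. norm (coulomb_cut \<delta>' (x - y) - coulomb_cut \<delta> (x - y)))"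
      by (rule continuous_on_subset[OF C0_pairing_continuous])
        (use C0_function_reflected[OF C0_function_coulomb_cut_diff] that \<delta> in auto)
    show "AE t in lborel. t \<in> {0..T} \<longrightarrow>
        (LINT y|\<rho> t. norm (coulomb_cut \<delta>' (x - y) - coulomb_cut \<delta> (x - y))) \<le> \<epsilon>"
      using ae by eventually_elim
        (use that assms in \<open>auto intro!: coulomb_cut_diff_integral_le\<close>)
  qed
  have nn: "(\<integral>\<^sup>+y. ennreal (norm (coulomb (x - y) - coulomb_cut \<delta> (x - y))) \<partial>\<rho> t) \<le> ennreal \<epsilon>"
    if t: "t \<in> {0..T}" for t x
  proof -
    let ?d = "\<lambda>n::nat. \<delta> / real (Suc n)"
    have d: "0 < ?d n" "?d n \<le> \<delta>" for n
      using \<delta> by (auto simp: field_simps)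
    have "?d \<longlonglongrightarrow> 0"
      by (rule LIMSEQ_Suc[OF lim_const_over_n])
    then have "filterlim ?d (at_right 0) sequentially"
      unfolding filterlim_at using d by (auto intro!: always_eventually simp del: of_nat_Suc)
    then have lim: "(\<lambda>n. ennreal (norm (coulomb_cut (?d n) z - coulomb_cut \<delta> z)))
        \<longlonglongrightarrow> ennreal (norm (coulomb z - coulomb_cut \<delta> z))" for z
      by (intro tendsto_ennrealI tendsto_norm tendsto_diff tendsto_const
          filterlim_compose[OF coulomb_cut_tendsto])
    have "(\<integral>\<^sup>+y. ennreal (norm (coulomb (x - y) - coulomb_cut \<delta> (x - y))) \<partial>\<rho> t)
        = (\<integral>\<^sup>+y. liminf (\<lambda>n. ennreal (norm (coulomb_cut (?d n) (x - y) - coulomb_cut \<delta> (x - y)))) \<partial>\<rho> t)"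
      by (intro nn_integral_cong lim_imp_Liminf[OF sequentially_bot lim, symmetric])
    also have "\<dots> \<le> liminf (\<lambda>n. \<integral>\<^sup>+y. ennreal (norm (coulomb_cut (?d n) (x - y) - coulomb_cut \<delta> (x - y))) \<partial>\<rho> t)"
      using t by (intro nn_integral_liminf borel_measurable_density; measurable)
    also have "\<dots> \<le> ennreal \<epsilon>"
    proof (rule order_trans[OF Liminf_le_Limsup Limsup_bounded], simp, intro always_eventually allI)
      fix n
      have "(\<integral>\<^sup>+y. ennreal (norm (coulomb_cut (?d n) (x - y) - coulomb_cut \<delta> (x - y))) \<partial>\<rho> t)
         = ennreal (LINT y|\<rho> t. norm (coulomb_cut (?d n) (x - y) - coulomb_cut \<delta> (x - y)))"
        using d \<delta> t by (intro nn_integral_eq_integral integrable_norm Bochner_Integration.integrable_diff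
            coulomb_cut_integrable) auto
      then show "(\<integral>\<^sup>+y. ennreal (norm (coulomb_cut (?d n) (x - y) - coulomb_cut \<delta> (x - y))) \<partial>\<rho> t) \<le> ennreal \<epsilon>"
        using cut[OF d t] by (simp add: ennreal_leI)
    qed
    finally show ?thesis .
  qed
  have int: "integrable (\<rho> t) (\<lambda>y. coulomb (x - y) - coulomb_cut \<delta> (x - y))" if "t \<in> {0..T}" for t x
  proof (rule integrableI_bounded)
    show "(\<lambda>y. coulomb (x - y) - coulomb_cut \<delta> (x - y)) \<in> borel_measurable (\<rho> t)"
      using that by (intro borel_measurable_density; measurable)
    show "(\<integral>\<^sup>+y. ennreal (norm (coulomb (x - y) - coulomb_cut \<delta> (x - y))) \<partial>\<rho> t) < \<infinity>"
      using order_le_less_trans[OF nn[OF that, of x]] by simp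
  qed
  show ?thesis
  proof (intro exI[of _ \<delta>] conjI \<delta> ballI allI)
    fix t x assume t: "t \<in> {0..T}"
    show "integrable (\<rho> t) (\<lambda>y. coulomb (x - y))"
      using Bochner_Integration.integrable_add[OF int[OF t, of x] coulomb_cut_integrable[OF \<delta>, of t x]] t by simp
    show "(LINT y|\<rho> t. norm (coulomb (x - y) - coulomb_cut \<delta> (x - y))) \<le> \<epsilon>"
      using nn[OF t, of x] nn_integral_eq_integral[OF integrable_norm[OF int[OF t, of x]]] assms by simp
  qed
qed

lemma coulomb_integrable:
  assumes "0 \<le> t"
  shows "integrable (\<rho> t) (\<lambda>y. coulomb (x - y))"
proof -
  have "0 < t + 1" "t \<in> {0..t + 1}"
    using assms by auto
  then show ?thesis
    using coulomb_cut_uniform[of "t + 1" 1, OF _ zero_less_one] by blast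
qed

lemma coulomb_cut_approx:
  assumes "0 < T" "0 < \<epsilon>"
  obtains \<delta> where "0 < \<delta>"
    "\<And>t x. t \<in> {0..T} \<Longrightarrow> (LINT y|\<rho> t. norm (coulomb (x - y) - coulomb_cut \<delta> (x - y))) \<le> \<epsilon>"
  using coulomb_cut_uniform[OF assms] by blast

lemma coulomb_integral_bound:
  assumes "0 < T"
  obtains M where "0 \<le> M" "\<And>t x. t \<in> {0..T} \<Longrightarrow> (LINT y|\<rho> t. norm (coulomb (x - y))) \<le> M"
proof -
  obtain \<delta> where \<delta>: "0 < \<delta>"
    "\<And>t x. t \<in> {0..T} \<Longrightarrow> (LINT y|\<rho> t. norm (coulomb (x - y) - coulomb_cut \<delta> (x - y))) \<le> 1"
    using coulomb_cut_approx[OF assms zero_less_one] by blast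
  show ?thesis
  proof (rule that)
    show "0 \<le> 1 + 1 / \<delta>" using \<delta> by simp
    fix t x assume t: "t \<in> {0..T}"
    then have t0: "0 \<le> t" by simp
    note ints = coulomb_integrable[OF t0, of x] coulomb_cut_integrable[OF \<delta>(1) t0, of x]
    have triangle: "norm (coulomb z) \<le> norm (coulomb z - coulomb_cut \<delta> z) + norm (coulomb_cut \<delta> z)" for z
      using norm_triangle_sub[of "coulomb z" "coulomb_cut \<delta> z"] by (simp add: add.commute)
    have "(LINT y|\<rho> t. norm (coulomb (x - y)))
        \<le> (LINT y|\<rho> t. norm (coulomb (x - y) - coulomb_cut \<delta> (x - y)) + norm (coulomb_cut \<delta> (x - y)))"
      by (intro integral_mono integrable_norm Bochner_Integration.integrable_add
          Bochner_Integration.integrable_diff ints triangle)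
    also have "\<dots> = (LINT y|\<rho> t. norm (coulomb (x - y) - coulomb_cut \<delta> (x - y))) + (LINT y|\<rho> t. norm (coulomb_cut \<delta> (x - y)))"
      by (intro Bochner_Integration.integral_add integrable_norm Bochner_Integration.integrable_diff ints)
    finally have split: "(LINT y|\<rho> t. norm (coulomb (x - y)))
        \<le> (LINT y|\<rho> t. norm (coulomb (x - y) - coulomb_cut \<delta> (x - y))) + (LINT y|\<rho> t. norm (coulomb_cut \<delta> (x - y)))" .
    have "norm (LINT y|\<rho> t. norm (coulomb_cut \<delta> (x - y))) \<le> 1 / \<delta>"
      by (rule norm_integral_le_of_mass_le_1[OF finite_density[OF t0] sets_density[OF t0] mass[OF t0]
            integrable_norm[OF ints(2)]])
        (use \<delta> in \<open>auto intro: norm_coulomb_cut_le\<close>)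
    then have "(LINT y|\<rho> t. norm (coulomb_cut \<delta> (x - y))) \<le> 1 / \<delta>" by simp
    with split show "(LINT y|\<rho> t. norm (coulomb (x - y))) \<le> 1 + 1 / \<delta>"
      using \<delta>(2)[OF t, of x] by linarith
  qed
qed

lemma norm_efield_le: "norm (efield (\<rho> t) x) \<le> (LINT y|\<rho> t. norm (coulomb (x - y)))"
  unfolding efield_def by (rule integral_norm_bound)

text \<open>For fixed \<open>x\<close>, continuity in time is weak continuity of \<open>\<rho>\<close>. The Lipschitz bound in \<open>x\<close> is uniform in time
because the mass is at most \<open>1\<close>, and this makes the continuity joint.\<close>

lemma regularized_field_continuous:
  assumes \<delta>: "0 < \<delta>"
  shows "continuous_on ({0..} \<times> UNIV) (\<lambda>z. LINT y|\<rho> (fst z). coulomb_cut \<delta> (snd z - y))"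
proof -
  let ?E = "\<lambda>t x. LINT y|\<rho> t. coulomb_cut \<delta> (x - y)"
  have lip: "norm (?E t x - ?E t x') \<le> 3 / \<delta>\<^sup>2 * norm (x - x')" if t: "0 \<le> t" for t x x'
  proof -
    have "?E t x - ?E t x' = (LINT y|\<rho> t. coulomb_cut \<delta> (x - y) - coulomb_cut \<delta> (x' - y))"
      by (intro Bochner_Integration.integral_diff[symmetric] coulomb_cut_integrable \<delta> t)
    also have "norm \<dots> \<le> 3 / \<delta>\<^sup>2 * norm (x - x')"
    proof (rule norm_integral_le_of_mass_le_1[OF finite_density[OF t] sets_density[OF t] mass[OF t]])
      show "norm (coulomb_cut \<delta> (x - y) - coulomb_cut \<delta> (x' - y)) \<le> 3 / \<delta>\<^sup>2 * norm (x - x')" for y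
        using coulomb_cut_lipschitz[OF \<delta>, of "x - y" "x' - y"] by simp
    qed (auto intro!: Bochner_Integration.integrable_diff coulomb_cut_integrable \<delta> t)
    finally show ?thesis .
  qed
  have time: "continuous_on {0..} (\<lambda>t. ?E t x)" for x
  proof (rule continuous_on_componentwise[THEN iffD2], intro ballI)
    fix b :: "real^2"
    have "continuous_on {0..} (\<lambda>t. LINT y|\<rho> t. coulomb_cut \<delta> (x - y) \<bullet> b)"
      by (rule C0_pairing_continuous[OF C0_function_reflected[OF C0_function_coulomb_cut[OF \<delta>]]])
    then show "continuous_on {0..} (\<lambda>t. ?E t x \<bullet> b)"
      by (rule continuous_on_eq) (auto intro!: integral_inner_left coulomb_cut_integrable \<delta>)
  qed
  show ?thesis
    unfolding continuous_on_def
  proof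
    fix z :: "real \<times> (real^2)" assume z: "z \<in> {0..} \<times> UNIV"
    obtain t0 x0 where z0: "z = (t0, x0)" "0 \<le> t0" using z by auto
    let ?F = "at z within {0..} \<times> UNIV"
    have "((\<lambda>w. ?E (fst w) x0) \<longlongrightarrow> ?E (fst z) x0) ?F"
    proof -
      have "continuous_on ({0..} \<times> UNIV) (\<lambda>w :: real \<times> (real^2). ?E (fst w) x0)"
        by (rule continuous_on_compose2[OF time continuous_on_fst[OF continuous_on_id]]) auto
      then show ?thesis
        using z unfolding continuous_on_def by blast
    qed
    moreover have "((\<lambda>w. ?E (fst w) (snd w) - ?E (fst w) x0) \<longlongrightarrow> 0) ?F"
    proof (rule Lim_null_comparison)
      show "\<forall>\<^sub>F w in ?F. norm (?E (fst w) (snd w) - ?E (fst w) x0) \<le> 3 / \<delta>\<^sup>2 * norm (snd w - x0)"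
        by (simp only: eventually_at_filter) (intro always_eventually allI impI lip, auto)
      have "((\<lambda>w. 3 / \<delta>\<^sup>2 * norm (snd w - x0)) \<longlongrightarrow> 3 / \<delta>\<^sup>2 * norm (snd z - x0)) ?F"
        by (intro tendsto_intros)
      then show "((\<lambda>w. 3 / \<delta>\<^sup>2 * norm (snd w - x0)) \<longlongrightarrow> 0) ?F"
        by (simp add: z0)
    qed
    ultimately have "((\<lambda>w. ?E (fst w) x0 + (?E (fst w) (snd w) - ?E (fst w) x0)) \<longlongrightarrow> ?E (fst z) x0 + 0) ?F"
      by (rule tendsto_add)
    then show "((\<lambda>w. ?E (fst w) (snd w)) \<longlongrightarrow> ?E (fst z) (snd z)) ?F"
      by (simp add: z0)
  qed
qed

lemma efield_continuous: "continuous_on ({0..} \<times> UNIV) (\<lambda>z. efield (\<rho> (fst z)) (snd z))"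
proof (rule continuous_on_halfline_times, rule continuous_on_uniform_approx)
  fix T \<epsilon> :: real assume T: "0 < T" and \<epsilon>: "0 < \<epsilon>"
  obtain \<delta> where \<delta>: "0 < \<delta>"
    "\<And>t x. t \<in> {0..T} \<Longrightarrow> (LINT y|\<rho> t. norm (coulomb (x - y) - coulomb_cut \<delta> (x - y))) \<le> \<epsilon>"
    using coulomb_cut_approx[OF T \<epsilon>] by blast
  have "dist (LINT y|\<rho> t. coulomb_cut \<delta> (x - y)) (efield (\<rho> t) x) \<le> \<epsilon>" if t: "t \<in> {0..T}" for t x
  proof -
    have "efield (\<rho> t) x - (LINT y|\<rho> t. coulomb_cut \<delta> (x - y))
        = (LINT y|\<rho> t. coulomb (x - y) - coulomb_cut \<delta> (x - y))"
      unfolding efield_def using t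
      by (intro Bochner_Integration.integral_diff[symmetric] coulomb_integrable coulomb_cut_integrable \<delta>) auto
    also have "norm \<dots> \<le> \<epsilon>"
      by (rule order_trans[OF integral_norm_bound \<delta>(2)[OF t]])
    finally show ?thesis
      by (subst dist_commute) (simp only: dist_norm)
  qed
  then show "\<exists>f. continuous_on ({0..T} \<times> UNIV) f \<and> (\<forall>z\<in>{0..T} \<times> UNIV. dist (f z) (efield (\<rho> (fst z)) (snd z)) \<le> \<epsilon>)"
    by (intro exI[of _ "\<lambda>z. LINT y|\<rho> (fst z). coulomb_cut \<delta> (snd z - y)"] conjI
        continuous_on_subset[OF regularized_field_continuous[OF \<delta>(1)]]) auto
qed

text \<open>The change of the measure is handled by weak continuity with the integrand frozen at time \<open>t0\<close>, the change of the
integrand by uniform continuity on compact sets together with the mass bound.\<close>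

lemma pairing_continuous:
  fixes F :: "real \<times> (real^2) \<Rightarrow> real"
  assumes F: "continuous_on ({0..} \<times> UNIV) F" and supp: "\<And>t x. R < norm x \<Longrightarrow> F (t, x) = 0"
  shows "continuous_on {0..} (\<lambda>t. LINT x|\<rho> t. F (t, x))"
  unfolding continuous_on_iff
proof (intro ballI allI impI)
  fix t0 e :: real assume t0: "t0 \<in> {0..}" and e: "0 < e"
  have slice: "continuous_on UNIV (\<lambda>x. F (t, x))" if "0 \<le> t" for t
    using that by (intro continuous_on_compose2[OF F]) (auto intro!: continuous_intros)
  have C0: "C0_function (\<lambda>x. F (t, x))" if "0 \<le> t" for t
    unfolding C0_function_def
    by (auto intro!: slice that tendsto_eventually eventually_at_infinityI[of "R + 1"] supp)
  have int: "integrable (\<rho> s) (\<lambda>x. F (t, x))" if ts: "0 \<le> t" "0 \<le> s" for s t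
  proof -
    have "compact ((\<lambda>x. F (t, x)) ` cball 0 R)"
      by (intro compact_continuous_image continuous_on_subset[OF slice] ts) auto
    then obtain B where B: "\<forall>x\<in>cball 0 R. norm (F (t, x)) \<le> B"
      using bounded_iff compact_imp_bounded by (metis imageI)
    have "norm (F (t, x)) \<le> max B 0" for x
      using B supp[of x t] by (cases "norm x \<le> R") (auto simp: le_max_iff_disj)
    then show ?thesis
      by (intro finite_borel_integrable_bounded[where c = "max B 0"] finite_density sets_density ts
          borel_measurable_continuous_onI slice)
  qed
  have "uniformly_continuous_on ({0..t0 + 1} \<times> cball 0 R) F"
    by (intro compact_uniformly_continuous continuous_on_subset[OF F] compact_Times) auto
  then obtain d1 where d1: "0 < d1"
    "\<And>z w. z \<in> {0..t0 + 1} \<times> cball 0 R \<Longrightarrow> w \<in> {0..t0 + 1} \<times> cball 0 R \<Longrightarrow> dist w z < d1 \<Longrightarrow> dist (F w) (F z) < e / 2"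
    unfolding uniformly_continuous_on_def using e by (metis half_gt_zero)
  obtain d2 where d2: "0 < d2"
    "\<And>t. t \<in> {0..} \<Longrightarrow> dist t t0 < d2 \<Longrightarrow> dist (LINT x|\<rho> t. F (t0, x)) (LINT x|\<rho> t0. F (t0, x)) < e / 2"
    using C0_pairing_continuous[OF C0[of t0]] t0 e unfolding continuous_on_iff
    by (metis atLeast_iff half_gt_zero)
  show "\<exists>d>0. \<forall>t\<in>{0..}. dist t t0 < d \<longrightarrow> dist (LINT x|\<rho> t. F (t, x)) (LINT x|\<rho> t0. F (t0, x)) < e"
  proof (intro exI[of _ "min 1 (min d1 d2)"] conjI ballI impI)
    show "0 < min 1 (min d1 d2)" using d1 d2 by simp
    fix t assume t: "t \<in> {0..}" "dist t t0 < min 1 (min d1 d2)"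
    then have t': "0 \<le> t" "t \<le> t0 + 1" "dist t t0 < d1" "dist t t0 < d2"
      by (auto simp: dist_real_def)
    have diff: "norm (F (t, x) - F (t0, x)) \<le> e / 2" for x
    proof (cases "norm x \<le> R")
      case True
      have "dist (t, x) (t0, x) < d1" using t'(3) by (simp add: dist_Pair_Pair)
      then show ?thesis
        using d1(2)[of "(t0, x)" "(t, x)"] True t' t0 by (simp add: dist_norm)
    qed (use supp e in simp)
    have "dist (LINT x|\<rho> t. F (t, x)) (LINT x|\<rho> t. F (t0, x)) = norm (LINT x|\<rho> t. F (t, x) - F (t0, x))"
      using t' t0 by (subst Bochner_Integration.integral_diff) (auto simp: dist_norm intro!: int)
    also have "\<dots> \<le> e / 2"
      using e t' t0 diff
      by (intro norm_integral_le_of_mass_le_1 finite_density sets_density mass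
          Bochner_Integration.integrable_diff int) auto
    finally show "dist (LINT x|\<rho> t. F (t, x)) (LINT x|\<rho> t0. F (t0, x)) < e"
      using d2(2)[OF t(1) t'(4)] dist_triangle[of "LINT x|\<rho> t. F (t, x)" "LINT x|\<rho> t0. F (t0, x)" "LINT x|\<rho> t. F (t0, x)"]
      by linarith
  qed
qed

text \<open>The integrand is singular along the trajectory \<open>\<xi>\<close>. Regularizing the kernel changes the pairing by an amount that is
small uniformly in \<open>t\<close>, and regularized pairings are continuous.\<close>

lemma singular_pairing_continuous:
  fixes V :: "real \<times> (real^2) \<Rightarrow> real^2"
  assumes V: "continuous_on ({0..} \<times> UNIV) V" "\<And>t x. R < norm x \<Longrightarrow> V (t, x) = 0"
    "\<And>z. norm (V z) \<le> B" and \<xi>: "continuous_on {0..} \<xi>"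
  shows "continuous_on {0..} (\<lambda>t. LINT x|\<rho> t. perp (coulomb (x - \<xi> t)) \<bullet> V (t, x))"
proof (rule continuous_on_halfline, rule continuous_on_uniform_approx)
  fix T \<epsilon> :: real assume T: "0 < T" and \<epsilon>: "0 < \<epsilon>"
  have B: "0 \<le> B" using V(3)[of 0] norm_ge_zero order_trans by blast
  then have "0 < \<epsilon> / (B + 1)" using \<epsilon> by simp
  from coulomb_cut_approx[OF T this] obtain \<delta> where \<delta>: "0 < \<delta>"
    "\<And>t x. t \<in> {0..T} \<Longrightarrow> (LINT y|\<rho> t. norm (coulomb (x - y) - coulomb_cut \<delta> (x - y))) \<le> \<epsilon> / (B + 1)"
    by blast
  let ?f = "\<lambda>t. LINT x|\<rho> t. perp (coulomb_cut \<delta> (x - \<xi> t)) \<bullet> V (t, x)"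
  have cut: "continuous_on {0..} ?f"
  proof (rule pairing_continuous[where F = "\<lambda>z. perp (coulomb_cut \<delta> (snd z - \<xi> (fst z))) \<bullet> V z", simplified])
    show "continuous_on ({0..} \<times> UNIV) (\<lambda>z. perp (coulomb_cut \<delta> (snd z - \<xi> (fst z))) \<bullet> V z)"
      by (intro continuous_intros V(1) continuous_on_compose2[OF continuous_on_coulomb_cut[OF \<delta>(1)]]
          continuous_on_compose2[OF \<xi>]) auto
    show "perp (coulomb_cut \<delta> (x - \<xi> t)) \<bullet> V (t, x) = 0" if "R < norm x" for t x
      using V(2)[OF that] by simp
  qed
  have "dist (?f t) (LINT x|\<rho> t. perp (coulomb (x - \<xi> t)) \<bullet> V (t, x)) \<le> \<epsilon>" if t: "t \<in> {0..T}" for t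
  proof -
    have t0: "0 \<le> t" using t by simp
    have Vm: "(\<lambda>x. V (t, x)) \<in> borel_measurable borel"
      using t0 by (intro borel_measurable_continuous_onI continuous_on_compose2[OF V(1)]) (auto intro!: continuous_intros)
    have flip: "coulomb (x - \<xi> t) = - coulomb (\<xi> t - x)" "coulomb_cut \<delta> (x - \<xi> t) = - coulomb_cut \<delta> (\<xi> t - x)" for x
      using coulomb_minus[of "\<xi> t - x"] coulomb_cut_minus[of \<delta> "\<xi> t - x"] by simp_all
    have diff_int: "integrable (\<rho> t) (\<lambda>x. norm (coulomb (\<xi> t - x) - coulomb_cut \<delta> (\<xi> t - x)))"
      by (intro integrable_norm Bochner_Integration.integrable_diff coulomb_integrable coulomb_cut_integrable t0 \<delta>)
    have int: "integrable (\<rho> t) (\<lambda>x. perp (K x) \<bullet> V (t, x))" if K: "integrable (\<rho> t) K" for K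
    proof (rule Bochner_Integration.integrable_bound[OF integrable_mult_right[of B, OF integrable_norm[OF K]]])
      have "K \<in> borel_measurable borel"
        using borel_measurable_integrable[OF K] measurable_cong_sets[OF sets_density[OF t0] refl] by blast
      then show "(\<lambda>x. perp (K x) \<bullet> V (t, x)) \<in> borel_measurable (\<rho> t)"
        using Vm by (intro borel_measurable_density t0 borel_measurable_inner measurable_compose[OF _ perp_borel])
      have "norm (perp (K x) \<bullet> V (t, x)) \<le> norm (B * norm (K x))" for x
        using Cauchy_Schwarz_ineq2[of "perp (K x)" "V (t, x)"] mult_left_mono[OF V(3)[of "(t, x)"], of "norm (K x)"] B
        by (simp add: abs_mult mult.commute)
      then show "AE x in \<rho> t. norm (perp (K x) \<bullet> V (t, x)) \<le> norm (B * norm (K x))" by simp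
    qed
    have K1: "integrable (\<rho> t) (\<lambda>x. coulomb (x - \<xi> t))" "integrable (\<rho> t) (\<lambda>x. coulomb_cut \<delta> (x - \<xi> t))"
      unfolding flip by (intro integrable_minus coulomb_integrable coulomb_cut_integrable t0 \<delta>)+
    have "?f t - (LINT x|\<rho> t. perp (coulomb (x - \<xi> t)) \<bullet> V (t, x))
        = (LINT x|\<rho> t. perp (coulomb_cut \<delta> (x - \<xi> t)) \<bullet> V (t, x) - perp (coulomb (x - \<xi> t)) \<bullet> V (t, x))"
      by (intro Bochner_Integration.integral_diff[symmetric] int K1)
    also have "norm \<dots> \<le> (LINT x|\<rho> t. norm (perp (coulomb_cut \<delta> (x - \<xi> t)) \<bullet> V (t, x) - perp (coulomb (x - \<xi> t)) \<bullet> V (t, x)))"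
      by (rule integral_norm_bound)
    also have "\<dots> \<le> (LINT x|\<rho> t. B * norm (coulomb (\<xi> t - x) - coulomb_cut \<delta> (\<xi> t - x)))"
    proof (intro integral_mono integrable_norm Bochner_Integration.integrable_diff int K1 integrable_mult_right diff_int)
      fix x
      have "norm (perp (coulomb (\<xi> t - x) - coulomb_cut \<delta> (\<xi> t - x)) \<bullet> V (t, x))
          \<le> norm (coulomb (\<xi> t - x) - coulomb_cut \<delta> (\<xi> t - x)) * B"
        using Cauchy_Schwarz_ineq2[of "perp (coulomb (\<xi> t - x) - coulomb_cut \<delta> (\<xi> t - x))" "V (t, x)"]
          mult_left_mono[OF V(3)[of "(t, x)"], of "norm (coulomb (\<xi> t - x) - coulomb_cut \<delta> (\<xi> t - x))"] by simp
      then show "norm (perp (coulomb_cut \<delta> (x - \<xi> t)) \<bullet> V (t, x) - perp (coulomb (x - \<xi> t)) \<bullet> V (t, x))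
          \<le> B * norm (coulomb (\<xi> t - x) - coulomb_cut \<delta> (\<xi> t - x))"
        unfolding flip by (simp add: perp_simps inner_diff_left mult.commute)
    qed (use coulomb_integrable[OF t0] coulomb_cut_integrable[OF \<delta>(1) t0] in auto)
    also have "\<dots> = B * (LINT x|\<rho> t. norm (coulomb (\<xi> t - x) - coulomb_cut \<delta> (\<xi> t - x)))"
      by simp
    also have "\<dots> \<le> B * (\<epsilon> / (B + 1))"
      by (intro mult_left_mono \<delta>(2)[OF t] B)
    also have "\<dots> \<le> \<epsilon>"
      using B \<epsilon> by (simp add: field_simps)
    finally show ?thesis
      by (simp only: dist_norm)
  qed
  with cut show "\<exists>f. continuous_on {0..T} f \<and>
      (\<forall>t\<in>{0..T}. dist (f t) (LINT x|\<rho> t. perp (coulomb (x - \<xi> t)) \<bullet> V (t, x)) \<le> \<epsilon>)"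
    by (intro exI[of _ ?f] conjI continuous_on_subset[OF cut]) auto
qed

end

section \<open>Interaction of a density with a point charge\<close>

lemma space_measure_plus: "space (measure_plus \<mu> \<nu>) = UNIV"
  using sets_eq_imp_space_eq[OF sets_measure_plus[of \<mu> \<nu>]] by simp

lemma nn_integral_measure_plus:
  fixes \<mu> \<nu> :: "('a::topological_space) measure"
  assumes sets: "sets \<mu> = sets borel" "sets \<nu> = sets borel" and f: "f \<in> borel_measurable borel"
  shows "(\<integral>\<^sup>+x. f x \<partial>measure_plus \<mu> \<nu>) = (\<integral>\<^sup>+x. f x \<partial>\<mu>) + (\<integral>\<^sup>+x. f x \<partial>\<nu>)"
proof -
  have meas: "borel_measurable (measure_plus \<mu> \<nu>) = (borel_measurable borel :: ('a \<Rightarrow> ennreal) set)"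
     "borel_measurable \<mu> = (borel_measurable borel :: ('a \<Rightarrow> ennreal) set)"
     "borel_measurable \<nu> = (borel_measurable borel :: ('a \<Rightarrow> ennreal) set)"
    using sets sets_measure_plus[of \<mu> \<nu>] by (auto intro!: measurable_cong_sets)
  from f show ?thesis
  proof (induction rule: borel_measurable_induct)
    case (cong f g)
    then show ?case by (metis ext space_borel UNIV_I)
  next
    case (set A)
    then show ?case
      by (simp add: emeasure_measure_plus sets sets_measure_plus)
  next
    case (mult u c)
    then show ?case by (simp add: nn_integral_cmult meas ring_distribs)
  next
    case (add u v)
    then show ?case by (simp add: nn_integral_add meas ac_simps)
  next
    case (seq U)
    have "(\<integral>\<^sup>+x. (SUP i. U i x) \<partial>measure_plus \<mu> \<nu>) = (SUP i. (\<integral>\<^sup>+x. U i x \<partial>\<mu>) + (\<integral>\<^sup>+x. U i x \<partial>\<nu>))"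
      using seq by (subst nn_integral_monotone_convergence_SUP) (auto simp: meas)
    also have "\<dots> = (SUP i. (\<integral>\<^sup>+x. U i x \<partial>\<mu>)) + (SUP i. (\<integral>\<^sup>+x. U i x \<partial>\<nu>))"
      using seq by (intro ennreal_SUP_add incseq_nn_integral)
    also have "\<dots> = (\<integral>\<^sup>+x. (SUP i. U i x) \<partial>\<mu>) + (\<integral>\<^sup>+x. (SUP i. U i x) \<partial>\<nu>)"
      using seq by (subst (1 2) nn_integral_monotone_convergence_SUP) (auto simp: meas)
    finally show ?case by (simp add: image_image SUP_apply[abs_def])
  qed
qed

lemma nn_integral_add_charge:
  assumes "sets \<mu> = sets borel" "f \<in> borel_measurable borel"
  shows "(\<integral>\<^sup>+x. f x \<partial>add_charge \<gamma> \<mu> a) = (\<integral>\<^sup>+x. f x \<partial>\<mu>) + ennreal \<gamma> * f a"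
  unfolding add_charge_def using assms
  by (subst nn_integral_measure_plus) (auto simp: nn_integral_scale_measure nn_integral_return)

lemma sets_add_charge: "sets (add_charge \<gamma> \<mu> a) = sets borel"
  by (simp add: add_charge_def sets_measure_plus)

lemma integrable_add_charge:
  fixes f :: "real^2 \<Rightarrow> 'b::{banach,second_countable_topology}"
  assumes \<mu>: "sets \<mu> = sets borel" and f: "integrable \<mu> f"
  shows "integrable (add_charge \<gamma> \<mu> a) f"
proof (rule integrableI_bounded)
  have fm: "f \<in> borel_measurable borel"
    using borel_measurable_integrable[OF f] measurable_cong_sets[OF \<mu> refl] by blast
  then show "f \<in> borel_measurable (add_charge \<gamma> \<mu> a)"
    using measurable_cong_sets[OF sets_add_charge refl] by blast
  have "(\<integral>\<^sup>+x. ennreal (norm (f x)) \<partial>\<mu>) < \<infinity>"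
    using f by (simp add: integrable_iff_bounded)
  then show "(\<integral>\<^sup>+x. ennreal (norm (f x)) \<partial>add_charge \<gamma> \<mu> a) < \<infinity>"
    using fm by (subst nn_integral_add_charge[OF \<mu>]) (auto simp: ennreal_mult_less_top)
qed

lemma integral_add_charge_real:
  fixes f :: "real^2 \<Rightarrow> real"
  assumes \<gamma>: "0 \<le> \<gamma>" and \<mu>: "sets \<mu> = sets borel" and f: "integrable \<mu> f"
  shows "(LINT x|add_charge \<gamma> \<mu> a. f x) = (LINT x|\<mu>. f x) + \<gamma> * f a"
proof -
  have [measurable]: "f \<in> borel_measurable borel"
    using borel_measurable_integrable[OF f] measurable_cong_sets[OF \<mu> refl] by blast
  have fin: "(\<integral>\<^sup>+x. ennreal (f x) \<partial>\<mu>) < \<infinity>" "(\<integral>\<^sup>+x. ennreal (- f x) \<partial>\<mu>) < \<infinity>"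
    using f by (auto simp: real_integrable_def less_top)
  have part: "enn2real (A + ennreal \<gamma> * ennreal c) = enn2real A + \<gamma> * max 0 c" if "A < \<infinity>" for A c
    using that \<gamma> by (cases "0 \<le> c")
      (auto simp: enn2real_plus ennreal_neg simp flip: ennreal_mult)
  have nn: "(\<integral>\<^sup>+x. ennreal (f x) \<partial>add_charge \<gamma> \<mu> a) = (\<integral>\<^sup>+x. ennreal (f x) \<partial>\<mu>) + ennreal \<gamma> * ennreal (f a)"
    "(\<integral>\<^sup>+x. ennreal (- f x) \<partial>add_charge \<gamma> \<mu> a) = (\<integral>\<^sup>+x. ennreal (- f x) \<partial>\<mu>) + ennreal \<gamma> * ennreal (- f a)"
    by (intro nn_integral_add_charge[OF \<mu>]; measurable)+
  have "(LINT x|add_charge \<gamma> \<mu> a. f x)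
      = enn2real (\<integral>\<^sup>+x. ennreal (f x) \<partial>\<mu>) - enn2real (\<integral>\<^sup>+x. ennreal (- f x) \<partial>\<mu>)
        + \<gamma> * (max 0 (f a) - max 0 (- f a))"
    unfolding real_lebesgue_integral_def[OF integrable_add_charge[OF \<mu> f]]
    by (simp only: nn part[OF fin(1)] part[OF fin(2)]) (simp add: algebra_simps)
  also have "max 0 (f a) - max 0 (- f a) = f a"
    by simp
  finally show ?thesis
    by (simp add: real_lebesgue_integral_def[OF f])
qed

lemma integral_add_charge:
  fixes f :: "real^2 \<Rightarrow> real^2"
  assumes \<gamma>: "0 \<le> \<gamma>" and \<mu>: "sets \<mu> = sets borel" and f: "integrable \<mu> f"
  shows "(LINT x|add_charge \<gamma> \<mu> a. f x) = (LINT x|\<mu>. f x) + \<gamma> *\<^sub>R f a"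
proof (rule euclidean_eqI)
  fix b :: "real^2"
  have "(LINT x|add_charge \<gamma> \<mu> a. f x) \<bullet> b = (LINT x|add_charge \<gamma> \<mu> a. f x \<bullet> b)"
    by (rule integral_inner_left[symmetric]) (rule integrable_add_charge[OF \<mu> f])
  also have "\<dots> = (LINT x|\<mu>. f x \<bullet> b) + \<gamma> * (f a \<bullet> b)"
    by (intro integral_add_charge_real \<gamma> \<mu> integrable_inner_left f)
  also have "(LINT x|\<mu>. f x \<bullet> b) = (LINT x|\<mu>. f x) \<bullet> b"
    by (rule integral_inner_left) (rule f)
  finally show "(LINT x|add_charge \<gamma> \<mu> a. f x) \<bullet> b = ((LINT x|\<mu>. f x) + \<gamma> *\<^sub>R f a) \<bullet> b"
    by (simp add: inner_add_left)
qed

lemma finite_measure_add_charge: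
  assumes "finite_measure \<mu>" "sets \<mu> = sets borel"
  shows "finite_measure (add_charge \<gamma> \<mu> a)"
proof (rule finite_measureI)
  interpret finite_measure \<mu> by fact
  have "space \<mu> = UNIV" using sets_eq_imp_space_eq[OF assms(2)] by simp
  moreover have "emeasure (add_charge \<gamma> \<mu> a) UNIV = emeasure \<mu> UNIV + ennreal \<gamma>"
    unfolding add_charge_def using assms(2) by (subst emeasure_measure_plus) auto
  ultimately show "emeasure (add_charge \<gamma> \<mu> a) (space (add_charge \<gamma> \<mu> a)) \<noteq> \<infinity>"
    using emeasure_finite[of UNIV] by (simp add: add_charge_def space_measure_plus)
qed

text \<open>The field bound is a function of \<open>x\<close> rather than a constant because for a measure with an atom the field is unbounded
near the atom.\<close>

lemma integrable_coulomb_pair: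
  assumes fin: "finite_measure \<mu>" and sets: "sets \<mu> = sets borel"
    and ac: "\<And>x. integrable \<mu> (\<lambda>y. coulomb (x - y))" "\<And>x. (LINT y|\<mu>. norm (coulomb (x - y))) \<le> h x"
    and h: "integrable \<mu> h"
  shows "integrable (\<mu> \<Otimes>\<^sub>M \<mu>) (\<lambda>(x, y). coulomb (x - y))"
proof -
  interpret finite_measure \<mu> by fact
  interpret pair_sigma_finite \<mu> \<mu> ..
  have "(\<lambda>z. coulomb (fst z - snd z)) \<in> borel_measurable (borel \<Otimes>\<^sub>M borel)"
    by measurable
  then have "(\<lambda>(x, y). coulomb (x - y)) \<in> borel_measurable (borel \<Otimes>\<^sub>M borel)"
    by (simp add: case_prod_beta)
  then have meas: "(\<lambda>(x, y). coulomb (x - y)) \<in> borel_measurable (\<mu> \<Otimes>\<^sub>M \<mu>)"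
    using measurable_cong_sets[OF sets_pair_measure_cong[OF sets sets] refl] by blast
  show ?thesis
  proof (rule Fubini_integrable[OF meas])
    have "(\<lambda>(x, y). norm (coulomb (x - y))) \<in> borel_measurable (\<mu> \<Otimes>\<^sub>M \<mu>)"
      using measurable_compose[OF meas borel_measurable_norm] by (simp add: case_prod_beta')
    then have "(\<lambda>x. LINT y|\<mu>. norm (case (x, y) of (x, y) \<Rightarrow> coulomb (x - y))) \<in> borel_measurable \<mu>"
      using borel_measurable_lebesgue_integral by simp
    then show "integrable \<mu> (\<lambda>x. LINT y|\<mu>. norm (case (x, y) of (x, y) \<Rightarrow> coulomb (x - y)))"
      by (rule Bochner_Integration.integrable_bound[OF h])
        (use ac(2) in \<open>auto intro!: AE_I2 simp: integral_nonneg_AE intro: order_trans[OF _ abs_ge_self]\<close>)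
  qed (use ac(1) in auto)
qed

lemma H_kernel_eq:
  "H_kernel \<Phi> x y = perp (coulomb (x - y)) \<bullet> grad \<Phi> x + perp (coulomb (y - x)) \<bullet> grad \<Phi> y"
proof -
  have "perp (coulomb (y - x)) = - perp (coulomb (x - y))"
    using coulomb_minus[of "x - y"] by (simp add: perp_simps)
  then show ?thesis
    by (auto simp: H_kernel_def coulomb_def perp_simps inner_diff_right)
qed

text \<open>Since \<open>coulomb\<close> is odd, \<open>H_kernel \<Phi> x y = h x y + h y x\<close> with \<open>h x y = perp (coulomb (x - y)) \<bullet> grad \<Phi> x\<close>. Each
summand is integrable by itself, exchanging the variables shows that both have the same integral, and the inner
integral of \<open>h\<close> produces the field.\<close>

lemma vortex_interaction_eq:
  assumes fin: "finite_measure \<mu>" and sets: "sets \<mu> = sets borel"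
    and K: "integrable (\<mu> \<Otimes>\<^sub>M \<mu>) (\<lambda>(x, y). coulomb (x - y))" "\<And>x. integrable \<mu> (\<lambda>y. coulomb (x - y))"
    and G: "grad \<Phi> \<in> borel_measurable borel" "\<And>x. norm (grad \<Phi> x) \<le> B"
  shows "vortex_interaction \<Phi> \<mu> \<mu> = (LINT x|\<mu>. perp (efield \<mu> x) \<bullet> grad \<Phi> x)"
proof -
  interpret finite_measure \<mu> by fact
  interpret pair_sigma_finite \<mu> \<mu> ..
  let ?h = "\<lambda>(x, y). perp (coulomb (x - y)) \<bullet> grad \<Phi> x"
  have pair: "sets (\<mu> \<Otimes>\<^sub>M \<mu>) = sets (borel \<Otimes>\<^sub>M borel)"
    by (rule sets_pair_measure_cong[OF sets sets])
  note G(1)[measurable]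
  have "(\<lambda>z. perp (coulomb (fst z - snd z)) \<bullet> grad \<Phi> (fst z)) \<in> borel_measurable (borel \<Otimes>\<^sub>M borel)"
    by measurable
  then have "?h \<in> borel_measurable (borel \<Otimes>\<^sub>M borel)"
    by (simp add: case_prod_beta')
  then have hm: "?h \<in> borel_measurable (\<mu> \<Otimes>\<^sub>M \<mu>)"
    using measurable_cong_sets[OF pair refl] by blast
  have h: "integrable (\<mu> \<Otimes>\<^sub>M \<mu>) ?h"
  proof (rule Bochner_Integration.integrable_bound[OF integrable_scaleR_right[of B, OF integrable_norm[OF K(1)]] hm])
    have "norm (?h z) \<le> norm (B *\<^sub>R norm (case z of (x, y) \<Rightarrow> coulomb (x - y)))" for z
    proof -
      obtain x y where z: "z = (x, y)" by force
      have "\<bar>perp (coulomb (x - y)) \<bullet> grad \<Phi> x\<bar> \<le> norm (coulomb (x - y)) * norm (grad \<Phi> x)"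
        using Cauchy_Schwarz_ineq2[of "perp (coulomb (x - y))" "grad \<Phi> x"] by simp
      also have "\<dots> \<le> norm (coulomb (x - y)) * \<bar>B\<bar>"
        using G(2)[of x] by (intro mult_left_mono) auto
      finally show ?thesis by (simp add: z mult.commute abs_mult)
    qed
    then show "AE z in \<mu> \<Otimes>\<^sub>M \<mu>. norm (?h z) \<le> norm (B *\<^sub>R norm (case z of (x, y) \<Rightarrow> coulomb (x - y)))"
      by simp
  qed
  have swap: "integrable (\<mu> \<Otimes>\<^sub>M \<mu>) (\<lambda>(x, y). ?h (y, x))"
    by (rule integrable_product_swap[OF h])
  have "(LINT (x, y)|(\<mu> \<Otimes>\<^sub>M \<mu>). H_kernel \<Phi> x y) = (LINT z|(\<mu> \<Otimes>\<^sub>M \<mu>). ?h z + (case z of (x, y) \<Rightarrow> ?h (y, x)))"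
    by (intro Bochner_Integration.integral_cong) (auto simp: H_kernel_eq)
  also have "\<dots> = integral\<^sup>L (\<mu> \<Otimes>\<^sub>M \<mu>) ?h + (LINT (x, y)|(\<mu> \<Otimes>\<^sub>M \<mu>). ?h (y, x))"
    by (rule Bochner_Integration.integral_add[OF h swap])
  also have "(LINT (x, y)|(\<mu> \<Otimes>\<^sub>M \<mu>). ?h (y, x)) = integral\<^sup>L (\<mu> \<Otimes>\<^sub>M \<mu>) ?h"
    by (rule integral_product_swap) (rule hm)
  finally have "vortex_interaction \<Phi> \<mu> \<mu> = integral\<^sup>L (\<mu> \<Otimes>\<^sub>M \<mu>) ?h"
    by (simp add: vortex_interaction_def)
  also have "\<dots> = (LINT x|\<mu>. LINT y|\<mu>. ?h (x, y))"
    by (rule integral_fst'[OF h, symmetric])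
  also have "\<dots> = (LINT x|\<mu>. perp (efield \<mu> x) \<bullet> grad \<Phi> x)"
  proof (intro Bochner_Integration.integral_cong refl)
    fix x
    have "(LINT y|\<mu>. perp (coulomb (x - y)) \<bullet> grad \<Phi> x) = (LINT y|\<mu>. perp (coulomb (x - y))) \<bullet> grad \<Phi> x"
      by (intro integral_inner_left integrable_bounded_linear[OF bounded_linear_perp] K(2))
    also have "(LINT y|\<mu>. perp (coulomb (x - y))) = perp (efield \<mu> x)"
      unfolding efield_def by (rule integral_bounded_linear[OF bounded_linear_perp K(2)])
    finally show "(LINT y|\<mu>. ?h (x, y)) = perp (efield \<mu> x) \<bullet> grad \<Phi> x"
      by simp
  qed
  finally show ?thesis .
qed

section \<open>Total mass of the limit density\<close>

text \<open>For a non-integrable function the Bochner integral on the left is \<open>0\<close>.\<close>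

lemma integral_le_nn_integral:
  fixes f :: "'a \<Rightarrow> real"
  shows "ennreal (integral\<^sup>L M f) \<le> (\<integral>\<^sup>+x. ennreal (f x) \<partial>M)"
proof (cases "integrable M f \<and> (\<integral>\<^sup>+x. ennreal (f x) \<partial>M) < \<infinity>")
  case True
  then have "integral\<^sup>L M f \<le> enn2real (\<integral>\<^sup>+x. ennreal (f x) \<partial>M)"
    by (simp add: real_lebesgue_integral_def)
  then have "ennreal (integral\<^sup>L M f) \<le> ennreal (enn2real (\<integral>\<^sup>+x. ennreal (f x) \<partial>M))"
    by (rule ennreal_leI)
  also have "\<dots> = (\<integral>\<^sup>+x. ennreal (f x) \<partial>M)"
    using True by (intro ennreal_enn2real) simp
  finally show ?thesis .
next
  case False
  then show ?thesis
    by (cases "integrable M f") (auto simp: not_integrable_integral_eq less_top)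
qed

lemma emeasure_spatial_measure_le:
  fixes g :: "(real^2) \<times> (real^2) \<Rightarrow> real"
  assumes g: "integrable lborel g"
  shows "emeasure (spatial_measure g) UNIV \<le> (\<integral>\<^sup>+z. ennreal (g z) \<partial>lborel)"
proof -
  have gm [measurable]: "g \<in> borel_measurable (lborel \<Otimes>\<^sub>M lborel)"
    using borel_measurable_integrable[OF g] by (simp add: lborel_prod)
  have "(\<lambda>x. LINT v|lborel. g (x, v)) \<in> borel_measurable lborel"
    by measurable
  then have "emeasure (spatial_measure g) UNIV = (\<integral>\<^sup>+x. ennreal (LINT v|lborel. g (x, v)) \<partial>lborel)"
    unfolding spatial_measure_def spatial_density_def by (subst emeasure_density) auto
  also have "\<dots> \<le> (\<integral>\<^sup>+x. (\<integral>\<^sup>+v. ennreal (g (x, v)) \<partial>lborel) \<partial>lborel)"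
    by (intro nn_integral_mono integral_le_nn_integral)
  also have "\<dots> = (\<integral>\<^sup>+z. ennreal (g z) \<partial>(lborel \<Otimes>\<^sub>M lborel))"
    by (rule lborel.nn_integral_fst) simp
  finally show ?thesis by (simp add: lborel_prod)
qed

text \<open>The phase space density is transported by the flow, so its total mass is that of the initial datum.\<close>

lemma solution_mass_le:
  assumes sol: "vp_global_solution \<gamma> \<epsilon> f0 \<xi>0 \<eta>0 f \<xi> \<eta>" and f0: "integrable lborel f0" and t: "0 \<le> t"
  shows "emeasure (spatial_measure (f t)) UNIV \<le> ennreal (L1_norm f0)"
proof -
  obtain X V where flow: "vp_flow \<gamma> \<epsilon> \<xi>0 f \<xi> X V"
    and push: "density lborel (\<lambda>z. ennreal (f t z)) = distr (density lborel (\<lambda>z. ennreal (f0 z))) borel (\<lambda>z. (X t z, V t z))"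
    using sol t unfolding vp_global_solution_def by blast
  have ft: "integrable lborel (f t)"
    using sol t unfolding vp_global_solution_def by blast
  have "(\<lambda>z. (X t z, V t z)) \<in> borel_measurable borel"
    using flow t unfolding vp_flow_def by blast
  then have meas: "(\<lambda>z. (X t z, V t z)) \<in> measurable (density lborel (\<lambda>z. ennreal (f0 z))) borel"
    by simp
  have [measurable]: "f0 \<in> borel_measurable borel" "f t \<in> borel_measurable borel"
    using f0 ft by (auto dest: borel_measurable_integrable)
  have "emeasure (spatial_measure (f t)) UNIV \<le> (\<integral>\<^sup>+z. ennreal (f t z) \<partial>lborel)"
    by (rule emeasure_spatial_measure_le[OF ft])
  also have "\<dots> = emeasure (density lborel (\<lambda>z. ennreal (f t z))) UNIV"
    by (subst emeasure_density) auto
  also have "\<dots> = emeasure (density lborel (\<lambda>z. ennreal (f0 z))) UNIV"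
    unfolding push by (subst emeasure_distr[OF meas]) auto
  also have "\<dots> = (\<integral>\<^sup>+z. ennreal (f0 z) \<partial>lborel)"
    by (subst emeasure_density) auto
  also have "\<dots> \<le> (\<integral>\<^sup>+z. ennreal (norm (f0 z)) \<partial>lborel)"
    by (intro nn_integral_mono ennreal_leI) auto
  also have "\<dots> = ennreal (L1_norm f0)"
    unfolding L1_norm_def by (subst nn_integral_eq_integral[OF integrable_norm[OF f0]]) auto
  finally show ?thesis .
qed

text \<open>The supremum of the norms bounds its members only if the norms are bounded above. This follows from the bound on the
sum of mass, second moment and position, as the last two are nonnegative.\<close>

lemma admissible_family_mass:
  assumes adm: "admissible_family \<gamma> f0 \<xi>0 \<eta>0" and \<epsilon>: "\<epsilon> \<in> {0<..<1}"
  shows "integrable lborel (f0 \<epsilon>)" "L1_norm (f0 \<epsilon>) \<le> 1"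
proof -
  let ?q = "\<lambda>\<epsilon>. LINT x|lborel. (norm x)\<^sup>2 * spatial_density (f0 \<epsilon>) x"
  have datum: "admissible_datum (f0 \<epsilon>) (\<xi>0 \<epsilon>)" if "\<epsilon> \<in> {0<..<1}" for \<epsilon>
    using adm that by (auto simp: admissible_family_def)
  then show "integrable lborel (f0 \<epsilon>)"
    using \<epsilon> by (auto simp: admissible_datum_def)
  have q: "0 \<le> ?q \<epsilon>" if "\<epsilon> \<in> {0<..<1}" for \<epsilon>
  proof -
    have "AE z in lborel \<Otimes>\<^sub>M lborel. 0 \<le> f0 \<epsilon> z"
      using datum[OF that] unfolding admissible_datum_def lborel_prod by blast
    then have "AE x in lborel. AE v in lborel. 0 \<le> f0 \<epsilon> (x, v)"
      by (rule lborel_pair.AE_pair)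
    then have "AE x in lborel. 0 \<le> (norm x)\<^sup>2 * spatial_density (f0 \<epsilon>) x"
      unfolding spatial_density_def
      by eventually_elim (intro mult_nonneg_nonneg integral_nonneg_AE zero_le_power2)
    then show ?thesis
      by (rule integral_nonneg_AE)
  qed
  have "bdd_above ((\<lambda>\<epsilon>. L1_norm (f0 \<epsilon>) + ?q \<epsilon> + norm (\<xi>0 \<epsilon>)) ` {0<..<1})"
    using adm unfolding admissible_family_def by (elim conjE)
  then obtain C where C: "\<And>y. y \<in> (\<lambda>\<epsilon>. L1_norm (f0 \<epsilon>) + ?q \<epsilon> + norm (\<xi>0 \<epsilon>)) ` {0<..<1} \<Longrightarrow> y \<le> C"
    unfolding bdd_above_def by blast
  have "bdd_above ((\<lambda>\<epsilon>. L1_norm (f0 \<epsilon>)) ` {0<..<1})"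
  proof (rule bdd_aboveI2)
    fix \<epsilon> :: real assume \<epsilon>: "\<epsilon> \<in> {0<..<1}"
    show "L1_norm (f0 \<epsilon>) \<le> C"
      using C[OF imageI[OF \<epsilon>]] q[OF \<epsilon>] norm_ge_zero[of "\<xi>0 \<epsilon>"] by linarith
  qed
  from cSUP_upper[OF \<epsilon> this] show "L1_norm (f0 \<epsilon>) \<le> 1"
    using adm unfolding admissible_family_def by linarith
qed

text \<open>Testing with continuous cut-offs of balls bounds the mass of every ball; mass can only be lost at infinity.\<close>

lemma Cw_limit_mass_le:
  fixes \<rho> :: "real \<Rightarrow> ('a::euclidean_space) measure"
  assumes lim: "Cw_tendsto \<mu> \<rho>" and \<rho>: "in_Cw \<rho>" and t: "0 \<le> t"
    and \<mu>: "\<And>n. sets (\<mu> n t) = sets borel" "\<And>n. emeasure (\<mu> n t) UNIV \<le> 1"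
  shows "measure (\<rho> t) UNIV \<le> 1"
proof -
  have \<rho>t: "sets (\<rho> t) = sets borel" "finite_measure (\<rho> t)"
    using \<rho> t by (auto simp: in_Cw_def Mplus_def)
  have space: "space (\<mu> n t) = UNIV" for n
    using sets_eq_imp_space_eq[OF \<mu>(1)] by simp
  have fin: "finite_measure (\<mu> n t)" for n
    using \<mu>(2)[of n] by (intro finite_measureI) (auto simp: space top_unique)
  have m1: "measure (\<mu> n t) UNIV \<le> 1" for n
    using \<mu>(2)[of n] by (simp add: measure_def enn2real_leI)
  have ball: "measure (\<rho> t) (ball 0 (real k)) \<le> 1" for k :: nat
  proof -
    define \<Phi> :: "'a \<Rightarrow> real" where "\<Phi> x = max 0 (min 1 (real k + 1 - norm x))" for x
    have \<Phi>: "continuous_on UNIV \<Phi>"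
      unfolding \<Phi>_def by (intro continuous_intros)
    have \<Phi>1: "norm (\<Phi> x) \<le> 1" for x
      by (auto simp: \<Phi>_def)
    have C0: "C0_function \<Phi>"
      unfolding C0_function_def
      by (auto intro!: \<Phi> tendsto_eventually eventually_at_infinityI[of "real k + 1"]) (auto simp: \<Phi>_def)
    have int: "integrable M \<Phi>" if "finite_measure M" "sets M = sets borel" for M
      by (rule finite_borel_integrable_bounded[OF that borel_measurable_continuous_onI[OF \<Phi>] \<Phi>1])
    have "measure (\<rho> t) (ball 0 (real k)) = (LINT x|\<rho> t. indicator (ball 0 (real k)) x)"
      using sets_eq_imp_space_eq[OF \<rho>t(1)] by simp
    also have "\<dots> \<le> (LINT x|\<rho> t. \<Phi> x)"
    proof (intro integral_mono int \<rho>t)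
      show "integrable (\<rho> t) (indicator (ball 0 (real k)) :: 'a \<Rightarrow> real)"
        by (intro finite_borel_integrable_bounded[where c = 1] \<rho>t borel_measurable_indicator)
          (auto simp: indicator_def)
      show "indicator (ball 0 (real k)) x \<le> \<Phi> x" for x
        by (auto simp: indicator_def \<Phi>_def)
    qed
    also have "\<dots> \<le> 1"
    proof (rule LIMSEQ_le_const2)
      have "uniform_limit {0..t + 1} (\<lambda>n s. LINT x|\<mu> n s. \<Phi> x) (\<lambda>s. LINT x|\<rho> s. \<Phi> x) sequentially"
        using lim C0 t unfolding Cw_tendsto_def by simp
      then show "(\<lambda>n. LINT x|\<mu> n t. \<Phi> x) \<longlonglongrightarrow> (LINT x|\<rho> t. \<Phi> x)"
        by (rule tendsto_uniform_limitI) (use t in simp)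
      have "norm (LINT x|\<mu> n t. \<Phi> x) \<le> 1" for n
        by (intro norm_integral_le_of_mass_le_1 fin \<mu> m1 int \<Phi>1) simp
      then have "(LINT x|\<mu> n t. \<Phi> x) \<le> 1" for n
        using abs_le_D1[of "LINT x|\<mu> n t. \<Phi> x" 1] by simp
      then show "\<exists>N. \<forall>n\<ge>N. (LINT x|\<mu> n t. \<Phi> x) \<le> 1" by blast
    qed
    finally show ?thesis .
  qed
  interpret finite_measure "\<rho> t" by (rule \<rho>t)
  have "(\<lambda>k. measure (\<rho> t) (ball 0 (real k))) \<longlonglongrightarrow> measure (\<rho> t) (\<Union>k. ball 0 (real k))"
    by (intro finite_Lim_measure_incseq) (auto simp: \<rho>t incseq_def)
  moreover have "(\<Union>k. ball 0 (real k)) = (UNIV :: 'a set)"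
    by (auto intro: reals_Archimedean2)
  ultimately show ?thesis
    using ball by (auto intro: LIMSEQ_le_const2)
qed

section \<open>The transport defect along the charge trajectory\<close>

lemma integral_halfline_compact_support:
  fixes h :: "real \<Rightarrow> real"
  assumes h: "continuous_on {0..} h" and ab: "0 < a" and zero: "\<And>t. 0 < t \<Longrightarrow> t \<notin> {a..b} \<Longrightarrow> h t = 0"
  shows "set_integrable lborel {0<..} h" "(LINT t:{0<..}|lborel. h t) = (LINT t:{a..b}|lborel. h t)"
proof -
  have eq: "indicat_real {0<..} t *\<^sub>R h t = indicat_real {a..b} t *\<^sub>R h t" for t
    using ab zero[of t] by (auto simp: indicator_def)
  have "set_integrable lborel {a..b} h"
    by (rule borel_integrable_atLeastAtMost'[OF continuous_on_subset[OF h]]) (use ab in auto)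
  then show "set_integrable lborel {0<..} h"
    unfolding set_integrable_def eq .
  show "(LINT t:{0<..}|lborel. h t) = (LINT t:{a..b}|lborel. h t)"
    unfolding set_lebesgue_integral_def eq ..
qed

lemma test_function_halfspace_bounds:
  fixes \<phi> :: "real \<times> (real^2) \<Rightarrow> real"
  assumes \<phi>: "test_function ({0<..} \<times> UNIV) \<phi>"
  obtains a b R B where "0 < a" "a \<le> b" "0 \<le> B"
    "\<And>t x. t \<notin> {a..b} \<or> R < norm x \<Longrightarrow> \<phi> (t, x) = 0 \<and> grad \<phi> (t, x) = 0"
    "\<And>z. norm (grad \<phi> z) \<le> B"
proof -
  let ?S = "closure {z. \<phi> z \<noteq> 0}"
  have S: "compact ?S" "?S \<subseteq> {0<..} \<times> UNIV"
    using \<phi> by (auto simp: test_function_def)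
  define K where "K = insert 1 (fst ` ?S)"
  have K: "compact K" "K \<noteq> {}" "K \<subseteq> {0<..}"
    using S unfolding K_def by (auto intro!: compact_insert compact_continuous_image continuous_intros)
  obtain a where a: "a \<in> K" "\<And>t. t \<in> K \<Longrightarrow> a \<le> t"
    using compact_attains_inf[OF K(1,2)] by blast
  obtain b where b: "b \<in> K" "\<And>t. t \<in> K \<Longrightarrow> t \<le> b"
    using compact_attains_sup[OF K(1,2)] by blast
  obtain R where R: "\<And>z. z \<in> ?S \<Longrightarrow> norm z \<le> R"
    using compact_imp_bounded[OF S(1)] unfolding bounded_iff by blast
  have out: "(t, x) \<notin> ?S" if "t \<notin> {a..b} \<or> R < norm x" for t x
  proof
    assume z: "(t, x) \<in> ?S"
    then have "t \<in> K" by (force simp: K_def)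
    moreover have "norm x \<le> R"
      using R[OF z] norm_snd_le[of x t] by linarith
    ultimately show False
      using that a(2) b(2) by auto
  qed
  obtain B where B: "0 \<le> B" "\<And>z. norm (grad \<phi> z) \<le> B"
    using grad_bounded[OF \<phi>] by blast
  show ?thesis
  proof (rule that[of a b B R])
    show "0 < a" "a \<le> b"
      using a b K by auto
    show "\<phi> (t, x) = 0 \<and> grad \<phi> (t, x) = 0" if "t \<notin> {a..b} \<or> R < norm x" for t x
      using test_function_eq_0[OF out[OF that]] by simp
  qed (fact B)+
qed

lemma grad_slice:
  fixes \<phi> :: "real \<times> (real^2) \<Rightarrow> real"
  assumes "test_function U \<phi>"
  shows "grad (\<lambda>x. \<phi> (t, x)) x = snd (grad \<phi> (t, x))"
proof (rule grad_unique)
  have "((\<lambda>x. (t, x)) has_derivative (\<lambda>v. (0, v))) (at x)"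
    by (auto intro!: derivative_eq_intros)
  from has_derivative_compose[OF this test_function_has_derivative[OF assms]]
  show "((\<lambda>x. \<phi> (t, x)) has_derivative (\<lambda>v. snd (grad \<phi> (t, x)) \<bullet> v)) (at x)"
    by (simp add: inner_prod_def)
qed

locale vortex_with_charge = vortex_density +
  fixes \<gamma> :: real and \<xi> \<xi>' :: "real \<Rightarrow> real^2"
  assumes \<gamma>: "0 < \<gamma>"
    and \<xi>': "continuous_on {0..} \<xi>'"
    and \<xi>_deriv: "0 \<le> t \<Longrightarrow> (\<xi> has_vector_derivative \<xi>' t) (at t within {0..})"
    and vortex: "vortex_equation (\<lambda>t. add_charge \<gamma> (\<rho> t) (\<xi> t))"
begin

definition drift :: "real \<Rightarrow> real^2 \<Rightarrow> real^2" where
  "drift t x = perp (efield (\<rho> t) x) + \<gamma> *\<^sub>R perp (coulomb (x - \<xi> t))"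

text \<open>The inner product with \<open>(1, drift t x)\<close> is \<open>\<partial>\<^sub>t\<phi> + drift \<bullet> \<nabla>\<phi>\<close>.\<close>

definition transport_pairing :: "(real \<times> (real^2) \<Rightarrow> real) \<Rightarrow> real \<Rightarrow> real" where
  "transport_pairing \<phi> t = (LINT x|\<rho> t. grad \<phi> (t, x) \<bullet> (1, drift t x))"

text \<open>The velocity of the charge relative to the flow \<open>E\<^sup>\<bottom>\<close>, where \<open>\<bottom>\<close> stands for \<open>perp\<close>; the goal is that it vanishes.\<close>

definition slip :: "real \<Rightarrow> real^2" where
  "slip t = \<xi>' t - perp (efield (\<rho> t) (\<xi> t))"

lemma \<xi>_continuous: "continuous_on {0..} \<xi>"
  by (rule continuous_on_vector_derivative) (use \<xi>_deriv in auto)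

lemma efield_charge_continuous: "continuous_on {0..} (\<lambda>t. efield (\<rho> t) (\<xi> t))"
  by (rule continuous_on_compose2[OF efield_continuous, of _ "\<lambda>t. (t, \<xi> t)", simplified])
    (auto intro!: continuous_intros \<xi>_continuous)

lemma slip_continuous: "continuous_on {0..} slip"
  unfolding slip_def by (intro continuous_intros \<xi>' efield_charge_continuous)

lemma efield_borel: "0 \<le> t \<Longrightarrow> efield (\<rho> t) \<in> borel_measurable borel"
  by (intro borel_measurable_continuous_onI
      continuous_on_compose2[OF efield_continuous, of _ "\<lambda>x. (t, x)", simplified]) (auto intro!: continuous_intros)

lemma efield_bound:
  assumes "0 < T"
  obtains M where "0 \<le> M" "\<And>t x. t \<in> {0..T} \<Longrightarrow> norm (efield (\<rho> t) x) \<le> M"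
proof -
  obtain M where M: "0 \<le> M" "\<And>t x. t \<in> {0..T} \<Longrightarrow> (LINT y|\<rho> t. norm (coulomb (x - y))) \<le> M"
    using coulomb_integral_bound[OF assms] by blast
  show ?thesis
    by (rule that[OF M(1)]) (rule order_trans[OF norm_efield_le M(2)])
qed

lemma coulomb_charge_integrable: "0 \<le> t \<Longrightarrow> integrable (\<rho> t) (\<lambda>x. coulomb (x - \<xi> t))"
  using integrable_minus[OF coulomb_integrable[of t "\<xi> t"]] coulomb_minus[of "\<xi> t - _"] by simp

lemma drift_integrable:
  assumes t: "0 \<le> t"
  shows "integrable (\<rho> t) (drift t)"
proof -
  have T: "0 < t + 1" using t by simp
  obtain M where M: "\<And>s x. s \<in> {0..t + 1} \<Longrightarrow> norm (efield (\<rho> s) x) \<le> M"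
    using efield_bound[OF T] by blast
  have "integrable (\<rho> t) (\<lambda>x. efield (\<rho> t) x)"
    using t M by (intro finite_borel_integrable_bounded[OF finite_density sets_density efield_borel, of _ _ M]) auto
  then have "integrable (\<rho> t) (\<lambda>x. perp (efield (\<rho> t) x))"
    by (rule integrable_bounded_linear[OF bounded_linear_perp])
  moreover have "integrable (\<rho> t) (\<lambda>x. \<gamma> *\<^sub>R perp (coulomb (x - \<xi> t)))"
    by (intro integrable_scaleR_right integrable_bounded_linear[OF bounded_linear_perp] coulomb_charge_integrable t)
  ultimately show ?thesis
    unfolding drift_def[abs_def] by (rule Bochner_Integration.integrable_add)
qed

lemma integrable_inner_bounded:
  fixes u V :: "real^2 \<Rightarrow> 'b::euclidean_space"
  assumes t: "0 \<le> t" and u: "integrable (\<rho> t) u" and V: "V \<in> borel_measurable borel" "\<And>x. norm (V x) \<le> B"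
  shows "integrable (\<rho> t) (\<lambda>x. V x \<bullet> u x)"
proof (rule Bochner_Integration.integrable_bound[OF integrable_mult_right[of B, OF integrable_norm[OF u]]])
  show "(\<lambda>x. V x \<bullet> u x) \<in> borel_measurable (\<rho> t)"
    by (rule borel_measurable_inner[OF borel_measurable_density[OF t V(1)] borel_measurable_integrable[OF u]])
  have "norm (V x \<bullet> u x) \<le> norm (B * norm (u x))" for x
  proof -
    have "\<bar>V x \<bullet> u x\<bar> \<le> norm (V x) * norm (u x)"
      by (rule Cauchy_Schwarz_ineq2)
    also have "\<dots> \<le> B * norm (u x)"
      by (rule mult_right_mono[OF V(2) norm_ge_zero])
    also have "\<dots> \<le> norm (B * norm (u x))"
      unfolding real_norm_def by (rule abs_ge_self)
    finally show ?thesis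
      unfolding real_norm_def .
  qed
  then show "AE x in \<rho> t. norm (V x \<bullet> u x) \<le> norm (B * norm (u x))" by simp
qed

lemma grad_slice_borel:
  assumes "test_function U \<phi>"
  shows "(\<lambda>x. grad \<phi> (t, x)) \<in> borel_measurable borel"
  by (intro borel_measurable_continuous_onI
      continuous_on_compose2[OF continuous_on_grad_test_function[OF assms], of _ "\<lambda>x. (t, x)"])
    (auto intro!: continuous_intros)

lemma transport_integrable:
  assumes t: "0 \<le> t" and \<phi>: "test_function U \<phi>" and B: "\<And>z. norm (grad \<phi> z) \<le> B"
  shows "integrable (\<rho> t) (\<lambda>x. grad \<phi> (t, x) \<bullet> (1, drift t x))"
proof (rule integrable_inner_bounded[OF t _ grad_slice_borel[OF \<phi>] B])
  have 1: "integrable (\<rho> t) (\<lambda>x. 1 :: real)"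
    using t by (intro finite_borel_integrable_bounded[where c = 1] finite_density sets_density) auto
  have "integrable (\<rho> t) (\<lambda>x. norm (drift t x) + 1)"
    by (intro Bochner_Integration.integrable_add integrable_norm drift_integrable t 1)
  then show "integrable (\<rho> t) (\<lambda>x. (1 :: real, drift t x))"
  proof (rule Bochner_Integration.integrable_bound)
    show "(\<lambda>x. (1 :: real, drift t x)) \<in> borel_measurable (\<rho> t)"
      using drift_integrable[OF t] by (intro borel_measurable_Pair) auto
    have "norm (1 :: real, drift t x) \<le> norm (norm (drift t x) + 1)" for x
      using norm_Pair_le[of "1 :: real" "drift t x"] by simp
    then show "AE x in \<rho> t. norm (1 :: real, drift t x) \<le> norm (norm (drift t x) + 1)" by simp
  qed
qed

text \<open>Continuity is what provides measurability and integrability in time of the pairing. The part with the field \<open>E\<close> has a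
continuous integrand; the part with the field of the charge is a singular pairing.\<close>

lemma transport_pairing_continuous:
  assumes \<phi>: "test_function ({0<..} \<times> UNIV) \<phi>"
  shows "continuous_on {0..} (transport_pairing \<phi>)"
proof -
  obtain a b R B where ab: "0 < a" "a \<le> b" "0 \<le> B"
    and zero: "\<And>t x. t \<notin> {a..b} \<or> R < norm x \<Longrightarrow> \<phi> (t, x) = 0 \<and> grad \<phi> (t, x) = 0"
    and B: "\<And>z. norm (grad \<phi> z) \<le> B"
    by (rule test_function_halfspace_bounds[OF \<phi>]) blast
  note G = continuous_on_subset[OF continuous_on_grad_test_function[OF \<phi>] subset_UNIV]
  let ?F = "\<lambda>z. fst (grad \<phi> z) + snd (grad \<phi> z) \<bullet> perp (efield (\<rho> (fst z)) (snd z))"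
  let ?V = "\<lambda>z. snd (grad \<phi> z)"
  have B': "norm (?V z) \<le> B" for z
    using B[of z] norm_snd_le[of "snd (grad \<phi> z)" "fst (grad \<phi> z)"] by simp
  have 1: "continuous_on {0..} (\<lambda>t. LINT x|\<rho> t. ?F (t, x))"
  proof (rule pairing_continuous)
    show "continuous_on ({0..} \<times> UNIV) ?F"
      by (intro continuous_intros efield_continuous G)
    show "?F (t, x) = 0" if "R < norm x" for t x
      using zero[of t x] that by simp
  qed
  have 2: "continuous_on {0..} (\<lambda>t. LINT x|\<rho> t. perp (coulomb (x - \<xi> t)) \<bullet> ?V (t, x))"
  proof (rule singular_pairing_continuous[OF _ _ B' \<xi>_continuous])
    show "continuous_on ({0..} \<times> UNIV) ?V"
      by (intro continuous_intros G)
    show "?V (t, x) = 0" if "R < norm x" for t x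
      using zero[of t x] that by simp
  qed
  have "transport_pairing \<phi> t = (LINT x|\<rho> t. ?F (t, x)) + \<gamma> * (LINT x|\<rho> t. perp (coulomb (x - \<xi> t)) \<bullet> ?V (t, x))"
    if t: "0 \<le> t" for t
  proof -
    have Vm: "(\<lambda>x. ?V (t, x)) \<in> borel_measurable borel"
      using measurable_compose[OF grad_slice_borel[OF \<phi>] borel_measurable_continuous_onI[OF continuous_on_snd[OF continuous_on_id]]] by simp
    have s: "integrable (\<rho> t) (\<lambda>x. \<gamma> * (perp (coulomb (x - \<xi> t)) \<bullet> ?V (t, x)))"
      using integrable_inner_bounded[OF t integrable_bounded_linear[OF bounded_linear_perp coulomb_charge_integrable[OF t]] Vm B']
      by (simp add: inner_commute)
    have split: "grad \<phi> (t, x) \<bullet> (1, drift t x) = ?F (t, x) + \<gamma> * (perp (coulomb (x - \<xi> t)) \<bullet> ?V (t, x))" for x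
      by (simp add: inner_prod_def drift_def inner_add_right inner_commute)
    have r: "integrable (\<rho> t) (\<lambda>x. ?F (t, x))"
      using Bochner_Integration.integrable_diff[OF transport_integrable[OF t \<phi> B] s] by (simp add: split)
    show ?thesis
      unfolding transport_pairing_def split
      by (subst Bochner_Integration.integral_add[OF r s]) simp
  qed
  then show ?thesis
    by (intro continuous_on_eq[OF continuous_on_add[OF 1 continuous_on_mult_left[OF 2, of \<gamma>]]]) auto
qed

text \<open>The field of \<open>\<rho> + \<gamma> \<delta>\<^sub>\<xi>\<close> is \<open>E + \<gamma> coulomb (x - \<xi>)\<close>, whose rotation is the drift, so the time derivative and the
interaction together are the integral of \<open>grad \<phi> \<bullet> (1, drift)\<close> over this measure. The atom contributes the value at
\<open>\<xi>\<close>, where the drift is only \<open>perp E\<close> because \<open>coulomb 0 = 0\<close>.\<close>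

lemma vortex_rhs_eq:
  assumes t: "0 \<le> t" and \<phi>: "test_function U \<phi>" and B: "\<And>z. norm (grad \<phi> z) \<le> B"
  shows "(LINT x|add_charge \<gamma> (\<rho> t) (\<xi> t). frechet_derivative \<phi> (at (t, x)) (1, 0))
      + vortex_interaction (\<lambda>x. \<phi> (t, x)) (add_charge \<gamma> (\<rho> t) (\<xi> t)) (add_charge \<gamma> (\<rho> t) (\<xi> t))
    = transport_pairing \<phi> t + \<gamma> * (grad \<phi> (t, \<xi> t) \<bullet> (1, perp (efield (\<rho> t) (\<xi> t))))"
proof -
  let ?\<mu> = "add_charge \<gamma> (\<rho> t) (\<xi> t)"
  note rho = sets_density[OF t] finite_density[OF t]
  have sets: "sets ?\<mu> = sets borel" by (rule sets_add_charge)
  have fin: "finite_measure ?\<mu>" by (rule finite_measure_add_charge[OF rho(2,1)])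
  have \<gamma>0: "0 \<le> \<gamma>" using \<gamma> by simp
  have K: "integrable ?\<mu> (\<lambda>y. coulomb (x - y))" for x
    by (intro integrable_add_charge rho coulomb_integrable t)
  have efield: "efield ?\<mu> x = efield (\<rho> t) x + \<gamma> *\<^sub>R coulomb (x - \<xi> t)" for x
    unfolding efield_def by (intro integral_add_charge \<gamma>0 rho coulomb_integrable t)
  have T: "0 < t + 1" using t by simp
  obtain M where M: "\<And>s x. s \<in> {0..t + 1} \<Longrightarrow> (LINT y|\<rho> s. norm (coulomb (x - y))) \<le> M"
    using coulomb_integral_bound[OF T] by blast
  let ?h = "\<lambda>x. M + \<gamma> * norm (coulomb (x - \<xi> t))"
  have "integrable (\<rho> t) ?h"
    using t by (intro Bochner_Integration.integrable_add integrable_mult_right integrable_norm coulomb_charge_integrable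
        finite_borel_integrable_bounded[where c = "\<bar>M\<bar>"] rho) auto
  then have h: "integrable ?\<mu> ?h"
    by (rule integrable_add_charge[OF rho(1)])
  have "(LINT y|?\<mu>. norm (coulomb (x - y))) \<le> ?h x" for x
    using M[of t x] t
    by (subst integral_add_charge_real[OF \<gamma>0 rho(1) integrable_norm[OF coulomb_integrable[OF t]]]) auto
  then have pair: "integrable (?\<mu> \<Otimes>\<^sub>M ?\<mu>) (\<lambda>(x, y). coulomb (x - y))"
    by (intro integrable_coulomb_pair[OF fin sets K _ h])
  have Gm: "(\<lambda>x. snd (grad \<phi> (t, x))) \<in> borel_measurable borel"
    using measurable_compose[OF grad_slice_borel[OF \<phi>] borel_measurable_continuous_onI[OF continuous_on_snd[OF continuous_on_id]]] by simp
  have GB: "norm (snd (grad \<phi> (t, x))) \<le> B" for x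
    using B[of "(t, x)"] norm_snd_le[of "snd (grad \<phi> (t, x))" "fst (grad \<phi> (t, x))"] by simp
  have slice: "grad (\<lambda>x. \<phi> (t, x)) = (\<lambda>x. snd (grad \<phi> (t, x)))"
    by (rule ext) (rule grad_slice[OF \<phi>])
  have Eint: "integrable (\<rho> t) (\<lambda>x. perp (efield ?\<mu> x))"
    using drift_integrable[OF t] by (simp add: efield perp_simps drift_def[abs_def])
  have int2: "integrable (\<rho> t) (\<lambda>x. perp (efield ?\<mu> x) \<bullet> snd (grad \<phi> (t, x)))"
    using integrable_inner_bounded[OF t Eint Gm GB] by (simp add: inner_commute)
  have split: "fst (grad \<phi> (t, x)) + perp (efield ?\<mu> x) \<bullet> snd (grad \<phi> (t, x)) = grad \<phi> (t, x) \<bullet> (1, drift t x)" for x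
    by (simp add: efield drift_def inner_prod_def perp_simps inner_commute)
  have int1: "integrable (\<rho> t) (\<lambda>x. fst (grad \<phi> (t, x)))"
    using Bochner_Integration.integrable_diff[OF transport_integrable[OF t \<phi> B] int2] by (simp flip: split)
  have "(LINT x|?\<mu>. frechet_derivative \<phi> (at (t, x)) (1, 0)) = (LINT x|?\<mu>. fst (grad \<phi> (t, x)))"
    by (simp add: frechet_derivative_test_function[OF \<phi>] inner_prod_def)
  moreover have "vortex_interaction (\<lambda>x. \<phi> (t, x)) ?\<mu> ?\<mu> = (LINT x|?\<mu>. perp (efield ?\<mu> x) \<bullet> snd (grad \<phi> (t, x)))"
    using vortex_interaction_eq[OF fin sets pair K, of "\<lambda>x. \<phi> (t, x)" B] Gm GB by (simp add: slice)
  ultimately have "(LINT x|?\<mu>. frechet_derivative \<phi> (at (t, x)) (1, 0)) + vortex_interaction (\<lambda>x. \<phi> (t, x)) ?\<mu> ?\<mu>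
      = (LINT x|?\<mu>. fst (grad \<phi> (t, x))) + (LINT x|?\<mu>. perp (efield ?\<mu> x) \<bullet> snd (grad \<phi> (t, x)))"
    by simp
  also have "\<dots> = (LINT x|?\<mu>. grad \<phi> (t, x) \<bullet> (1, drift t x))"
    unfolding split[symmetric]
    by (intro Bochner_Integration.integral_add[symmetric] integrable_add_charge rho int1 int2)
  also have "\<dots> = transport_pairing \<phi> t + \<gamma> * (grad \<phi> (t, \<xi> t) \<bullet> (1, drift t (\<xi> t)))"
    unfolding transport_pairing_def by (intro integral_add_charge_real \<gamma>0 rho transport_integrable[OF t \<phi> B])
  also have "drift t (\<xi> t) = perp (efield (\<rho> t) (\<xi> t))"
    using linear_0[OF bounded_linear.linear[OF bounded_linear_perp]] by (simp add: drift_def)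
  finally show ?thesis .
qed

text \<open>The vortex equation is tested with a function of time equal to \<open>1\<close> on a neighbourhood of the time support of \<open>\<phi>\<close>, which
turns it into the vanishing of the integral of its right-hand side. The charge contributes \<open>grad \<phi> \<bullet> (1, perp E)\<close>
along the trajectory; the integral of \<open>grad \<phi> \<bullet> (1, \<xi>')\<close> vanishes by the fundamental theorem of calculus, and
the difference of the two is the slip term.\<close>

lemma transport_defect_identity:
  assumes \<phi>: "test_function ({0<..} \<times> UNIV) \<phi>"
  shows "set_integrable lborel {0<..} (transport_pairing \<phi>)"
    "(LINT t:{0<..}|lborel. transport_pairing \<phi> t) = \<gamma> * (LINT t:{0<..}|lborel. grad \<phi> (t, \<xi> t) \<bullet> (0, slip t))"
proof -
  obtain a b R B where ab: "0 < a" "a \<le> b" "0 \<le> B"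
    and zero: "\<And>t x. t \<notin> {a..b} \<or> R < norm x \<Longrightarrow> \<phi> (t, x) = 0 \<and> grad \<phi> (t, x) = 0"
    and B: "\<And>z. norm (grad \<phi> z) \<le> B"
    by (rule test_function_halfspace_bounds[OF \<phi>]) blast
  have zero': "\<phi> (t, x) = 0" "grad \<phi> (t, x) = 0" if "t \<notin> {a..b}" for t x
    using zero[of t x] that by auto
  let ?c = "a / 2" and ?d = "b + 1"
  have cd: "0 < ?c" "?c \<le> ?d" "\<And>t. t \<notin> {?c..?d} \<Longrightarrow> t \<notin> {a..b}"
    using ab by auto
  \<comment> \<open>the plateau is larger than \<open>{a..b}\<close>, so that the derivative of \<open>\<theta>\<close> vanishes on all of \<open>{a..b}\<close>\<close>
  have a4: "0 < a / 4" using ab by simp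
  obtain \<theta> where \<theta>: "\<And>k. Ck k \<theta>" "\<And>s. s \<in> {?c..?d} \<Longrightarrow> \<theta> s = 1" "\<And>s. s \<notin> {?c - a / 4..?d + a / 4} \<Longrightarrow> \<theta> s = 0"
    by (rule smooth_plateau[OF a4, of ?c ?d]) (rule that; assumption)
  have \<theta>_test: "test_function {0<..} \<theta>"
    using ab by (intro test_functionI[OF \<theta>(1), of "{?c - a / 4..?d + a / 4}"] \<theta>(3)) auto
  have \<theta>_deriv: "deriv \<theta> t = 0" if "t \<in> {a..b}" for t
  proof -
    have "\<forall>\<^sub>F s in nhds t. \<theta> s = 1"
      using that ab \<theta>(2) by (auto simp: eventually_nhds intro!: exI[of _ "{?c<..<?d}"])
    then have "deriv \<theta> t = deriv (\<lambda>_. 1) t"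
      by (rule deriv_cong_ev) simp
    then show ?thesis by simp
  qed
  let ?\<mu> = "\<lambda>t. add_charge \<gamma> (\<rho> t) (\<xi> t)"
  let ?G = "\<lambda>t. grad \<phi> (t, \<xi> t)"
  let ?q = "\<lambda>t. ?G t \<bullet> (1, perp (efield (\<rho> t) (\<xi> t)))"
  let ?r = "\<lambda>t. ?G t \<bullet> (1, \<xi>' t)"
  have TP0: "transport_pairing \<phi> t = 0" if "t \<notin> {a..b}" for t
    unfolding transport_pairing_def using zero'(2)[OF that] by simp
  have "(LINT t:{0<..}|lborel. transport_pairing \<phi> t + \<gamma> * ?q t)
      = (LINT t:{0<..}|lborel. \<theta> t * ((LINT x|?\<mu> t. frechet_derivative \<phi> (at (t, x)) (1, 0))
          + vortex_interaction (\<lambda>x. \<phi> (t, x)) (?\<mu> t) (?\<mu> t)))"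
  proof (rule set_lebesgue_integral_cong, simp, intro allI impI)
    fix t :: real assume "t \<in> {0<..}"
    then have t: "0 \<le> t" by simp
    show "transport_pairing \<phi> t + \<gamma> * ?q t = \<theta> t * ((LINT x|?\<mu> t. frechet_derivative \<phi> (at (t, x)) (1, 0))
          + vortex_interaction (\<lambda>x. \<phi> (t, x)) (?\<mu> t) (?\<mu> t))"
    proof (cases "t \<in> {?c..?d}")
      case True
      then show ?thesis
        by (simp only: vortex_rhs_eq[OF t \<phi> B] \<theta>(2) mult_1)
    next
      case False
      then show ?thesis
        by (simp add: vortex_rhs_eq[OF t \<phi> B] TP0[OF cd(3)[OF False]] zero'(2)[OF cd(3)[OF False]])
    qed
  qed
  also have "\<dots> = - (LINT t:{0<..}|lborel. deriv \<theta> t * (LINT x|?\<mu> t. \<phi> (t, x)))"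
    using vortex test_function_mono[OF \<phi> subset_UNIV] \<theta>_test unfolding vortex_equation_def by simp
  finally have "(LINT t:{0<..}|lborel. transport_pairing \<phi> t + \<gamma> * ?q t)
      = - (LINT t:{0<..}|lborel. deriv \<theta> t * (LINT x|?\<mu> t. \<phi> (t, x)))" .
  moreover have "deriv \<theta> t * (LINT x|?\<mu> t. \<phi> (t, x)) = 0" for t
    using \<theta>_deriv[of t] zero'(1)[of t] by (cases "t \<in> {a..b}") simp_all
  ultimately have total: "(LINT t:{0<..}|lborel. transport_pairing \<phi> t + \<gamma> * ?q t) = 0"
    by (simp add: set_lebesgue_integral_def)
  have G: "continuous_on {0..} ?G"
    by (rule continuous_on_compose2[OF continuous_on_grad_test_function[OF \<phi>]])
      (auto intro!: continuous_intros \<xi>_continuous)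
  have q: "continuous_on {0..} ?q"
    by (intro continuous_intros G efield_charge_continuous)
  have r: "continuous_on {0..} ?r"
    by (intro continuous_intros G \<xi>')
  have TP: "continuous_on {0..} (transport_pairing \<phi>)"
    by (rule transport_pairing_continuous[OF \<phi>])
  note iTP = integral_halfline_compact_support[OF TP ab(1) TP0]
  have iq: "set_integrable lborel {0<..} ?q"
    by (rule integral_halfline_compact_support(1)[OF q ab(1), of b]) (simp add: zero'(2))
  have r_out: "?r t = 0" if "t \<notin> {?c..?d}" for t
    using zero'(2)[OF cd(3)[OF that]] by simp
  have ir: "set_integrable lborel {0<..} ?r" "(LINT t:{0<..}|lborel. ?r t) = (LINT t:{?c..?d}|lborel. ?r t)"
    by (rule integral_halfline_compact_support[OF r cd(1)], rule r_out, assumption)+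
  have "has_bochner_integral lborel (\<lambda>t. indicator {?c..?d} t *\<^sub>R ?r t) (\<phi> (?d, \<xi> ?d) - \<phi> (?c, \<xi> ?c))"
  proof (rule has_bochner_integral_FTC_Icc[OF cd(2)])
    show "continuous_on {?c..?d} ?r"
      by (rule continuous_on_subset[OF r]) (use ab in auto)
    fix t assume t: "?c \<le> t" "t \<le> ?d"
    have "(\<xi> has_vector_derivative \<xi>' t) (at t within {?c..?d})"
      by (rule has_vector_derivative_within_subset[OF \<xi>_deriv]) (use t ab in auto)
    then have "((\<lambda>s. (s, \<xi> s)) has_vector_derivative (1, \<xi>' t)) (at t within {?c..?d})"
      unfolding has_vector_derivative_def by (auto intro!: derivative_eq_intros)
    from vector_derivative_diff_chain_within[OF this has_derivative_at_withinI[OF test_function_has_derivative[OF \<phi>]]]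
    show "((\<lambda>t. \<phi> (t, \<xi> t)) has_vector_derivative ?r t) (at t within {?c..?d})"
      by (simp add: o_def)
  qed
  then have "(LINT t:{?c..?d}|lborel. ?r t) = 0"
    unfolding set_lebesgue_integral_def using ab by (simp add: has_bochner_integral_integral_eq zero'(1))
  then have r0: "(LINT t:{0<..}|lborel. ?r t) = 0"
    using ir(2) by simp
  show "set_integrable lborel {0<..} (transport_pairing \<phi>)"
    by (rule iTP(1)) 
  have "(LINT t:{0<..}|lborel. ?G t \<bullet> (0, slip t)) = (LINT t:{0<..}|lborel. ?r t - ?q t)"
    by (simp add: slip_def inner_prod_def inner_diff_right)
  also have "\<dots> = - (LINT t:{0<..}|lborel. ?q t)"
    using set_integral_diff(2)[OF ir(1) iq] r0 by simp
  finally have "\<gamma> * (LINT t:{0<..}|lborel. ?G t \<bullet> (0, slip t)) = - (LINT t:{0<..}|lborel. \<gamma> * ?q t)"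
    by simp
  moreover have "(LINT t:{0<..}|lborel. transport_pairing \<phi> t) + (LINT t:{0<..}|lborel. \<gamma> * ?q t) = 0"
    using set_integral_add(2)[OF iTP(1) set_integrable_mult_right[of \<gamma>, OF iq]] total by simp
  ultimately show "(LINT t:{0<..}|lborel. transport_pairing \<phi> t) = \<gamma> * (LINT t:{0<..}|lborel. ?G t \<bullet> (0, slip t))"
    by linarith
qed

end

section \<open>Localization at the charge\<close>

text \<open>A compactly supported function whose spatial gradient on the cylinder \<open>|z| < L\<close> is the vector \<open>w\<close>, up to a factor
depending on time only. The product of cut-offs in the two coordinates serves as cut-off in the plane.\<close>

lemma localized_linear_test_function:
  fixes w :: "real^2"
  assumes L: "0 < L"
  obtains \<theta> :: "real \<Rightarrow> real" and \<phi> :: "real \<times> (real^2) \<Rightarrow> real" and R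
  where "\<And>s. 0 \<le> \<theta> s" "\<And>s. s \<in> {-1..1} \<Longrightarrow> \<theta> s = 1"
    "\<And>s. s \<notin> {-2..2} \<Longrightarrow> \<theta> s = 0" "continuous_on UNIV \<theta>"
    "\<And>k. Ck k \<phi>" "\<And>s z. s \<notin> {-2..2} \<or> R < norm z \<Longrightarrow> \<phi> (s, z) = 0"
    "\<And>s z b. norm z < L \<Longrightarrow> frechet_derivative \<phi> (at (s, z)) (0, b) = \<theta> s * (w \<bullet> b)"
proof -
  obtain \<theta> :: "real \<Rightarrow> real" where \<theta>: "\<And>k. Ck k \<theta>" "\<And>s. 0 \<le> \<theta> s" "\<And>s. s \<in> {-1..1} \<Longrightarrow> \<theta> s = 1"
    "\<And>s. s \<notin> {-1 - 1..1 + 1} \<Longrightarrow> \<theta> s = 0"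
    by (rule smooth_plateau[OF zero_less_one, of "-1" 1]) (rule that; assumption)
  obtain c :: "real \<Rightarrow> real" where c: "\<And>k. Ck k c" "\<And>s. 0 \<le> c s" "\<And>s. s \<in> {-L..L} \<Longrightarrow> c s = 1"
    "\<And>s. s \<notin> {-L - 1..L + 1} \<Longrightarrow> c s = 0"
    by (rule smooth_plateau[OF zero_less_one, of "-L" L]) (rule that; assumption)
  define \<phi> :: "real \<times> (real^2) \<Rightarrow> real" where
    "\<phi> z = \<theta> (fst z) * ((w \<bullet> snd z) * (c (snd z $ 1) * c (snd z $ 2)))" for z
  have comp: "bounded_linear (\<lambda>z :: real \<times> (real^2). snd z $ i)" for i
    by (rule bounded_linear_compose[OF bounded_linear_vec_nth bounded_linear_snd])
  have Ck: "Ck k \<phi>" for k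
  proof -
    have "Ck k (\<lambda>z :: real \<times> (real^2). c (0 + snd z $ i))" for i
      by (rule Ck_affine[OF comp c(1)])
    moreover have "Ck k (\<lambda>z :: real \<times> (real^2). \<theta> (0 + fst z))"
      by (rule Ck_affine[OF bounded_linear_fst \<theta>(1)])
    moreover have "Ck k (\<lambda>z :: real \<times> (real^2). w \<bullet> snd z)"
      by (intro Ck_bounded_linear bounded_linear_compose[OF bounded_linear_inner_right bounded_linear_snd])
    ultimately show ?thesis
      unfolding \<phi>_def[abs_def] by (intro Ck_mult) simp_all
  qed
  have out: "\<phi> (s, z) = 0" if "s \<notin> {-2..2} \<or> 2 * (L + 1) < norm z" for s z
  proof (cases "s \<in> {-2..2}")
    case False
    then show ?thesis using \<theta>(4)[of s] by (simp add: \<phi>_def)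
  next
    case True
    then have "2 * (L + 1) < \<bar>z $ 1\<bar> + \<bar>z $ 2\<bar>"
      using that norm_le_l1_cart[of z] by (simp add: sum_2)
    then have "z $ 1 \<notin> {-L - 1..L + 1} \<or> z $ 2 \<notin> {-L - 1..L + 1}"
      by auto
    then show ?thesis using c(4) by (auto simp: \<phi>_def)
  qed
  have der: "frechet_derivative \<phi> (at (s, z)) (0, b) = \<theta> s * (w \<bullet> b)" if z: "norm z < L" for s z b
  proof -
    obtain D where D: "(\<theta> has_derivative D) (at s)"
      using Ck_Suc_has_derivative[OF \<theta>(1)] by blast
    have "((\<lambda>y. \<theta> (fst y) * (w \<bullet> snd y)) has_derivative
        (\<lambda>v. \<theta> s * (w \<bullet> snd v) + D (fst v) * (w \<bullet> z))) (at (s, z))"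
      by (auto intro!: derivative_eq_intros has_derivative_compose[OF has_derivative_fst[OF has_derivative_ident], where g = \<theta>] D)
    then have "(\<phi> has_derivative (\<lambda>v. \<theta> s * (w \<bullet> snd v) + D (fst v) * (w \<bullet> z))) (at (s, z))"
    proof (rule has_derivative_transform_within_open)
      show "open (UNIV \<times> ball 0 L :: (real \<times> (real^2)) set)" by (intro open_Times) auto
      show "(s, z) \<in> UNIV \<times> ball 0 L" using z by simp
      fix y :: "real \<times> (real^2)" assume "y \<in> UNIV \<times> ball 0 L"
      then have "norm (snd y) < L" by (cases y) simp
      then have "snd y $ i \<in> {-L..L}" for i
        using component_le_norm_cart[of "snd y" i] by (auto simp: abs_le_iff)
      then show "\<theta> (fst y) * (w \<bullet> snd y) = \<phi> y"
        by (simp add: \<phi>_def c(3))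
    qed
    from frechet_derivative_at[OF this] have "frechet_derivative \<phi> (at (s, z)) = (\<lambda>v. \<theta> s * (w \<bullet> snd v) + D (fst v) * (w \<bullet> z))"
      by simp
    moreover have "D 0 = 0"
      using linear_0[OF has_derivative_linear[OF D]] .
    ultimately show ?thesis by simp
  qed
  have "continuous_on UNIV \<theta>" using \<theta>(1)[of 0] by simp
  moreover have "\<theta> s = 0" if "s \<notin> {-2..2}" for s
    using \<theta>(4)[of s] that by simp
  ultimately show ?thesis
    by (intro that[OF \<theta>(2,3) _ _ Ck out der])
qed

text \<open>The prefactor compensates the dilation: along this family of test functions the gradient keeps its size while the
support shrinks like \<open>\<tau>\<close>.\<close>

lemma grad_rescale:
  fixes \<phi> :: "'a::euclidean_space \<Rightarrow> real"
  assumes \<phi>: "test_function U \<phi>" and \<tau>: "\<tau> \<noteq> 0"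
  shows "grad (\<lambda>z. \<tau> * \<phi> (- a /\<^sub>R \<tau> + z /\<^sub>R \<tau>)) z = grad \<phi> (- a /\<^sub>R \<tau> + z /\<^sub>R \<tau>)"
proof (rule grad_unique)
  have "((\<lambda>z. - a /\<^sub>R \<tau> + z /\<^sub>R \<tau>) has_derivative (\<lambda>v. v /\<^sub>R \<tau>)) (at z)"
    by (auto intro!: derivative_eq_intros)
  from has_derivative_mult_right[OF has_derivative_compose[OF this test_function_has_derivative[OF \<phi>]], of \<tau>]
  show "((\<lambda>z. \<tau> * \<phi> (- a /\<^sub>R \<tau> + z /\<^sub>R \<tau>)) has_derivative (\<lambda>v. grad \<phi> (- a /\<^sub>R \<tau> + z /\<^sub>R \<tau>) \<bullet> v)) (at z)"
    using \<tau> by (simp add: mult.assoc[symmetric])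
qed

context vortex_with_charge
begin

text \<open>The drift is at most \<open>M + \<gamma> / |x - \<xi>|\<close>, so for a test function supported near the charge the pairing is an instance
of the singular integral estimate centred at \<open>\<xi> t\<close>.\<close>

lemma transport_pairing_small:
  assumes T: "0 < T" and M: "0 \<le> M" "\<And>t x. t \<in> {0..T} \<Longrightarrow> norm (efield (\<rho> t) x) \<le> M" and \<epsilon>: "0 < \<epsilon>"
  obtains \<delta> where "0 < \<delta>"
    "AE t in lborel. t \<in> {0..T} \<longrightarrow> (\<forall>U \<phi> B. test_function U \<phi> \<longrightarrow> (\<forall>z. norm (grad \<phi> z) \<le> B) \<longrightarrow>
       (\<forall>x. \<delta> \<le> norm (\<xi> t - x) \<longrightarrow> grad \<phi> (t, x) = 0) \<longrightarrow> \<bar>transport_pairing \<phi> t\<bar> \<le> B * (1 + M + \<gamma>) * \<epsilon>)"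
proof -
  obtain \<delta> where \<delta>: "0 < \<delta>" and ae: "AE t in lborel. t \<in> {0..T} \<longrightarrow>
    (\<forall>x. (\<integral>\<^sup>+y. ennreal (1 + inverse (norm (x - y))) * indicator (ball x \<delta>) y \<partial>\<rho> t) \<le> ennreal \<epsilon>)"
    using singular_integral_small_AE[OF T \<epsilon>] by blast
  have "\<bar>transport_pairing \<phi> t\<bar> \<le> B * (1 + M + \<gamma>) * \<epsilon>"
    if t: "t \<in> {0..T}" and small: "(\<integral>\<^sup>+y. ennreal (1 + inverse (norm (\<xi> t - y))) * indicator (ball (\<xi> t) \<delta>) y \<partial>\<rho> t) \<le> ennreal \<epsilon>"
      and \<phi>: "test_function U \<phi>" and B: "\<And>z. norm (grad \<phi> z) \<le> B"
      and out: "\<And>x. \<delta> \<le> norm (\<xi> t - x) \<Longrightarrow> grad \<phi> (t, x) = 0"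
    for t U \<phi> B
  proof -
    have t0: "0 \<le> t" using t by simp
    have B0: "0 \<le> B" using order_trans[OF norm_ge_zero B[of 0]] .
    define C where "C = B * (1 + M + \<gamma>)"
    have C: "0 \<le> C" unfolding C_def using B0 M(1) \<gamma> by simp
    let ?k = "\<lambda>x. ennreal (1 + inverse (norm (\<xi> t - x))) * indicator (ball (\<xi> t) \<delta>) x"
    have [measurable]: "ball (\<xi> t) \<delta> \<in> sets borel" by simp
    have km: "?k \<in> borel_measurable (\<rho> t)"
      by (rule borel_measurable_density[OF t0]) measurable
    have pw: "ennreal (norm (grad \<phi> (t, x) \<bullet> (1, drift t x))) \<le> ennreal C * ?k x" for x
    proof (cases "x \<in> ball (\<xi> t) \<delta>")
      case False
      then have "\<delta> \<le> norm (\<xi> t - x)" by (simp add: dist_norm)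
      from out[OF this] show ?thesis by simp
    next
      case True
      have "norm (drift t x) \<le> norm (perp (efield (\<rho> t) x)) + norm (\<gamma> *\<^sub>R perp (coulomb (x - \<xi> t)))"
        unfolding drift_def by (rule norm_triangle_ineq)
      also have "\<dots> \<le> M + \<gamma> * inverse (norm (\<xi> t - x))"
        using M(2)[OF t] \<gamma> by (simp add: norm_coulomb norm_minus_commute)
      finally have drift: "norm (drift t x) \<le> M + \<gamma> * inverse (norm (\<xi> t - x))" .
      have "norm (grad \<phi> (t, x) \<bullet> (1, drift t x)) \<le> norm (grad \<phi> (t, x)) * norm (1 :: real, drift t x)"
        unfolding real_norm_def by (rule Cauchy_Schwarz_ineq2)
      also have "\<dots> \<le> B * (1 + norm (drift t x))"
        using norm_Pair_le[of "1 :: real" "drift t x"] by (intro mult_mono B B0) auto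
      also have "\<dots> \<le> B * (1 + (M + \<gamma> * inverse (norm (\<xi> t - x))))"
        by (intro mult_left_mono add_left_mono drift B0)
      also have "\<dots> \<le> B * ((1 + M + \<gamma>) * (1 + inverse (norm (\<xi> t - x))))"
      proof (rule mult_left_mono[OF _ B0])
        have "0 \<le> (1 + M) * inverse (norm (\<xi> t - x))" using M(1) by simp
        then show "1 + (M + \<gamma> * inverse (norm (\<xi> t - x))) \<le> (1 + M + \<gamma>) * (1 + inverse (norm (\<xi> t - x)))"
          using \<gamma> unfolding distrib_left distrib_right by linarith
      qed
      finally have "norm (grad \<phi> (t, x) \<bullet> (1, drift t x)) \<le> C * (1 + inverse (norm (\<xi> t - x)))"
        by (simp only: C_def mult.assoc)
      then have "ennreal (norm (grad \<phi> (t, x) \<bullet> (1, drift t x))) \<le> ennreal C * ennreal (1 + inverse (norm (\<xi> t - x)))"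
        using C by (subst ennreal_mult[symmetric]) (auto intro: ennreal_leI)
      then show ?thesis using True by simp
    qed
    have "ennreal (norm (transport_pairing \<phi> t)) \<le> (\<integral>\<^sup>+x. norm (grad \<phi> (t, x) \<bullet> (1, drift t x)) \<partial>\<rho> t)"
      unfolding transport_pairing_def by (rule integral_norm_bound_ennreal[OF transport_integrable[OF t0 \<phi> B]])
    also have "\<dots> \<le> (\<integral>\<^sup>+x. ennreal C * ?k x \<partial>\<rho> t)"
      by (rule nn_integral_mono) (rule pw)
    also have "\<dots> = ennreal C * (\<integral>\<^sup>+x. ?k x \<partial>\<rho> t)"
      by (rule nn_integral_cmult[OF km])
    also have "\<dots> \<le> ennreal C * ennreal \<epsilon>"
      by (rule mult_left_mono[OF small]) simp
    also have "\<dots> = ennreal (C * \<epsilon>)"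
      using C \<epsilon> by (simp add: ennreal_mult)
    finally show ?thesis
      using C \<epsilon> by (simp add: C_def)
  qed
  with ae \<delta> show ?thesis
    by (intro that[of \<delta>]) (auto elim!: eventually_mono)
qed

text \<open>Let \<open>w\<close> be the slip at \<open>t0\<close>, supposed nonzero, and test with the function of slope \<open>w\<close> rescaled by \<open>\<tau>\<close> around
\<open>(t0, \<xi> t0)\<close>. For times within \<open>2 \<tau>\<close> of \<open>t0\<close> the charge moves by at most \<open>2 N \<tau>\<close>, so it stays where the test function is
linear in space, and the defect is at least \<open>\<gamma> \<tau> |w|\<^sup>2\<close>. The transport pairing is at most \<open>C \<epsilon>\<close> during a time \<open>4 \<tau>\<close>. This is
a contradiction once \<open>4 C \<epsilon> < \<gamma> |w|\<^sup>2\<close>.\<close>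

lemma slip_eq_0_interior:
  assumes t0: "0 < t0"
  shows "slip t0 = 0"
proof (rule ccontr)
  define w where "w = slip t0"
  assume "slip t0 \<noteq> 0"
  then have w: "0 < norm w" by (simp add: w_def)
  define T where "T = 2 * t0"
  have T: "0 < T" using t0 by (simp add: T_def)
  obtain M where M: "0 \<le> M" "\<And>t x. t \<in> {0..T} \<Longrightarrow> norm (efield (\<rho> t) x) \<le> M"
    using efield_bound[OF T] by blast
  have "compact (\<xi>' ` {0..T})"
    by (intro compact_continuous_image continuous_on_subset[OF \<xi>']) auto
  then obtain N where N: "\<And>t. t \<in> {0..T} \<Longrightarrow> norm (\<xi>' t) \<le> N"
    using compact_imp_bounded bounded_iff by (metis imageI)
  have N0: "0 \<le> N" using order_trans[OF norm_ge_zero N[of 0]] T by simp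
  have lip: "norm (\<xi> t - \<xi> t0) \<le> N * \<bar>t - t0\<bar>" if t: "t \<in> {0..T}" for t
  proof -
    have "norm (\<xi> t - \<xi> t0) \<le> N * norm (t - t0)"
    proof (rule differentiable_bound[where S = "{0..T}" and f' = "\<lambda>s h. h *\<^sub>R \<xi>' s"])
      show "(\<xi> has_derivative (\<lambda>h. h *\<^sub>R \<xi>' s)) (at s within {0..T})" if "s \<in> {0..T}" for s
        using has_vector_derivative_within_subset[OF \<xi>_deriv, of s "{0..T}"] that
        by (simp add: has_vector_derivative_def)
      show "onorm (\<lambda>h. h *\<^sub>R \<xi>' s) \<le> N" if "s \<in> {0..T}" for s
        using N[OF that] N0
        by (intro onorm_bound) (auto simp: mult.commute[of N] intro: mult_left_mono)
    qed (use t t0 in \<open>auto simp: T_def\<close>)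
    then show ?thesis by simp
  qed
  \<comment> \<open>strictly larger than \<open>2 N\<close>, so that the charge remains in the open cylinder in which the slope is \<open>w\<close>\<close>
  define L where "L = 2 * N + 1"
  have L: "0 < L" using N0 by (simp add: L_def)
  obtain \<theta> :: "real \<Rightarrow> real" and \<phi> :: "real \<times> (real^2) \<Rightarrow> real" and R
    where \<theta>: "\<And>s. 0 \<le> \<theta> s" "\<And>s. s \<in> {-1..1} \<Longrightarrow> \<theta> s = 1"
      "\<And>s. s \<notin> {-2..2} \<Longrightarrow> \<theta> s = 0" "continuous_on UNIV \<theta>"
    and \<phi>: "\<And>k. Ck k \<phi>" "\<And>s z. s \<notin> {-2..2} \<or> R < norm z \<Longrightarrow> \<phi> (s, z) = 0"
    and der: "\<And>s z b. norm z < L \<Longrightarrow> frechet_derivative \<phi> (at (s, z)) (0, b) = \<theta> s * (w \<bullet> b)"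
    by (rule localized_linear_test_function[OF L, of w]) (rule that; assumption)
  have \<phi>_out: "\<phi> z = 0" if "z \<notin> {-2..2} \<times> cball 0 R" for z
    using \<phi>(2)[of "fst z" "snd z"] that by (cases z) auto
  have \<phi>_test: "test_function UNIV \<phi>"
    by (rule test_functionI[OF \<phi>(1) compact_Times[OF compact_Icc compact_cball] subset_UNIV \<phi>_out])
  obtain B where B: "0 \<le> B" "\<And>z. norm (grad \<phi> z) \<le> B"
    using grad_bounded[OF \<phi>_test] by blast
  have grad_out: "grad \<phi> (s, z) = 0" if "s \<notin> {-2..2} \<or> R < norm z" for s z
  proof (rule test_function_eq_0(2))
    have "closure {y. \<phi> y \<noteq> 0} \<subseteq> {-2..2} \<times> cball 0 R"
      using \<phi>_out by (intro closure_minimal closed_Times closed_cball closed_atLeastAtMost) blast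
    then show "(s, z) \<notin> closure {y. \<phi> y \<noteq> 0}"
      using that by auto
  qed
  obtain d where d: "0 < d" "\<And>t. t \<in> {0..} \<Longrightarrow> dist t t0 < d \<Longrightarrow> dist (slip t) (slip t0) < norm w / 2"
    using slip_continuous t0 w unfolding continuous_on_iff
    by (metis atLeast_iff half_gt_zero less_imp_le)
  have w_slip: "(norm w)\<^sup>2 / 2 \<le> w \<bullet> slip t" if "0 \<le> t" "\<bar>t - t0\<bar> < d" for t
  proof -
    have "norm (w - slip t) \<le> norm w / 2"
      using d(2)[of t] that by (simp add: w_def dist_norm norm_minus_commute)
    then have "norm w * norm (w - slip t) \<le> norm w * (norm w / 2)"
      by (intro mult_left_mono) auto
    then have "w \<bullet> (w - slip t) \<le> (norm w)\<^sup>2 / 2"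
      using norm_cauchy_schwarz[of w "w - slip t"] by (simp add: power2_eq_square)
    then show ?thesis
      by (simp add: inner_diff_right power2_norm_eq_inner)
  qed
  define C where "C = B * (1 + M + \<gamma>)"
  have C: "0 \<le> C" unfolding C_def using B(1) M(1) \<gamma> by simp
  define \<epsilon> where "\<epsilon> = \<gamma> * (norm w)\<^sup>2 / (8 * (C + 1))"
  have \<epsilon>: "0 < \<epsilon>" unfolding \<epsilon>_def using \<gamma> w C by (intro divide_pos_pos mult_pos_pos) auto
  obtain \<delta> where \<delta>: "0 < \<delta>" and small:
    "AE t in lborel. t \<in> {0..T} \<longrightarrow> (\<forall>U \<phi> B. test_function U \<phi> \<longrightarrow> (\<forall>z. norm (grad \<phi> z) \<le> B) \<longrightarrow>
       (\<forall>x. \<delta> \<le> norm (\<xi> t - x) \<longrightarrow> grad \<phi> (t, x) = 0) \<longrightarrow> \<bar>transport_pairing \<phi> t\<bar> \<le> B * (1 + M + \<gamma>) * \<epsilon>)"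
    using transport_pairing_small[OF T M \<epsilon>] by blast
  \<comment> \<open>\<open>\<tau>\<close> keeps the support in positive time and before \<open>T\<close>, keeps the slip close to \<open>w\<close>, and places the support of the
    rescaled function in the ball of radius \<open>\<delta>\<close> around the moving charge\<close>
  define \<tau> where "\<tau> = min (t0 / 4) (min (d / 4) (\<delta> / (2 * (\<bar>R\<bar> + L))))"
  have \<tau>: "0 < \<tau>" "4 * \<tau> \<le> t0" "4 * \<tau> \<le> d" "\<tau> * (\<bar>R\<bar> + L) < \<delta>"
  proof -
    have RL: "0 < \<bar>R\<bar> + L" using L by simp
    show "0 < \<tau>" using t0 d(1) \<delta> RL by (simp add: \<tau>_def)
    show "4 * \<tau> \<le> t0" "4 * \<tau> \<le> d" by (auto simp: \<tau>_def)
    have "\<tau> * (\<bar>R\<bar> + L) \<le> \<delta> / (2 * (\<bar>R\<bar> + L)) * (\<bar>R\<bar> + L)"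
      using RL by (intro mult_right_mono) (auto simp: \<tau>_def)
    also have "\<dots> = \<delta> / 2" using RL by (metis less_irrefl mult.commute nonzero_mult_divide_mult_cancel_left times_divide_eq_left)
    also have "\<dots> < \<delta>" using \<delta> by simp
    finally show "\<tau> * (\<bar>R\<bar> + L) < \<delta>" .
  qed
  have norm_scaled: "norm (y /\<^sub>R \<tau>) = norm y / \<tau>" for y :: "real^2"
    using \<tau>(1) by (simp add: divide_inverse mult.commute)
  have far: "R < norm (y /\<^sub>R \<tau>)" if "\<tau> * R < norm y" for y :: "real^2"
    using that \<tau>(1) unfolding norm_scaled by (simp add: pos_less_divide_eq mult.commute)
  define \<psi> where "\<psi> z = \<tau> * \<phi> (- (t0, \<xi> t0) /\<^sub>R \<tau> + z /\<^sub>R \<tau>)" for z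
  have arg: "- (t0, \<xi> t0) /\<^sub>R \<tau> + (t, x) /\<^sub>R \<tau> = ((t - t0) / \<tau>, (x - \<xi> t0) /\<^sub>R \<tau>)" for t x
    by (simp add: divide_inverse algebra_simps)
  have grad_\<psi>: "grad \<psi> (t, x) = grad \<phi> ((t - t0) / \<tau>, (x - \<xi> t0) /\<^sub>R \<tau>)" for t x
    unfolding \<psi>_def[abs_def] using grad_rescale[OF \<phi>_test, of \<tau> "(t0, \<xi> t0)" "(t, x)"] \<tau>(1) by (simp only: arg)
  have time: "(t - t0) / \<tau> \<notin> {-2..2}" if "t \<notin> {t0 - 2 * \<tau>..t0 + 2 * \<tau>}" for t
    using that \<tau>(1) by (auto simp: field_simps)
  have \<psi>_test: "test_function ({0<..} \<times> UNIV) \<psi>"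
  proof (rule test_functionI)
    show "Ck k \<psi>" for k
      unfolding \<psi>_def[abs_def]
      by (intro Ck_mult Ck_const Ck_affine[OF _ \<phi>(1)] bounded_linear_scaleR_right)
    show "compact ({t0 - 2 * \<tau>..t0 + 2 * \<tau>} \<times> cball (\<xi> t0) (\<tau> * R))"
      by (intro compact_Times compact_cball compact_Icc)
    show "{t0 - 2 * \<tau>..t0 + 2 * \<tau>} \<times> cball (\<xi> t0) (\<tau> * R) \<subseteq> {0<..} \<times> UNIV"
      using \<tau> by auto
    fix z assume z: "z \<notin> {t0 - 2 * \<tau>..t0 + 2 * \<tau>} \<times> cball (\<xi> t0) (\<tau> * R)"
    obtain t x where tx: "z = (t, x)" by force
    have "(t - t0) / \<tau> \<notin> {-2..2} \<or> R < norm ((x - \<xi> t0) /\<^sub>R \<tau>)"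
    proof (cases "t \<in> {t0 - 2 * \<tau>..t0 + 2 * \<tau>}")
      case True
      then have "\<tau> * R < norm (x - \<xi> t0)"
        using z by (auto simp: tx dist_norm norm_minus_commute)
      then show ?thesis using far by blast
    qed (use time in blast)
    then show "\<psi> z = 0"
      unfolding tx \<psi>_def arg by (simp add: \<phi>(2))
  qed
  let ?h = "\<lambda>t. \<theta> ((t - t0) / \<tau>) * (w \<bullet> slip t)"
  have h: "grad \<psi> (t, \<xi> t) \<bullet> (0, slip t) = ?h t" for t
  proof (cases "t \<in> {t0 - 2 * \<tau>..t0 + 2 * \<tau>}")
    case True
    then have "norm (\<xi> t - \<xi> t0) \<le> N * \<bar>t - t0\<bar>"
      using \<tau> by (intro lip) (auto simp: T_def)
    also have "\<dots> \<le> N * (2 * \<tau>)"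
      using True N0 by (intro mult_left_mono) auto
    also have "\<dots> < \<tau> * L"
      using \<tau>(1) by (simp add: L_def algebra_simps)
    finally have "norm ((\<xi> t - \<xi> t0) /\<^sub>R \<tau>) < L"
      using \<tau>(1) unfolding norm_scaled by (simp add: pos_divide_less_eq mult.commute)
    from der[OF this, of "(t - t0) / \<tau>" "slip t"] show ?thesis
      unfolding grad_\<psi> frechet_derivative_test_function[OF \<phi>_test] .
  next
    case False
    then show ?thesis
      using grad_out[OF disjI1[OF time[OF False]]] \<theta>(3)[OF time[OF False]] by (simp add: grad_\<psi>)
  qed
  have h_out: "?h t = 0" if "t \<notin> {t0 - 2 * \<tau>..t0 + 2 * \<tau>}" for t
    using \<theta>(3)[OF time[OF that]] by simp
  have h_cont: "continuous_on {0..} ?h"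
    by (intro continuous_intros slip_continuous continuous_on_compose2[OF \<theta>(4)]) (use \<tau>(1) in auto)
  have c: "0 < t0 - 2 * \<tau>" using \<tau> by linarith
  have hi: "set_integrable lborel {0<..} ?h"
    by (rule integral_halfline_compact_support(1)[OF h_cont c, of "t0 + 2 * \<tau>"]) (rule h_out)
  have lower: "(norm w)\<^sup>2 * \<tau> \<le> (LINT t:{0<..}|lborel. ?h t)"
  proof -
    have "(norm w)\<^sup>2 * \<tau> = (LINT t|lborel. indicator {t0 - \<tau>..t0 + \<tau>} t *\<^sub>R ((norm w)\<^sup>2 / 2))"
      using \<tau>(1) by simp
    also have "\<dots> \<le> (LINT t:{0<..}|lborel. ?h t)"
      unfolding set_lebesgue_integral_def
    proof (rule integral_mono)
      show "integrable lborel (\<lambda>t. indicat_real {t0 - \<tau>..t0 + \<tau>} t *\<^sub>R ((norm w)\<^sup>2 / 2))"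
        by (intro integrable_scaleR_left integrable_real_indicator) (auto simp: emeasure_lborel_Icc_eq)
      show "integrable lborel (\<lambda>t. indicat_real {0<..} t *\<^sub>R ?h t)"
        using hi by (simp only: set_integrable_def)
      fix t
      have pos: "0 \<le> ?h t" if "0 < t"
      proof (cases "t \<in> {t0 - 2 * \<tau>..t0 + 2 * \<tau>}")
        case True
        then have "\<bar>t - t0\<bar> < d" using \<tau> by auto
        then have "0 \<le> w \<bullet> slip t"
          using w_slip[of t] that zero_le_power2[of "norm w"] by linarith
        then show ?thesis using \<theta>(1) by simp
      next
        case False
        show ?thesis by (rule eq_refl[OF h_out[OF False, symmetric]])
      qed
      show "indicat_real {t0 - \<tau>..t0 + \<tau>} t *\<^sub>R ((norm w)\<^sup>2 / 2) \<le> indicat_real {0<..} t *\<^sub>R ?h t"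
      proof (cases "t \<in> {t0 - \<tau>..t0 + \<tau>}")
        case True
        then have t: "0 < t" "\<bar>t - t0\<bar> < d" "(t - t0) / \<tau> \<in> {-1..1}"
          using \<tau> by (auto simp: field_simps)
        then show ?thesis
          using True w_slip[of t] \<theta>(2)[OF t(3)] by simp
      next
        case False
        then show ?thesis using pos by (cases "0 < t") (auto simp: indicator_def)
      qed
    qed
    finally show ?thesis .
  qed
  have upper: "(LINT t:{0<..}|lborel. transport_pairing \<psi> t) \<le> 4 * \<tau> * (C * \<epsilon>)"
  proof -
    have "(LINT t:{0<..}|lborel. transport_pairing \<psi> t)
        \<le> (LINT t|lborel. indicator {t0 - 2 * \<tau>..t0 + 2 * \<tau>} t *\<^sub>R (C * \<epsilon>))"
      unfolding set_lebesgue_integral_def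
    proof (rule integral_mono_AE)
      show "integrable lborel (\<lambda>t. indicat_real {0<..} t *\<^sub>R transport_pairing \<psi> t)"
        using transport_defect_identity(1)[OF \<psi>_test] by (simp only: set_integrable_def)
      show "AE t in lborel. indicat_real {0<..} t *\<^sub>R transport_pairing \<psi> t
          \<le> indicat_real {t0 - 2 * \<tau>..t0 + 2 * \<tau>} t *\<^sub>R (C * \<epsilon>)"
        using small
      proof eventually_elim
        case (elim t)
        show ?case
        proof (cases "t \<in> {t0 - 2 * \<tau>..t0 + 2 * \<tau>}")
          case True
          then have t: "t \<in> {0..T}" "0 < t" using \<tau> by (auto simp: T_def)
          have "grad \<psi> (t, x) = 0" if x: "\<delta> \<le> norm (\<xi> t - x)" for x
          proof -
            have "norm (\<xi> t - x) \<le> norm (\<xi> t - \<xi> t0) + norm (x - \<xi> t0)"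
              using norm_triangle_ineq4[of "\<xi> t - \<xi> t0" "x - \<xi> t0"] by simp
            moreover have "norm (\<xi> t - \<xi> t0) \<le> N * (2 * \<tau>)"
              using True N0 by (intro order_trans[OF lip[OF t(1)] mult_left_mono]) auto
            moreover have "N * (2 * \<tau>) \<le> \<tau> * L" "\<tau> * R \<le> \<tau> * \<bar>R\<bar>"
              using \<tau>(1) by (auto simp: L_def algebra_simps)
            ultimately have "\<tau> * R < norm (x - \<xi> t0)"
              using x \<tau>(4) by (simp add: distrib_left)
            then show ?thesis
              unfolding grad_\<psi> by (intro grad_out disjI2 far)
          qed
          moreover have "norm (grad \<psi> z) \<le> B" for z
            by (cases z) (simp add: grad_\<psi> B(2))
          ultimately have "\<bar>transport_pairing \<psi> t\<bar> \<le> B * (1 + M + \<gamma>) * \<epsilon>"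
            using elim t(1) \<psi>_test by blast
          then show ?thesis
            using True t(2) by (simp add: C_def)
        next
          case False
          then have "grad \<psi> (t, x) = 0" for x
            unfolding grad_\<psi> by (intro grad_out disjI1 time)
          then have "transport_pairing \<psi> t = 0"
            by (simp add: transport_pairing_def)
          then show ?thesis using False by simp
        qed
      qed
    qed (intro integrable_scaleR_left integrable_real_indicator, auto simp: emeasure_lborel_Icc_eq)
    also have "\<dots> = 4 * \<tau> * (C * \<epsilon>)"
      using \<tau>(1) by simp
    finally show ?thesis .
  qed
  have "\<gamma> * ((norm w)\<^sup>2 * \<tau>) \<le> \<gamma> * (LINT t:{0<..}|lborel. ?h t)"
    using lower \<gamma> by (intro mult_left_mono) auto
  also have "\<dots> = (LINT t:{0<..}|lborel. transport_pairing \<psi> t)"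
    unfolding transport_defect_identity(2)[OF \<psi>_test] h ..
  also note upper
  finally have "\<tau> * (\<gamma> * (norm w)\<^sup>2) \<le> \<tau> * (4 * (C * \<epsilon>))"
    by (simp add: mult_ac)
  then have "\<gamma> * (norm w)\<^sup>2 \<le> 4 * (C * \<epsilon>)"
    using \<tau>(1) by simp
  also have "\<dots> < \<gamma> * (norm w)\<^sup>2"
  proof -
    have "8 * (C + 1) * \<epsilon> = \<gamma> * (norm w)\<^sup>2"
      using C by (simp add: \<epsilon>_def)
    moreover have "0 \<le> C * \<epsilon>"
      using C \<epsilon> by simp
    ultimately show ?thesis
      using \<epsilon> by (simp add: algebra_simps)
  qed
  finally show False by simp
qed

lemma slip_eq_0:
  assumes "0 \<le> t"
  shows "slip t = 0"
proof -
  have "continuous_on (closure {0<..}) slip"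
    using slip_continuous by simp
  then show ?thesis
    by (rule continuous_constant_on_closure) (use assms slip_eq_0_interior in auto)
qed

lemma charge_velocity: "0 \<le> t \<Longrightarrow> (\<xi> has_vector_derivative perp (efield (\<rho> t) (\<xi> t))) (at t within {0..})"
  using \<xi>_deriv[of t] slip_eq_0[of t] by (simp add: slip_def)

lemma transport_distributional_drift: "transport_distributional drift \<rho>"
  unfolding transport_distributional_def
proof (intro allI impI)
  fix \<phi> :: "real \<times> (real^2) \<Rightarrow> real"
  assume \<phi>: "test_function ({0<..} \<times> UNIV) \<phi>"
  obtain B where B: "\<And>z. norm (grad \<phi> z) \<le> B"
    using grad_bounded[OF \<phi>] by blast
  have "indicat_real {0<..} t *\<^sub>R (grad \<phi> (t, \<xi> t) \<bullet> (0, slip t)) = 0" for t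
    by (cases "0 < t") (simp_all add: slip_eq_0 inner_prod_def)
  then have "(LINT t:{0<..}|lborel. grad \<phi> (t, \<xi> t) \<bullet> (0, slip t)) = 0"
    unfolding set_lebesgue_integral_def by (simp only:) simp
  with transport_defect_identity[OF \<phi>] transport_integrable[OF _ \<phi> B]
  show "(AE t in lborel. 0 < t \<longrightarrow> integrable (\<rho> t) (\<lambda>x. frechet_derivative \<phi> (at (t, x)) (1, drift t x))) \<and>
      set_integrable lborel {0<..} (\<lambda>t. LINT x|\<rho> t. frechet_derivative \<phi> (at (t, x)) (1, drift t x)) \<and>
      (LINT t:{0<..}|lborel. LINT x|\<rho> t. frechet_derivative \<phi> (at (t, x)) (1, drift t x)) = 0"
    by (simp add: frechet_derivative_test_function[OF \<phi>] transport_pairing_def[abs_def])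
qed

end

theorem theorem1p6:
  fixes \<gamma> p :: real
    and f0 :: "real \<Rightarrow> (real^2) \<times> (real^2) \<Rightarrow> real"
    and \<xi>0 \<eta>0 :: "real \<Rightarrow> real^2"
    and f :: "real \<Rightarrow> real \<Rightarrow> (real^2) \<times> (real^2) \<Rightarrow> real"
    and \<xi>e \<eta>e :: "real \<Rightarrow> real \<Rightarrow> real^2"
    and e :: "nat \<Rightarrow> real"
    and \<rho> :: "real \<Rightarrow> (real^2) measure"
    and \<xi> :: "real \<Rightarrow> real^2"
  assumes "\<gamma> > 0"
    and "admissible_family \<gamma> f0 \<xi>0 \<eta>0"
    and "\<And>\<epsilon>. \<epsilon> \<in> {0<..<1} \<Longrightarrow>
           vp_global_solution \<gamma> \<epsilon> (f0 \<epsilon>) (\<xi>0 \<epsilon>) (\<eta>0 \<epsilon>) (f \<epsilon>) (\<xi>e \<epsilon>) (\<eta>e \<epsilon>)"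
    and "\<And>n. e n \<in> {0<..<1}" and "e \<longlonglongrightarrow> 0"
    and "in_Cw \<rho>" and "in_Linf_Hm1 \<rho>"
    and "Cw_tendsto (\<lambda>n t. spatial_measure (f (e n) t)) \<rho>"
    and "\<And>T. T > 0 \<Longrightarrow> (\<lambda>n. holder_norm (1/2) T (\<lambda>t. \<xi>e (e n) t - \<xi> t)) \<longlonglongrightarrow> 0"
    and "vortex_equation (\<lambda>t. add_charge \<gamma> (\<rho> t) (\<xi> t))"
    and "p > 2" and "in_Linf_loc_Lp p \<rho>"
    and "C1_halfline \<xi>"
  shows "(\<forall>t\<ge>0. \<forall>x. integrable (\<rho> t) (\<lambda>y. coulomb (x - y)))
    \<and> transport_distributional
        (\<lambda>t x. perp (efield (\<rho> t) x) + \<gamma> *\<^sub>R (perp (x - \<xi> t) /\<^sub>R (norm (x - \<xi> t))\<^sup>2)) \<rho>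
    \<and> (\<forall>t\<ge>0. (\<xi> has_vector_derivative perp (efield (\<rho> t) (\<xi> t))) (at t within {0..}))"
proof -
  have mass: "measure (\<rho> t) UNIV \<le> 1" if t: "0 \<le> t" for t
  proof (rule Cw_limit_mass_le[OF assms(8) assms(6) t])
    show "sets (spatial_measure (f (e n) t)) = sets borel" for n
      by (simp add: spatial_measure_def)
    show "emeasure (spatial_measure (f (e n) t)) UNIV \<le> 1" for n
    proof -
      note adm = admissible_family_mass[OF assms(2) assms(4)[of n]]
      have "emeasure (spatial_measure (f (e n) t)) UNIV \<le> ennreal (L1_norm (f0 (e n)))"
        by (rule solution_mass_le[OF assms(3)[OF assms(4)] adm(1) t])
      also have "\<dots> \<le> ennreal 1"
        by (rule ennreal_leI[OF adm(2)])
      finally show ?thesis by simp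
    qed
  qed
  obtain \<xi>' where \<xi>': "continuous_on {0..} \<xi>'"
    "\<And>t. 0 \<le> t \<Longrightarrow> (\<xi> has_vector_derivative \<xi>' t) (at t within {0..})"
    using assms(13) unfolding C1_halfline_def by blast
  interpret vortex_with_charge \<rho> p \<gamma> \<xi> \<xi>'
    by unfold_locales (fact assms(6) assms(11) assms(12) mass assms(1) \<xi>' assms(10))+
  have "(\<lambda>t x. perp (efield (\<rho> t) x) + \<gamma> *\<^sub>R (perp (x - \<xi> t) /\<^sub>R (norm (x - \<xi> t))\<^sup>2)) = drift"
    by (intro ext) (simp add: drift_def coulomb_def perp_simps)
  then show ?thesis
    using coulomb_integrable transport_distributional_drift charge_velocity by simp
qed

end
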